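(* Let $\Omega\subset\mathbb{R}^m$ be a bounded domain. Let $A\subset\Gamma\subset\Omega$ be such that $\Gamma$ is relatively closed in $\Omega$, $H_{m-1}(\bar A)=0$, and $\Gamma\setminus A$ is a $C^1$-smooth $(m-1)$-dimensional manifold. Suppose $\Omega\setminus\Gamma=\bigcup_{j=1}^{\infty}\Omega_j$ is the union of at most countably many (disjoint) domains $\Omega_j$ with $\partial\Omega_j\subset\partial\Omega\cup\Gamma$. View $\Omega\setminus\Gamma$ as the domains $\Omega_j$ obtained by cutting $\Omega$ apart along $\Gamma$, so that $\Gamma\setminus A$ is counted as two copies of $\Gamma\setminus A$ (one for each side), and let $\nu_j$ denote the outward unit normal to $\partial\Omega_j$, which exists at every point of $\partial\Omega_j\cap(\Gamma\setminus A)$; at such a point $p$ there is another index $l$ (possibly $l=j$, the two sides then belonging to the same domain) such that $\nu_l=-\nu_j$. Let $\vec F\in C^1(\Omega\setminus\Gamma)\cap L^1_{loc}(\Omega)$ be a vector field and $H\in C^0(\Omega\setminus\Gamma)\cap L^1_{loc}(\Omega)$. Suppose $u\in C^1(\Omega\setminus\Gamma)\cap W^1(\Omega)$ has no singular points in $\Omega\setminus\Gamma$, and let $N_j(u)$ denote the restriction of $N(u)$ to $\Omega_j$. Suppose that for every $j$, $N_j(u)\in C^0\big(\Omega_j\cup(\partial\Omega_j\cap(\Gamma\setminus A))\big)\cap C^1(\Omega_j)$ satisfies $\operatorname{div}N_j(u)=H$ in $\Omega_j$. Then $u$ is a weak solution to $\operatorname{div}\frac{\nabla u+\vec F}{|\nabla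 u+\vec F|}=H$ in $\Omega$ if and only if for each $p\in\Gamma\setminus A$ there exist $j,l$ as described (the indices of the domains on the two sides of $\Gamma$ at $p$, with $\nu_l=-\nu_j$) such that at $p$ $$(N_j(u)-N_l(u))\cdot\nu_j=(N_j(u)-N_l(u))\cdot\nu_l=0,$$ where $N_j(u)$ and $N_l(u)$ at $p$ are the boundary values from the respective sides.
   Context: $H_{m-1}$ is the $(m-1)$-dimensional Hausdorff measure. $W^1(\Omega)$ is the space of weakly differentiable functions on $\Omega$. $S(u)=\{\nabla u+\vec F=0\}$ is the singular set of $u$, whose points are called singular points, and $N(u)=\frac{\nabla u+\vec F}{|\nabla u+\vec F|}$ away from $S(u)$. $u\in W^1(\Omega)$ is a weak solution to $\operatorname{div}N(u)=H$ in $\Omega$ if for every $\varphi\in C_0^\infty(\Omega)$ $$\int_{S(u)}|\nabla\varphi|+\int_{\Omega\setminus S(u)}N(u)\cdot\nabla\varphi+\int_\Omega H\varphi\ge0.$$ *)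

theory Defs
  imports "HOL-Analysis.Analysis"
begin

definition domain :: "'a::euclidean_space set \<Rightarrow> bool" where
  "domain D \<longleftrightarrow> open D \<and> connected D \<and> D \<noteq> {}"

text \<open>The dimension is a natural number so that \<open>0 ^ 0 = 1\<close> gives points full weight when
  \<open>k = 0\<close> (with \<open>powr\<close> they would have weight \<open>0\<close>); the empty set then needs
  weight \<open>0\<close> explicitly.\<close>

definition hausdorff_weight :: "nat \<Rightarrow> 'a::metric_space set \<Rightarrow> ennreal" where
  "hausdorff_weight k C =
     (if C = {} then 0 else ennreal (unit_ball_vol (real k) * (diameter C / 2) ^ k))"

definition hausdorff_premeasure :: "nat \<Rightarrow> real \<Rightarrow> 'a::metric_space set \<Rightarrow> ennreal" where
  "hausdorff_premeasure k \<delta> E =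
     (INF C \<in> {C :: nat \<Rightarrow> 'a set. E \<subseteq> (\<Union>i. C i) \<and> (\<forall>i. bounded (C i) \<and> diameter (C i) \<le> \<delta>)}.
        \<Sum>i. hausdorff_weight k (C i))"

definition hausdorff_measure :: "nat \<Rightarrow> 'a::metric_space set \<Rightarrow> ennreal" where
  "hausdorff_measure k E = (SUP \<delta>\<in>{0<..}. hausdorff_premeasure k \<delta> E)"

text \<open>\<open>C^k\<close> on an open set, by recursion on the partial derivatives.\<close>

primrec Ck_on :: "nat \<Rightarrow> 'a::euclidean_space set \<Rightarrow> ('a \<Rightarrow> 'b::real_normed_vector) \<Rightarrow> bool" where
  "Ck_on 0 S f \<longleftrightarrow> continuous_on S f"
| "Ck_on (Suc k) S f \<longleftrightarrow>
     (\<forall>x\<in>S. f differentiable (at x)) \<and>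
     (\<forall>b\<in>Basis. Ck_on k S (\<lambda>x. frechet_derivative f (at x) b))"

definition grad :: "('a::euclidean_space \<Rightarrow> real) \<Rightarrow> 'a \<Rightarrow> 'a" where
  "grad f x = (THE D. GDERIV f x :> D)"

definition divergence :: "('a::euclidean_space \<Rightarrow> 'a) \<Rightarrow> 'a \<Rightarrow> real" where
  "divergence V x = (\<Sum>b\<in>Basis. frechet_derivative V (at x) b \<bullet> b)"

definition test_functions :: "'a::euclidean_space set \<Rightarrow> ('a \<Rightarrow> real) set" where
  "test_functions \<Omega> =
     {\<phi>. (\<forall>k. Ck_on k UNIV \<phi>) \<and> compact (closure {x. \<phi> x \<noteq> 0}) \<and> closure {x. \<phi> x \<noteq> 0} \<subseteq> \<Omega>}"

definition locally_L1 :: "'a::euclidean_space set \<Rightarrow> ('a \<Rightarrow> 'b::euclidean_space) \<Rightarrow> bool" where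
  "locally_L1 \<Omega> f \<longleftrightarrow> (\<forall>K. compact K \<and> K \<subseteq> \<Omega> \<longrightarrow> f absolutely_integrable_on K)"

definition weak_gradient ::
    "'a::euclidean_space set \<Rightarrow> ('a \<Rightarrow> real) \<Rightarrow> ('a \<Rightarrow> 'a) \<Rightarrow> bool" where
  "weak_gradient \<Omega> u Du \<longleftrightarrow> locally_L1 \<Omega> u \<and> locally_L1 \<Omega> Du \<and>
     (\<forall>\<phi>\<in>test_functions \<Omega>. \<forall>b\<in>Basis.
        (LINT x:\<Omega>|lebesgue. u x * (grad \<phi> x \<bullet> b)) = - (LINT x:\<Omega>|lebesgue. (Du x \<bullet> b) * \<phi> x))"

definition weakly_differentiable :: "'a::euclidean_space set \<Rightarrow> ('a \<Rightarrow> real) \<Rightarrow> bool" where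
  "weakly_differentiable \<Omega> u \<longleftrightarrow> (\<exists>Du. weak_gradient \<Omega> u Du)"

text \<open>In the next two definitions \<open>Du\<close> is the gradient field of the function under
  consideration: its classical gradient where that exists, or a representative of its weak
  gradient.\<close>

definition singular_set :: "'a::euclidean_space set \<Rightarrow> ('a \<Rightarrow> 'a) \<Rightarrow> ('a \<Rightarrow> 'a) \<Rightarrow> 'a set" where
  "singular_set \<Omega> Du F = {x\<in>\<Omega>. Du x + F x = 0}"

definition N_field :: "('a::euclidean_space \<Rightarrow> 'a) \<Rightarrow> ('a \<Rightarrow> 'a) \<Rightarrow> 'a \<Rightarrow> 'a" where
  "N_field Du F x = (Du x + F x) /\<^sub>R norm (Du x + F x)"

text \<open>The weak gradient is determined up to a null set, which changes neither of the
  integrals below, so any representative may be used.\<close>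

definition weak_solution ::
    "'a::euclidean_space set \<Rightarrow> ('a \<Rightarrow> 'a) \<Rightarrow> ('a \<Rightarrow> real) \<Rightarrow> ('a \<Rightarrow> real) \<Rightarrow> bool" where
  "weak_solution \<Omega> F H u \<longleftrightarrow> (\<exists>Du. weak_gradient \<Omega> u Du \<and>
     (\<forall>\<phi>\<in>test_functions \<Omega>.
        (LINT x:singular_set \<Omega> Du F|lebesgue. norm (grad \<phi> x))
        + (LINT x:\<Omega> - singular_set \<Omega> Du F|lebesgue. N_field Du F x \<bullet> grad \<phi> x)
        + (LINT x:\<Omega>|lebesgue. H x * \<phi> x) \<ge> 0))"

text \<open>A \<open>C^1\<close> manifold of codimension one in Euclidean space (embedded, without boundary)
  is locally the zero set of a \<open>C^1\<close> function with nowhere vanishing gradient.\<close>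

definition local_equation :: "'a::euclidean_space set \<Rightarrow> 'a set \<Rightarrow> ('a \<Rightarrow> real) \<Rightarrow> bool" where
  "local_equation M U g \<longleftrightarrow>
     open U \<and> Ck_on 1 U g \<and> (\<forall>x\<in>U. grad g x \<noteq> 0) \<and> M \<inter> U = {x\<in>U. g x = 0}"

definition C1_hypersurface :: "'a::euclidean_space set \<Rightarrow> bool" where
  "C1_hypersurface M \<longleftrightarrow> (\<forall>p\<in>M. \<exists>U g. p \<in> U \<and> local_equation M U g)"

definition unit_normal :: "('a::euclidean_space \<Rightarrow> real) \<Rightarrow> 'a \<Rightarrow> 'a" where
  "unit_normal g p = grad g p /\<^sub>R norm (grad g p)"

text \<open>Cutting along \<open>M = \<Gamma> - A\<close> replaces each \<open>p \<in> M\<close> by two copies, one for each side.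
  The copy belonging to a side is encoded as \<open>(p, \<nu>)\<close>, where \<open>\<nu>\<close> is the unit normal at \<open>p\<close>
  pointing out of that side. The side is \<open>{x\<in>U. g x < 0}\<close> for a local equation \<open>g\<close> of \<open>M\<close>
  with unit normal \<open>\<nu>\<close> at \<open>p\<close>, and the copy lies on the boundary of \<open>D\<close> if that side belongs
  to \<open>D\<close>. Points of \<open>\<Gamma>\<close> have to be taken out of the side because \<open>A\<close> may accumulate at \<open>p\<close>
  off \<open>M\<close>.\<close>

definition side_nhd ::
    "'a::euclidean_space set \<Rightarrow> 'a set \<Rightarrow> 'a set \<Rightarrow> 'a \<Rightarrow> 'a \<Rightarrow> 'a set \<Rightarrow> ('a \<Rightarrow> real) \<Rightarrow> bool" where
  "side_nhd \<Gamma> A D p \<nu> U g \<longleftrightarrow>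
     p \<in> (\<Gamma> - A) \<inter> U \<and> local_equation (\<Gamma> - A) U g \<and> unit_normal g p = \<nu> \<and>
     {x\<in>U. g x < 0} - \<Gamma> \<subseteq> D"

definition outward_normal ::
    "'a::euclidean_space set \<Rightarrow> 'a set \<Rightarrow> 'a set \<Rightarrow> 'a \<Rightarrow> 'a \<Rightarrow> bool" where
  "outward_normal \<Gamma> A D p \<nu> \<longleftrightarrow> (\<exists>U g. side_nhd \<Gamma> A D p \<nu> U g)"

text \<open>\<open>f \<in> C^0(D \<union> (\<partial>D \<inter> (\<Gamma> - A)))\<close> with two copies of \<open>\<Gamma> - A\<close>: \<open>f\<close> on \<open>D\<close> together with the
  values \<open>bv p \<nu>\<close> at the boundary copies \<open>(p, \<nu>)\<close> is continuous. A basic neighbourhood of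
  \<open>(p, \<nu>)\<close> consists of a one-sided neighbourhood in \<open>D\<close> and the copies of the points of
  \<open>\<Gamma> - A\<close> adjacent to it.\<close>

definition continuous_on_cut ::
    "'a::euclidean_space set \<Rightarrow> 'a set \<Rightarrow> 'a set \<Rightarrow> ('a \<Rightarrow> 'a) \<Rightarrow> ('a \<Rightarrow> 'a \<Rightarrow> 'a) \<Rightarrow> bool" where
  "continuous_on_cut \<Gamma> A D f bv \<longleftrightarrow> continuous_on D f \<and>
     (\<forall>p \<nu>. outward_normal \<Gamma> A D p \<nu> \<longrightarrow>
       (\<forall>\<epsilon>>0. \<exists>U g. side_nhd \<Gamma> A D p \<nu> U g \<and>
          (\<forall>x\<in>{x\<in>U. g x < 0} - \<Gamma>. dist (f x) (bv p \<nu>) < \<epsilon>) \<and>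
          (\<forall>q\<in>(\<Gamma> - A) \<inter> U. dist (bv q (unit_normal g q)) (bv p \<nu>) < \<epsilon>)))"

end

theory Submission
  imports Defs
begin

text \<open>Off \<open>\<Gamma>\<close> the weak gradient is the classical one and \<open>\<Gamma>\<close> is a null set, so the singular set
  is null and (testing with \<open>\<phi>\<close> and \<open>-\<phi>\<close>) \<open>u\<close> is a weak solution iff the integral of
  \<open>N \<bullet> \<nabla>\<phi> + H \<phi>\<close> over \<open>\<Omega> - \<Gamma>\<close> vanishes for all test functions \<open>\<phi>\<close>. Covering \<open>closure A\<close> by balls of small total
  \<open>(m-1)\<close>-dimensional size gives cut-off functions with \<open>L\<^sup>1\<close>-small gradients; as \<open>|N| \<le> 1\<close>, the
  set \<open>A\<close> is invisible to this functional. Near a point of \<open>\<Gamma> - A = {g = 0}\<close> the cut-offs \<open>P(n g)\<close>,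
  with \<open>P\<close> even and vanishing near \<open>0\<close>, reduce the functional to the limit of
  \<open>- \<integral> \<phi> n P'(n g) (N \<bullet> \<nabla>g)\<close>, that is, to the jump of \<open>N \<bullet> \<nabla>g\<close> across \<open>\<Gamma>\<close>. These layer integrals
  are evaluated by \<open>n P'(n g) \<partial>\<^sub>b g = \<partial>\<^sub>b (P(n g))\<close> and a further integration by parts, so that no
  surface measure is needed. Finally, \<open>closure A\<close> being too small to meet all
  parallel translates of a segment, each side of \<open>\<Gamma>\<close> near \<open>p\<close> lies in a single \<open>\<Omega>\<^sub>j\<close>.\<close>

subsection \<open>Compactly supported C1 functions\<close>

text \<open>Cut-offs composed with a local equation \<open>g\<close> are only C^1, because
  \<open>g\<close> is, so the smooth test functions are not stable under the multiplications that
  occur. All identities are therefore proved for C^1 functions of compact support. The two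
  implications meet different obstacles. For necessity, the limit of the layer integrals is the
  normal jump times a surface integral, and this factor has to be shown to be positive although no
  surface measure is at hand. For sufficiency, the normal component is merely continuous across
  \<open>\<Gamma> - A\<close> and cannot itself be integrated by parts. Moreover a point of
  \<open>\<Gamma> - A\<close> may lie in \<open>closure A\<close>, since \<open>A\<close> may
  accumulate there. For necessity such a point is treated like any other, because
  \<open>closure A\<close> is removed inside the layer; for sufficiency it is discarded together
  with \<open>closure A\<close>.\<close>

lemma GDERIV_unique: "GDERIV f x :> D \<Longrightarrow> GDERIV f x :> E \<Longrightarrow> D = E"
  unfolding gderiv_def by (metis has_derivative_unique inner_commute vector_eq_rdot)

lemma grad_eqI: "GDERIV f x :> D \<Longrightarrow> grad f x = D"
  unfolding grad_def using GDERIV_unique by blast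

lemma GDERIV_inner_component:
  assumes "f differentiable (at x)"
  shows "GDERIV (\<lambda>y. f y \<bullet> c) x :> (\<Sum>b\<in>Basis. (frechet_derivative f (at x) b \<bullet> c) *\<^sub>R b)"
proof -
  let ?D = "frechet_derivative f (at x)"
  have d: "(f has_derivative ?D) (at x)" using assms frechet_derivative_works by blast
  have d1: "((\<lambda>y. f y \<bullet> c) has_derivative (\<lambda>h. ?D h \<bullet> c)) (at x)"
    by (rule has_derivative_inner_left[OF d])
  have d2: "?D h \<bullet> c = h \<bullet> (\<Sum>b\<in>Basis. (?D b \<bullet> c) *\<^sub>R b)" for h
  proof -
    have "linear ?D" by (rule has_derivative_linear[OF d])
    then have "?D h = (\<Sum>b\<in>Basis. (h \<bullet> b) *\<^sub>R ?D b)"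
      by (subst (1) euclidean_representation[of h, symmetric]) (simp only: linear_sum linear_cmul)
    then show ?thesis by (simp add: inner_sum_left inner_sum_right ac_simps)
  qed
  show ?thesis unfolding gderiv_def
    by (rule has_derivative_eq_rhs[OF d1]) (rule ext, rule d2)
qed

lemma
  assumes "Ck_on 1 U g"
  shows Ck_on_1_GDERIV: "x \<in> U \<Longrightarrow> GDERIV g x :> grad g x"
    and Ck_on_1_continuous_grad: "continuous_on U (grad g)"
proof -
  have d: "g differentiable (at x)" if "x \<in> U" for x using assms that by simp
  have G: "GDERIV g x :> (\<Sum>b\<in>Basis. frechet_derivative g (at x) b *\<^sub>R b)" if "x \<in> U" for x
    using GDERIV_inner_component[OF d[OF that], of 1] by simp
  show "x \<in> U \<Longrightarrow> GDERIV g x :> grad g x" for x using G grad_eqI by metis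
  have "continuous_on U (\<lambda>x. \<Sum>b\<in>Basis. frechet_derivative g (at x) b *\<^sub>R b)"
    using assms by (intro continuous_intros) auto
  then show "continuous_on U (grad g)"
    using G grad_eqI by (metis (no_types, lifting) continuous_on_cong)
qed

lemma GDERIV_isCont: "GDERIV f x :> D \<Longrightarrow> isCont f x"
  unfolding gderiv_def using has_derivative_continuous by blast

lemma GDERIV_continuous_on: "(\<And>x. x \<in> S \<Longrightarrow> GDERIV f x :> Df x) \<Longrightarrow> continuous_on S f"
  by (meson GDERIV_isCont continuous_at_imp_continuous_on)

text \<open>The gradient is an argument, so that product and chain rules supply it directly. The
  support is controlled by a compact subset of \<open>W\<close>; the set \<open>W\<close> itself may
  fail to be open, as will \<open>\<Omega> - M\<close> below.\<close>

definition C1c :: "'a::euclidean_space set \<Rightarrow> ('a \<Rightarrow> real) \<Rightarrow> ('a \<Rightarrow> 'a) \<Rightarrow> bool" where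
  "C1c W f Df \<longleftrightarrow> (\<forall>x. GDERIV f x :> Df x) \<and> continuous_on UNIV Df \<and>
     (\<exists>K. K \<subseteq> W \<and> compact K \<and> (\<forall>x. x \<notin> K \<longrightarrow> f x = 0))"

lemma C1c_GDERIV: "C1c W f Df \<Longrightarrow> GDERIV f x :> Df x"
  by (simp add: C1c_def)

lemma C1c_continuous_D: "C1c W f Df \<Longrightarrow> continuous_on S Df"
  by (auto simp: C1c_def intro: continuous_on_subset)

lemma C1c_continuous: "C1c W f Df \<Longrightarrow> continuous_on S f"
  by (metis C1c_GDERIV GDERIV_continuous_on)

lemma C1c_mono: "C1c W f Df \<Longrightarrow> W \<subseteq> W' \<Longrightarrow> C1c W' f Df"
  unfolding C1c_def by (elim conjE exE, intro conjI exI) auto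

lemma C1c_support:
  assumes "C1c W f Df"
  obtains K where "compact K" "K \<subseteq> W" "\<And>x. x \<notin> K \<Longrightarrow> f x = 0" "\<And>x. x \<notin> K \<Longrightarrow> Df x = 0"
proof -
  obtain K where K: "K \<subseteq> W" "compact K" and K0: "\<forall>x. x \<notin> K \<longrightarrow> f x = 0"
    using conjunct2[OF conjunct2[OF assms[unfolded C1c_def]]] by (elim exE conjE) (rule that)
  have "Df x = 0" if "x \<notin> K" for x
  proof -
    have "open (- K)" by (rule open_Compl[OF compact_imp_closed[OF K(2)]])
    then have "((\<lambda>y. f y) has_derivative (\<lambda>h. 0)) (at x)"
      using has_derivative_transform_within_open[of "\<lambda>y. 0::real" "\<lambda>h. 0" x UNIV "- K" f]
        that K0 by auto
    then have "GDERIV f x :> 0" by (simp add: gderiv_def)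
    then show ?thesis using C1c_GDERIV[OF assms] GDERIV_unique by blast
  qed
  then show ?thesis using K K0 by (intro that) auto
qed

lemma integrable_continuous_compact_support:
  fixes f :: "'a::euclidean_space \<Rightarrow> 'b::{banach, second_countable_topology}"
  assumes "continuous_on K f" "compact K" "\<And>x. x \<notin> K \<Longrightarrow> f x = 0"
  shows "integrable lborel f"
proof -
  have "integrable lborel (\<lambda>x. indicator K x *\<^sub>R f x)"
    using borel_integrable_compact[OF assms(2,1)] .
  moreover have "indicator K x *\<^sub>R f x = f x" for x
    using assms(3) by (auto simp: indicator_def)
  ultimately show ?thesis by simp
qed

lemma bounded_continuous_compact_support:
  fixes f :: "'a::topological_space \<Rightarrow> 'b::real_normed_vector"
  assumes "continuous_on K f" "compact K" "\<And>x. x \<notin> K \<Longrightarrow> f x = 0"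
  obtains B where "0 < B" "\<And>x. norm (f x) \<le> B"
proof -
  have "bounded (f ` K)" by (rule compact_imp_bounded[OF compact_continuous_image[OF assms(1,2)]])
  then obtain B where B: "\<forall>y \<in> f ` K. norm y \<le> B"
    unfolding bounded_iff by blast
  have "norm (f x) \<le> max B 1" for x
    using B assms(3)[of x] by (cases "x \<in> K") (auto simp: max_def)
  then show ?thesis using that[of "max B 1"] by auto
qed

lemma C1c_bounds:
  assumes "C1c W f Df"
  obtains B where "0 < B" "\<And>x. \<bar>f x\<bar> \<le> B" "\<And>x. norm (Df x) \<le> B"
proof -
  obtain K where K: "compact K" "K \<subseteq> W" "\<And>x. x \<notin> K \<Longrightarrow> f x = 0" "\<And>x. x \<notin> K \<Longrightarrow> Df x = 0"
    using C1c_support[OF assms] by blast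
  obtain B1 where "0 < B1" "\<And>x. norm (f x) \<le> B1"
    using bounded_continuous_compact_support[OF C1c_continuous[OF assms] K(1,3)] by blast
  moreover obtain B2 where "0 < B2" "\<And>x. norm (Df x) \<le> B2"
    using bounded_continuous_compact_support[OF C1c_continuous_D[OF assms] K(1,4)] by blast
  ultimately show ?thesis using that[of "max B1 B2"]
    by (simp add: less_max_iff_disj le_max_iff_disj)
qed

lemma C1c_integrable: "C1c W f Df \<Longrightarrow> integrable lborel f"
  using C1c_support[of W f Df] integrable_continuous_compact_support[OF C1c_continuous[of W f Df]]
  by metis

lemma C1c_integrable_D: "C1c W f Df \<Longrightarrow> integrable lborel Df"
  using C1c_support[of W f Df] integrable_continuous_compact_support[OF C1c_continuous_D[of W f Df]]
  by metis

lemma integral_lborel_translate: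
  fixes f :: "'a::euclidean_space \<Rightarrow> real"
  assumes "f \<in> borel_measurable borel"
  shows "(LBINT x. f (x + c)) = (LBINT x. f x)"
proof -
  have "(LBINT x. f x) = (\<integral>x. f x \<partial>(distr lborel borel ((+) c)))"
    by (simp add: lborel_distr_plus)
  also have "\<dots> = (LBINT x. f (c + x))"
    using assms by (subst integral_distr) auto
  finally show ?thesis by (simp add: add.commute)
qed

text \<open>The difference quotients of \<open>f\<close> have integral \<open>0\<close> by translation invariance, and they
  converge to the directional derivative boundedly on a compact set.\<close>

lemma C1c_integral_D:
  fixes b :: "'a::euclidean_space"
  assumes "C1c W f Df"
  shows "(LBINT x. Df x \<bullet> b) = 0"
proof -
  obtain K where K: "compact K" "K \<subseteq> W" "\<And>x. x \<notin> K \<Longrightarrow> f x = 0" "\<And>x. x \<notin> K \<Longrightarrow> Df x = 0"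
    using C1c_support[OF assms] by blast
  obtain B where B: "0 < B" "\<And>x. \<bar>f x\<bar> \<le> B" "\<And>x. norm (Df x) \<le> B"
    using C1c_bounds[OF assms] by blast
  obtain R where R: "\<And>x. x \<in> K \<Longrightarrow> norm x \<le> R"
    using compact_imp_bounded[OF K(1)] by (auto simp: bounded_iff)
  define h where "h n = inverse (real (Suc n))" for n
  have h: "0 < h n" "h n \<le> 1" for n
    by (auto simp: h_def divide_simps)
  have h0: "h \<longlonglongrightarrow> 0" unfolding h_def by (rule LIMSEQ_inverse_real_of_nat)
  define s where "s n x = (f (x + h n *\<^sub>R b) - f x) / h n" for n x
  have fb: "f \<in> borel_measurable borel"
    by (rule borel_measurable_continuous_onI[OF C1c_continuous[OF assms]])
  have Db: "(\<lambda>x. Df x \<bullet> b) \<in> borel_measurable borel"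
    by (intro borel_measurable_continuous_onI continuous_intros C1c_continuous_D[OF assms])
  have bound: "norm (s n x) \<le> B * norm b * indicator (cball 0 (R + norm b)) x" for n x
  proof (cases "x \<in> cball 0 (R + norm b)")
    case True
    have "norm (f (x + h n *\<^sub>R b) - f x) \<le> B * norm (x + h n *\<^sub>R b - x)"
    proof (rule differentiable_bound[where S = UNIV and f' = "\<lambda>x v. v \<bullet> Df x"])
      show "(f has_derivative (\<lambda>v. v \<bullet> Df y)) (at y within UNIV)" for y
        using C1c_GDERIV[OF assms] by (simp add: gderiv_def)
      show "onorm (\<lambda>v. v \<bullet> Df y) \<le> B" for y
        by (rule onorm_le) (metis B(3) mult.commute mult_left_mono Cauchy_Schwarz_ineq2 norm_ge_zero order_trans real_norm_def)
    qed auto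
    then show ?thesis using True h[of n] by (simp add: s_def field_simps)
  next
    case False
    have "h n * norm b \<le> norm b" using h[of n] by (simp add: mult_left_le_one_le)
    then have "norm (x + h n *\<^sub>R b) > R"
      using False norm_triangle_ineq4[of "x + h n *\<^sub>R b" "h n *\<^sub>R b"] h[of n] by auto
    moreover have "norm x > R" using False norm_ge_zero[of b] by (smt (verit) mem_cball_0)
    ultimately have "x \<notin> K" "x + h n *\<^sub>R b \<notin> K" using R by (metis not_le)+
    then show ?thesis using False K(3) by (simp add: s_def)
  qed
  have lim: "(\<lambda>n. s n x) \<longlonglongrightarrow> Df x \<bullet> b" for x
  proof -
    have "(f has_derivative (\<lambda>v. v \<bullet> Df x)) (at (x + 0 *\<^sub>R b))"
      using C1c_GDERIV[OF assms] by (simp add: gderiv_def)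
    moreover have "((\<lambda>t. x + t *\<^sub>R b) has_derivative (\<lambda>t. t *\<^sub>R b)) (at 0)"
      by (auto intro!: derivative_eq_intros)
    ultimately have "((\<lambda>t. f (x + t *\<^sub>R b)) has_derivative (\<lambda>t. (t *\<^sub>R b) \<bullet> Df x)) (at 0)"
      by (rule has_derivative_compose[rotated])
    then have "((\<lambda>t. f (x + t *\<^sub>R b)) has_field_derivative (Df x \<bullet> b)) (at 0)"
      by (simp add: has_field_derivative_def inner_commute mult.commute[of _ "Df x \<bullet> b"] mult_commute_abs)
    then have "((\<lambda>t. (f (x + t *\<^sub>R b) - f x) / t) \<longlongrightarrow> Df x \<bullet> b) (at 0)"
      by (simp add: has_field_derivative_iff)
    moreover have "filterlim h (at 0) sequentially"
      using h0 h by (simp add: filterlim_at order_less_imp_not_eq2)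
    ultimately show ?thesis unfolding s_def using filterlim_compose by blast
  qed
  have "(\<lambda>n. LBINT x. s n x) \<longlonglongrightarrow> (LBINT x. Df x \<bullet> b)"
  proof (rule integral_dominated_convergence[where w = "\<lambda>x. B * norm b * indicator (cball 0 (R + norm b)) x"])
    show "integrable lborel (\<lambda>x::'a. B * norm b * indicator (cball 0 (R + norm b)) x)"
      using borel_integrable_compact[of "cball (0::'a) (R + norm b)" "\<lambda>_. B * norm b"] by simp
    show "s n \<in> borel_measurable lborel" for n unfolding s_def using fb by measurable
  qed (use bound lim Db in auto)
  moreover have "(LBINT x. s n x) = 0" for n
  proof -
    have "integrable lborel (\<lambda>x. f (x + h n *\<^sub>R b))"
    proof (rule integrable_continuous_compact_support[where K = "(\<lambda>x. x - h n *\<^sub>R b) ` K"])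
      show "continuous_on ((\<lambda>x. x - h n *\<^sub>R b) ` K) (\<lambda>x. f (x + h n *\<^sub>R b))"
        by (rule continuous_on_compose2[OF C1c_continuous[OF assms, of UNIV]])
          (auto intro!: continuous_intros)
      show "compact ((\<lambda>x. x - h n *\<^sub>R b) ` K)"
        by (rule compact_continuous_image[OF _ K(1)]) (auto intro!: continuous_intros)
      show "f (x + h n *\<^sub>R b) = 0" if "x \<notin> (\<lambda>x. x - h n *\<^sub>R b) ` K" for x
        using that K(3)[of "x + h n *\<^sub>R b"] by (metis add_diff_cancel image_eqI)
    qed
    then show ?thesis
      using C1c_integrable[OF assms] integral_lborel_translate[OF fb, of "h n *\<^sub>R b"] by (simp add: s_def)
  qed
  ultimately show ?thesis using LIMSEQ_unique[of "\<lambda>n. 0::real"] by simp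
qed

text \<open>The factor \<open>v\<close> is controlled only on \<open>W\<close>, but \<open>f\<close>
  vanishes off a compact \<open>K\<close> inside \<open>W\<close>. The open sets \<open>W\<close>
  and \<open>- K\<close> cover the space, and the product is C^1 on each. The indicator discards the
  unknown values of \<open>Dv\<close> off \<open>W\<close>.\<close>

lemma C1c_mult:
  assumes "C1c W f Df" "open W" "\<And>x. x \<in> W \<Longrightarrow> GDERIV v x :> Dv x" "continuous_on W Dv"
  shows "C1c W (\<lambda>x. f x * v x) (\<lambda>x. indicator W x *\<^sub>R (f x *\<^sub>R Dv x + v x *\<^sub>R Df x))"
proof -
  obtain K where K: "compact K" "K \<subseteq> W" "\<And>x. x \<notin> K \<Longrightarrow> f x = 0" "\<And>x. x \<notin> K \<Longrightarrow> Df x = 0"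
    using C1c_support[OF assms(1)] by blast
  let ?D = "\<lambda>x. indicator W x *\<^sub>R (f x *\<^sub>R Dv x + v x *\<^sub>R Df x)"
  have o: "open (- K)" by (rule open_Compl[OF compact_imp_closed[OF K(1)]])
  have cv: "continuous_on W v" using assms(3) GDERIV_continuous_on by blast
  have "GDERIV (\<lambda>x. f x * v x) x :> ?D x" for x
  proof (cases "x \<in> W")
    case True
    then show ?thesis
      using GDERIV_mult[OF C1c_GDERIV[OF assms(1)] assms(3)[OF True]] by simp
  next
    case False
    then have "x \<in> - K" using K(2) by blast
    then have "((\<lambda>x. f x * v x) has_derivative (\<lambda>h. 0)) (at x)"
      using has_derivative_transform_within_open[of "\<lambda>y. 0::real" "\<lambda>h. 0" x UNIV "- K" "\<lambda>x. f x * v x"]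
        o K(3) by auto
    then show ?thesis using False by (simp add: gderiv_def)
  qed
  moreover have "continuous_on UNIV ?D"
  proof -
    have "continuous_on W (\<lambda>x. f x *\<^sub>R Dv x + v x *\<^sub>R Df x)"
      by (intro continuous_intros cv assms(4) C1c_continuous[OF assms(1)] C1c_continuous_D[OF assms(1)])
    then have "continuous_on W ?D" by (rule continuous_on_eq) auto
    moreover have "continuous_on (- K) ?D"
      by (rule continuous_on_eq[where f = "\<lambda>_. 0"]) (auto simp: K(3,4))
    ultimately have "continuous_on (W \<union> - K) ?D"
      using assms(2) o continuous_on_open_Un by blast
    moreover have "W \<union> - K = UNIV" using K(2) by auto
    ultimately show ?thesis by simp
  qed
  ultimately show ?thesis unfolding C1c_def using K by (metis mult_zero_left)
qed

lemma C1c_mult_UNIV: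
  assumes "C1c W f Df" "\<And>x. GDERIV v x :> Dv x" "continuous_on UNIV Dv"
  shows "C1c W (\<lambda>x. f x * v x) (\<lambda>x. f x *\<^sub>R Dv x + v x *\<^sub>R Df x)"
proof -
  obtain K where K: "compact K" "K \<subseteq> W" "\<And>x. x \<notin> K \<Longrightarrow> f x = 0" "\<And>x. x \<notin> K \<Longrightarrow> Df x = 0"
    using C1c_support[OF assms(1)] by blast
  have "C1c UNIV (\<lambda>x. f x * v x) (\<lambda>x. f x *\<^sub>R Dv x + v x *\<^sub>R Df x)"
    using C1c_mult[OF C1c_mono[OF assms(1)] open_UNIV assms(2,3)] by simp
  then show ?thesis unfolding C1c_def using K by (metis mult_zero_left)
qed

text \<open>The integrand is the derivative along \<open>b\<close> of the compactly supported
  product of \<open>f\<close> and \<open>v\<close>, so it integrates to zero.\<close>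

lemma C1c_integral_parts:
  assumes "C1c W f Df" "open W" "\<And>x. x \<in> W \<Longrightarrow> GDERIV v x :> Dv x" "continuous_on W Dv"
  shows "integrable lborel (\<lambda>x. indicator W x * (f x * (Dv x \<bullet> b) + v x * (Df x \<bullet> b)))"
    and "(LBINT x. indicator W x * (f x * (Dv x \<bullet> b) + v x * (Df x \<bullet> b))) = 0"
proof -
  note C = C1c_mult[OF assms]
  have eq: "indicator W x *\<^sub>R (f x *\<^sub>R Dv x + v x *\<^sub>R Df x) \<bullet> b
      = indicator W x * (f x * (Dv x \<bullet> b) + v x * (Df x \<bullet> b))" for x
    by (simp add: inner_add_left)
  show "integrable lborel (\<lambda>x. indicator W x * (f x * (Dv x \<bullet> b) + v x * (Df x \<bullet> b)))"
    using integrable_inner_left[OF C1c_integrable_D[OF C], of b] unfolding eq by simp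
  show "(LBINT x. indicator W x * (f x * (Dv x \<bullet> b) + v x * (Df x \<bullet> b))) = 0"
    using C1c_integral_D[OF C, of b] unfolding eq by simp
qed

lemma C1c_divergence:
  assumes "C1c W f Df" "open W" "Ck_on 1 W V"
  shows "(LBINT x. indicator W x * (V x \<bullet> Df x + divergence V x * f x)) = 0"
proof -
  define Dv where "Dv c x = (\<Sum>b\<in>Basis. (frechet_derivative V (at x) b \<bullet> c) *\<^sub>R b)" for c x
  have G: "GDERIV (\<lambda>y. V y \<bullet> c) x :> Dv c x" if "x \<in> W" for c x
    unfolding Dv_def by (rule GDERIV_inner_component) (use assms(3) that in simp)
  have cD: "continuous_on W (Dv c)" for c
    unfolding Dv_def using assms(3) by (intro continuous_intros) auto
  note P = C1c_integral_parts[OF assms(1,2) G cD]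
  have "indicator W x * (V x \<bullet> Df x + divergence V x * f x)
     = (\<Sum>b\<in>Basis. indicator W x * (f x * (Dv b x \<bullet> b) + (V x \<bullet> b) * (Df x \<bullet> b)))" for x
  proof -
    have "Dv b x \<bullet> b = frechet_derivative V (at x) b \<bullet> b" if "b \<in> Basis" for b
      using that unfolding Dv_def by (simp add: inner_sum_left inner_Basis sum.delta if_distrib cong: if_cong)
    moreover have "V x \<bullet> Df x = (\<Sum>b\<in>Basis. (V x \<bullet> b) * (Df x \<bullet> b))"
      by (rule euclidean_inner)
    ultimately show ?thesis
      by (simp add: divergence_def sum.distrib algebra_simps sum_distrib_left sum_distrib_right)
  qed
  then have eq: "(\<lambda>x. indicator W x * (V x \<bullet> Df x + divergence V x * f x))
     = (\<lambda>x. \<Sum>b\<in>Basis. indicator W x * (f x * (Dv b x \<bullet> b) + (V x \<bullet> b) * (Df x \<bullet> b)))"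
    by (rule ext)
  have "(LBINT x. indicator W x * (V x \<bullet> Df x + divergence V x * f x))
     = (\<Sum>b\<in>Basis. LBINT x. indicator W x * (f x * (Dv b x \<bullet> b) + (V x \<bullet> b) * (Df x \<bullet> b)))"
    unfolding eq by (intro Bochner_Integration.integral_sum P(1))
  then show ?thesis using P(2) by simp
qed

subsection \<open>A smooth step function and Hausdorff null sets\<close>

text \<open>The factor \<open>t powi (-k)\<close> makes the family closed under differentiation.\<close>

definition flat :: "nat \<Rightarrow> real \<Rightarrow> real" where
  "flat k t = (if 0 < t then exp (- inverse t) * inverse t ^ k else 0)"

lemma flat_nonneg: "0 \<le> flat k t"
  by (simp add: flat_def)

lemma flat_pos: "0 < t \<Longrightarrow> 0 < flat k t"
  by (simp add: flat_def)

lemma flat_zero: "t \<le> 0 \<Longrightarrow> flat k t = 0"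
  by (simp add: flat_def)

lemma flat_0_le_1: "flat 0 t \<le> 1"
  by (simp add: flat_def)

text \<open>Away from 0 this is the product rule. At 0 the difference quotient from the right is
  \<open>y ^ (k + 1) / exp y\<close> with \<open>y = inverse h\<close> tending to infinity, so
  exponential decay beats the power.\<close>

lemma DERIV_flat: "(flat k has_real_derivative flat (k + 2) t - real k * flat (k + 1) t) (at t)"
proof (cases t "0::real" rule: linorder_cases)
  case less
  have "((\<lambda>_. 0) has_real_derivative 0) (at t)" by simp
  then have "(flat k has_real_derivative 0) (at t)"
    by (rule has_field_derivative_transform_within_open[where S = "{..<0}"]) (auto simp: less flat_def)
  then show ?thesis using less by (simp add: flat_def)
next
  case greater
  have "((\<lambda>t. exp (- inverse t) * inverse t ^ k) has_real_derivative
      flat (k + 2) t - real k * flat (k + 1) t) (at t)"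
  proof (cases k)
    case 0
    then show ?thesis using greater
      by (auto intro!: derivative_eq_intros simp: flat_def power2_eq_square field_simps)
  next
    case (Suc n)
    have n: "n = 0 \<or> t ^ n = t * t ^ (n - Suc 0)" by (cases n) auto
    show ?thesis unfolding Suc using greater n
      by (elim disjE) (auto intro!: derivative_eq_intros simp: flat_def field_simps)
  qed
  then show ?thesis
    by (rule has_field_derivative_transform_within_open[where S = "{0<..}"]) (auto simp: greater flat_def)
next
  case equal
  have "((\<lambda>y::real. y ^ (k + 1) / exp y) \<longlongrightarrow> 0) at_top"
    by (rule tendsto_power_div_exp_0)
  then have "((\<lambda>h::real. inverse h ^ (k + 1) / exp (inverse h)) \<longlongrightarrow> 0) (at_right 0)"
    by (rule filterlim_compose[OF _ filterlim_inverse_at_top_right])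
  then have r: "((\<lambda>h. flat k h / h) \<longlongrightarrow> 0) (at_right 0)"
  proof (rule Lim_transform_eventually)
    have "inverse h ^ (k + 1) / exp (inverse h) = flat k h / h" if "0 < h" for h
      using that by (simp add: flat_def exp_minus divide_inverse mult.commute mult.left_commute)
    then show "\<forall>\<^sub>F h in at_right 0. inverse h ^ (k + 1) / exp (inverse h) = flat k h / h"
      by (rule eventually_mono[OF eventually_at_right_less])
  qed
  have "((\<lambda>h::real. 0::real) \<longlongrightarrow> 0) (at_left 0)" by simp
  then have l: "((\<lambda>h. flat k h / h) \<longlongrightarrow> 0) (at_left 0)"
    by (rule Lim_transform_eventually)
      (auto simp: eventually_at_left_field flat_def intro!: exI[of _ "-1"])
  have "((\<lambda>h. flat k h / h) \<longlongrightarrow> 0) (at 0)" by (rule filterlim_split_at_real[OF l r])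
  then show ?thesis using equal by (simp add: has_field_derivative_iff flat_def)
qed

lemma isCont_flat: "isCont (flat k) t"
  by (rule DERIV_isCont[OF DERIV_flat])

lemma continuous_on_flat: "continuous_on S (flat k)"
  using isCont_flat by (simp add: continuous_at_imp_continuous_on)

lemma continuous_on_flat_compose [continuous_intros]:
  "continuous_on S f \<Longrightarrow> continuous_on S (\<lambda>x. flat k (f x))"
  by (rule continuous_on_compose2[OF continuous_on_flat[of UNIV]]) auto

definition step :: "real \<Rightarrow> real" where
  "step t = flat 0 (t - 1) / (flat 0 (t - 1) + flat 0 (2 - t))"

text \<open>The quotient rule with \<open>flat 2\<close> as the derivative of \<open>flat 0\<close>.
  The products of \<open>flat 2 (t - 1)\<close> and \<open>flat 0 (t - 1)\<close> have cancelled,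
  which leaves a visibly nonnegative numerator.\<close>

definition step' :: "real \<Rightarrow> real" where
  "step' t = (flat 2 (t - 1) * flat 0 (2 - t) + flat 0 (t - 1) * flat 2 (2 - t)) /
     (flat 0 (t - 1) + flat 0 (2 - t))\<^sup>2"

lemma step_denominator_pos: "0 < flat 0 (t - 1) + flat 0 (2 - t)"
  using flat_nonneg[of 0 "t - 1"] flat_nonneg[of 0 "2 - t"] flat_pos[of "t - 1" 0] flat_pos[of "2 - t" 0]
  by (cases "t > 1") auto

lemma DERIV_step: "(step has_real_derivative step' t) (at t)"
proof -
  have g1: "((\<lambda>t. t - 1) has_real_derivative 1) (at t)"
    and g2: "((\<lambda>t. 2 - t) has_real_derivative - 1) (at t)"
    by (auto intro!: derivative_eq_intros)
  have 1: "((\<lambda>t. flat 0 (t - 1)) has_real_derivative flat 2 (t - 1)) (at t)"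
    using DERIV_chain2[OF DERIV_flat[of 0 "t - 1"] g1] by (simp add: numeral_2_eq_2)
  have 2: "((\<lambda>t. flat 0 (2 - t)) has_real_derivative - flat 2 (2 - t)) (at t)"
    using DERIV_chain2[OF DERIV_flat[of 0 "2 - t"] g2] by (simp add: numeral_2_eq_2)
  have "((\<lambda>t. flat 0 (t - 1) / (flat 0 (t - 1) + flat 0 (2 - t))) has_real_derivative
     (flat 2 (t - 1) * (flat 0 (t - 1) + flat 0 (2 - t)) - flat 0 (t - 1) * (flat 2 (t - 1) + - flat 2 (2 - t)))
     / ((flat 0 (t - 1) + flat 0 (2 - t)) * (flat 0 (t - 1) + flat 0 (2 - t)))) (at t)"
    using step_denominator_pos[of t] by (intro DERIV_divide DERIV_add 1 2) auto
  then show ?thesis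
    unfolding step_def[abs_def] step'_def by (rule DERIV_cong) (simp add: power2_eq_square algebra_simps)
qed

lemma continuous_on_step': "continuous_on S step'"
  unfolding step'_def[abs_def]
  using step_denominator_pos by (intro continuous_intros) (metis less_numeral_extra(3) power_not_zero)

lemma step_eq_0: "t \<le> 1 \<Longrightarrow> step t = 0"
  by (simp add: step_def flat_zero)

lemma step_eq_1: "2 \<le> t \<Longrightarrow> step t = 1"
  using step_denominator_pos[of t] by (simp add: step_def flat_zero)

lemma step_bounds: "0 \<le> step t" "step t \<le> 1"
  using step_denominator_pos[of t] flat_nonneg by (auto simp: step_def field_simps)

lemma step'_nonneg: "0 \<le> step' t"
  by (simp add: step'_def flat_nonneg)

lemma step'_eq_0: "t \<le> 1 \<or> 2 \<le> t \<Longrightarrow> step' t = 0"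
  by (auto simp: step'_def flat_zero)

lemma step'_bounded: obtains B where "0 < B" "\<And>t. step' t \<le> B"
proof -
  obtain B where "0 < B" "\<And>t. norm (step' t) \<le> B"
    using bounded_continuous_compact_support[OF continuous_on_step' compact_Icc[of 1 2]]
      step'_eq_0 by (metis atLeastAtMost_iff linear)
  then show ?thesis using that by (metis abs_le_D1 real_norm_def)
qed

text \<open>The squared distance keeps the function C^1 at the centre. The transition takes place
  between the radii r and sqrt 2 times r; below, 3/2 serves as a rational upper bound for sqrt 2
  that is still less than 2.\<close>

definition cut :: "'a::euclidean_space \<Rightarrow> real \<Rightarrow> 'a \<Rightarrow> real" where
  "cut p r x = step ((x - p) \<bullet> (x - p) / r\<^sup>2)"

definition dcut :: "'a::euclidean_space \<Rightarrow> real \<Rightarrow> 'a \<Rightarrow> 'a" where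
  "dcut p r x = step' ((x - p) \<bullet> (x - p) / r\<^sup>2) *\<^sub>R ((2 / r\<^sup>2) *\<^sub>R (x - p))"

lemma GDERIV_cut: "GDERIV (cut p r) x :> dcut p r x"
proof -
  have "GDERIV (\<lambda>x. (x - p) \<bullet> (x - p) / r\<^sup>2) x :> (2 / r\<^sup>2) *\<^sub>R (x - p)"
    unfolding gderiv_def divide_inverse
    by (auto intro!: derivative_eq_intros simp: inner_commute)
  from GDERIV_DERIV_compose[OF this DERIV_step] show ?thesis
    unfolding cut_def[abs_def] dcut_def .
qed

lemma continuous_on_dcut: "continuous_on S (dcut p r)"
proof (cases "r = 0")
  case False
  then show ?thesis unfolding dcut_def[abs_def]
    by (intro continuous_intros continuous_on_compose2[OF continuous_on_step'[of UNIV]]) auto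
qed (simp add: dcut_def[abs_def])

lemma cut_bounds: "0 \<le> cut p r x" "cut p r x \<le> 1"
  by (auto simp: cut_def step_bounds)

lemma cut_eq_0: "0 < r \<Longrightarrow> dist p x \<le> r \<Longrightarrow> cut p r x = 0"
  unfolding cut_def
  by (rule step_eq_0) (simp add: power2_norm_eq_inner[symmetric] dist_norm norm_minus_commute power_mono)

lemma cut_arg_ge:
  assumes "0 < r" "3/2 * r \<le> dist p x"
  shows "2 \<le> (x - p) \<bullet> (x - p) / r\<^sup>2"
proof -
  have "2 * r\<^sup>2 \<le> (3/2 * r)\<^sup>2" by (simp add: power2_eq_square)
  also have "\<dots> \<le> (dist p x)\<^sup>2" using assms by (intro power_mono) auto
  also have "\<dots> = (x - p) \<bullet> (x - p)"
    by (metis dist_norm norm_minus_commute power2_norm_eq_inner)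
  finally show ?thesis using assms(1) by (simp add: field_simps)
qed

lemma cut_eq_1: "0 < r \<Longrightarrow> 3/2 * r \<le> dist p x \<Longrightarrow> cut p r x = 1"
  unfolding cut_def by (rule step_eq_1) (rule cut_arg_ge)

lemma dcut_eq_0: "0 < r \<Longrightarrow> 3/2 * r \<le> dist p x \<Longrightarrow> dcut p r x = 0"
  unfolding dcut_def using cut_arg_ge step'_eq_0 by (metis scaleR_zero_left)

text \<open>The chain rule contributes \<open>2 / r\<^sup>2\<close> times the distance from
  \<open>p\<close>, which is at most \<open>4 / r\<close> on the ball of radius
  \<open>2 * r\<close>. The constant depends on neither centre nor radius, so the bounds can be
  summed over a covering.\<close>

lemma dcut_bound:
  obtains B where "0 < B" "\<And>p r x. 0 < r \<Longrightarrow> norm (dcut p r x) \<le> B / r * indicator (cball p (2 * r)) x"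
proof -
  obtain B where B: "0 < B" "\<And>t. step' t \<le> B" by (rule step'_bounded) blast
  have "norm (dcut p r x) \<le> (4 * B) / r * indicator (cball p (2 * r)) x" if r: "0 < r" for p r and x :: 'a
  proof (cases "dist p x \<le> 2 * r")
    case True
    have "norm (dcut p r x) = step' ((x - p) \<bullet> (x - p) / r\<^sup>2) * (2 / r\<^sup>2 * norm (x - p))"
      by (simp add: dcut_def step'_nonneg)
    also have "\<dots> \<le> B * (2 / r\<^sup>2 * (2 * r))"
      using True B step'_nonneg r
      by (intro mult_mono) (auto simp: dist_norm norm_minus_commute divide_simps)
    also have "\<dots> = 4 * B / r" using r by (simp add: power2_eq_square)
    finally show ?thesis using True by simp
  next
    case False
    then show ?thesis using dcut_eq_0[OF r, of p x] r by simp
  qed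
  then show ?thesis using that[of "4 * B"] B(1) by auto
qed

lemma C1c_bump:
  assumes "0 < r"
  shows "C1c (ball p (2 * r)) (\<lambda>x. 1 - cut p r x) (\<lambda>x. - dcut p r x)"
  unfolding C1c_def
proof (intro conjI allI exI impI)
  show "GDERIV (\<lambda>x. 1 - cut p r x) x :> - dcut p r x" for x
    using GDERIV_diff[OF GDERIV_const[of 1 x] GDERIV_cut[of p r x]] by simp
  show "continuous_on UNIV (\<lambda>x. - dcut p r x)"
    by (intro continuous_intros continuous_on_dcut)
  show "cball p (3/2 * r) \<subseteq> ball p (2 * r)" using assms by auto
  show "1 - cut p r x = 0" if "x \<notin> cball p (3/2 * r)" for x
    using cut_eq_1[OF assms, of p x] that by auto
qed auto

text \<open>In the product rule every undifferentiated factor lies between 0 and 1, so the norms of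
  the gradients simply add up.\<close>

lemma prod_cut:
  assumes "finite T"
  shows "\<exists>D. (\<forall>y. GDERIV (\<lambda>y. \<Prod>i\<in>T. cut (x i) (r i) y) y :> D y) \<and> continuous_on UNIV D \<and>
     (\<forall>y. norm (D y) \<le> (\<Sum>i\<in>T. norm (dcut (x i) (r i) y)))"
  using assms
proof induction
  case empty
  show ?case by (intro exI[of _ "\<lambda>_. 0"]) (auto simp: GDERIV_const)
next
  case (insert j T)
  define P where "P y = (\<Prod>i\<in>T. cut (x i) (r i) y)" for y
  obtain D where D: "\<And>y. GDERIV P y :> D y" "continuous_on UNIV D"
     "\<And>y. norm (D y) \<le> (\<Sum>i\<in>T. norm (dcut (x i) (r i) y))"
    using insert.IH unfolding P_def by blast
  have P: "0 \<le> P y" "P y \<le> 1" for y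
    unfolding P_def by (auto intro!: prod_nonneg prod_le_1 simp: cut_bounds)
  let ?E = "\<lambda>y. cut (x j) (r j) y *\<^sub>R D y + P y *\<^sub>R dcut (x j) (r j) y"
  have "GDERIV (\<lambda>y. cut (x j) (r j) y * P y) y :> ?E y" for y
    by (rule GDERIV_mult[OF GDERIV_cut D(1)])
  moreover have "continuous_on UNIV ?E"
    by (intro continuous_intros D(2) continuous_on_dcut GDERIV_continuous_on[OF GDERIV_cut] GDERIV_continuous_on[OF D(1)])
  moreover have "norm (?E y) \<le> (\<Sum>i\<in>insert j T. norm (dcut (x i) (r i) y))" for y
  proof -
    have "norm (?E y) \<le> norm (cut (x j) (r j) y *\<^sub>R D y) + norm (P y *\<^sub>R dcut (x j) (r j) y)"
      by (rule norm_triangle_ineq)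
    also have "\<dots> \<le> norm (D y) + norm (dcut (x j) (r j) y)"
      by (intro add_mono) (simp_all add: P cut_bounds mult_left_le_one_le)
    finally show ?thesis using D(3)[of y] insert.hyps by simp
  qed
  ultimately show ?case using insert.hyps by (intro exI[of _ ?E]) (simp add: P_def)
qed

section \<open>Coverings of compact Hausdorff null sets by small balls and their
  consequences\<close>

lemma power_right_approx:
  fixes d :: real
  assumes "0 < e" "d < c"
  obtains r where "d < r" "r < c" "r ^ k \<le> d ^ k + e"
proof -
  have "((\<lambda>r. r ^ k) \<longlongrightarrow> d ^ k) (at_right d)" by (intro tendsto_intros)
  then have "\<forall>\<^sub>F r in at_right d. r ^ k < d ^ k + e"
    using assms(1) by (simp add: order_tendstoD(2))
  moreover have "\<forall>\<^sub>F r in at_right d. d < r \<and> r < c"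
    using assms(2) eventually_at_right_field by (auto intro!: exI[of _ c])
  ultimately have "\<forall>\<^sub>F r in at_right d. d < r \<and> r < c \<and> r ^ k < d ^ k + e"
    by eventually_elim auto
  then have "\<exists>r. d < r \<and> r < c \<and> r ^ k < d ^ k + e"
    using eventually_happens[of _ "at_right d"] trivial_limit_at_right_real by blast
  then show ?thesis using that less_imp_le by blast
qed

text \<open>A covering set that meets \<open>K\<close> lies in a ball about a point of
  \<open>K\<close> whose radius slightly exceeds the diameter; the balls being open, finitely many
  suffice. The excess has to be strict, as a diameter may be 0. It costs at most
  \<open>\<epsilon> * (1/2) ^ (i + 2)\<close> in the \<open>k\<close>-th power, altogether at most
  \<open>\<epsilon>/2\<close>.\<close>

lemma hausdorff_null_cover:
  fixes K :: "'a::metric_space set"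
  assumes K: "compact K" "hausdorff_measure k K = 0" and "0 < \<epsilon>" "0 < \<delta>"
  obtains T :: "nat set" and x :: "nat \<Rightarrow> 'a" and r :: "nat \<Rightarrow> real"
  where "finite T" "K \<subseteq> (\<Union>i\<in>T. ball (x i) (r i))" "\<And>i. i \<in> T \<Longrightarrow> x i \<in> K"
    "\<And>i. i \<in> T \<Longrightarrow> 0 < r i" "\<And>i. i \<in> T \<Longrightarrow> r i < \<delta>" "(\<Sum>i\<in>T. r i ^ k) < \<epsilon>"
proof -
  \<comment> \<open>The factor for which \<open>hausdorff_weight k C = w * diameter C ^ k\<close>
    when \<open>C\<close> is nonempty.\<close>
  define w where "w = unit_ball_vol (real k) * (1/2) ^ k"
  have w: "0 < w" by (simp add: w_def)
  have "hausdorff_premeasure k (\<delta>/2) K \<le> hausdorff_measure k K"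
    unfolding hausdorff_measure_def using assms(4) by (intro SUP_upper) auto
  then have "hausdorff_premeasure k (\<delta>/2) K < ennreal (w * (\<epsilon>/2))"
    using K(2) w assms(3) by (simp add: ennreal_zero_less_mult_iff)
  then obtain C where C: "K \<subseteq> (\<Union>i. C i)" "\<And>i. bounded (C i)" "\<And>i. diameter (C i) \<le> \<delta>/2"
      and Cs: "(\<Sum>i. hausdorff_weight k (C i)) < ennreal (w * (\<epsilon>/2))"
    unfolding hausdorff_premeasure_def INF_less_iff by auto
  define d where "d i = diameter (C i)" for i :: nat
  have "\<exists>s. d i < s \<and> s < \<delta> \<and> s ^ k \<le> d i ^ k + \<epsilon> * (1/2) ^ (i + 2)" for i
    using power_right_approx[of "\<epsilon> * (1/2) ^ (i + 2)" "d i" \<delta> k] C(3)[of i] assms(3,4)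
    unfolding d_def by (smt (verit, ccfv_SIG) divide_pos_pos field_sum_of_halves mult_pos_pos zero_less_power)
  then obtain r where r: "\<And>i. d i < r i" "\<And>i. r i < \<delta>" "\<And>i. r i ^ k \<le> d i ^ k + \<epsilon> * (1/2) ^ (i + 2)"
    by metis
  define N where "N = {i. C i \<inter> K \<noteq> {}}"
  have "\<exists>y. y \<in> C i \<inter> K" if "i \<in> N" for i using that by (auto simp: N_def)
  then obtain x where x: "\<And>i. i \<in> N \<Longrightarrow> x i \<in> C i \<inter> K" by metis
  have d0: "0 \<le> d i" for i using diameter_ge_0[OF C(2)] by (simp add: d_def)
  have "K \<subseteq> (\<Union>i\<in>N. ball (x i) (r i))"
  proof
    fix y assume y: "y \<in> K"
    then obtain i where i: "y \<in> C i" using C(1) by blast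
    then have iN: "i \<in> N" using y by (auto simp: N_def)
    have "dist (x i) y \<le> d i"
      unfolding d_def using diameter_bounded_bound[OF C(2)] x[OF iN] i by blast
    then show "y \<in> (\<Union>i\<in>N. ball (x i) (r i))"
      using iN r(1)[of i] by (intro UN_I[OF iN]) auto
  qed
  then obtain T where T: "T \<subseteq> N" "finite T" "K \<subseteq> (\<Union>i\<in>T. ball (x i) (r i))"
    using compactE_image[OF K(1), of N "\<lambda>i. ball (x i) (r i)"] by auto
  have "ennreal (w * (\<Sum>i\<in>T. d i ^ k)) = (\<Sum>i\<in>T. hausdorff_weight k (C i))"
  proof -
    have "hausdorff_weight k (C i) = ennreal (w * d i ^ k)" if "i \<in> T" for i
    proof -
      have "C i \<noteq> {}" using that T(1) by (auto simp: N_def)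
      then show ?thesis by (simp add: hausdorff_weight_def w_def d_def power_divide mult_ac)
    qed
    then have "(\<Sum>i\<in>T. hausdorff_weight k (C i)) = (\<Sum>i\<in>T. ennreal (w * d i ^ k))" by simp
    also have "\<dots> = ennreal (\<Sum>i\<in>T. w * d i ^ k)"
      by (rule sum_ennreal) (use w d0 in auto)
    finally show ?thesis by (simp add: sum_distrib_left)
  qed
  also have "\<dots> \<le> (\<Sum>i. hausdorff_weight k (C i))"
    by (rule sum_le_suminf) (auto simp: T(2))
  finally have "ennreal (w * (\<Sum>i\<in>T. d i ^ k)) < ennreal (w * (\<epsilon>/2))" using Cs by (rule le_less_trans)
  then have "w * (\<Sum>i\<in>T. d i ^ k) < w * (\<epsilon>/2)"
    using w d0 by (subst (asm) ennreal_less_iff) (auto intro!: sum_nonneg mult_nonneg_nonneg)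
  then have 1: "(\<Sum>i\<in>T. d i ^ k) < \<epsilon>/2" using w by simp
  have "(\<Sum>i\<in>T. r i ^ k) \<le> (\<Sum>i\<in>T. d i ^ k + \<epsilon> * (1/2) ^ (i + 2))" by (intro sum_mono r(3))
  also have "\<dots> = (\<Sum>i\<in>T. d i ^ k) + (\<epsilon>/4) * (\<Sum>i\<in>T. (1/2) ^ i)"
    by (simp add: sum.distrib sum_distrib_left power_add)
  also have "(\<Sum>i\<in>T. (1/2) ^ i) \<le> (\<Sum>i. (1/2::real) ^ i)"
    by (rule sum_le_suminf) (auto simp: T(2))
  also have "(\<Sum>i. (1/2::real) ^ i) = 2" by (simp add: suminf_geometric)
  finally have "(\<Sum>i\<in>T. r i ^ k) < \<epsilon>" using 1 assms(3) by simp
  moreover have "0 < r i" for i using d0[of i] r(1)[of i] by simp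
  ultimately show ?thesis using that[of T x r] T x r(2) by blast
qed

text \<open>One cut-off per covering ball, multiplied together. The gradient of a cut-off of radius
  \<open>r\<close> has size \<open>B / r\<close> on a ball whose volume is proportional to
  \<open>r ^ DIM('a)\<close>, so its integral is a multiple of \<open>r ^ (DIM('a) - 1)\<close>, the
  quantity that the covering makes small. Radii below \<open>\<delta>/2\<close> let every transition
  end within distance \<open>\<delta>\<close> of \<open>K\<close>.\<close>

lemma hausdorff_null_cutoff:
  fixes K :: "'a::euclidean_space set"
  assumes K: "compact K" "hausdorff_measure (DIM('a) - 1) K = 0" and e: "0 < \<epsilon>" "0 < \<delta>"
  obtains \<eta> D U where "\<And>y. GDERIV \<eta> y :> D y" "continuous_on UNIV D"
    "\<And>y. 0 \<le> \<eta> y" "\<And>y. \<eta> y \<le> 1" "open U" "K \<subseteq> U" "\<And>y. y \<in> U \<Longrightarrow> \<eta> y = 0"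
    "\<And>y. (\<And>z. z \<in> K \<Longrightarrow> \<delta> \<le> dist z y) \<Longrightarrow> \<eta> y = 1"
    "integrable lborel (\<lambda>y. norm (D y))" "(LBINT y. norm (D y)) \<le> \<epsilon>"
proof -
  obtain B where B: "0 < B" "\<And>p r x. 0 < r \<Longrightarrow> norm (dcut p r (x::'a)) \<le> B / r * indicator (cball p (2 * r)) x"
    by (rule dcut_bound) blast
  define C where "C = B * unit_ball_vol (real DIM('a)) * 2 ^ DIM('a)"
  have C: "0 < C" using B by (simp add: C_def)
  obtain T :: "nat set" and x :: "nat \<Rightarrow> 'a" and r where T: "finite T" "K \<subseteq> (\<Union>i\<in>T. ball (x i) (r i))"
     "\<And>i. i \<in> T \<Longrightarrow> x i \<in> K" "\<And>i. i \<in> T \<Longrightarrow> 0 < r i" "\<And>i. i \<in> T \<Longrightarrow> r i < \<delta>/2" "(\<Sum>i\<in>T. r i ^ (DIM('a) - 1)) < \<epsilon> / C"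
    by (rule hausdorff_null_cover[OF K, of "\<epsilon>/C" "\<delta>/2"]) (use C e in \<open>auto intro: that\<close>)
  define \<eta> where "\<eta> y = (\<Prod>i\<in>T. cut (x i) (r i) y)" for y
  obtain D where D: "\<And>y. GDERIV \<eta> y :> D y" "continuous_on UNIV D"
     "\<And>y. norm (D y) \<le> (\<Sum>i\<in>T. norm (dcut (x i) (r i) y))"
    using prod_cut[OF T(1), of x r] unfolding \<eta>_def by blast
  define g where "g y = (\<Sum>i\<in>T. B / r i * indicator (cball (x i) (2 * r i)) y)" for y
  have ig: "integrable lborel (\<lambda>y. B / r i * indicator (cball (x i) (2 * r i)) y)" for i
    using borel_integrable_compact[of "cball (x i) (2 * r i)" "\<lambda>_. B / r i"]
    by (simp only: real_scaleR_def mult.commute[of "B / r i"] compact_cball continuous_on_const simp_thms)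
  have g: "integrable lborel g" unfolding g_def by (intro Bochner_Integration.integrable_sum ig)
  have le: "norm (D y) \<le> g y" for y
  proof -
    have "(\<Sum>i\<in>T. norm (dcut (x i) (r i) y)) \<le> g y"
      unfolding g_def by (intro sum_mono B(2) T(4))
    then show ?thesis using D(3)[of y] by simp
  qed
  have iD: "integrable lborel (\<lambda>y. norm (D y))"
  proof (rule Bochner_Integration.integrable_bound[OF g])
    show "(\<lambda>y. norm (D y)) \<in> borel_measurable lborel"
      using borel_measurable_continuous_onI[OF D(2)] by simp
    show "AE y in lborel. norm (norm (D y)) \<le> norm (g y)"
      using le by (intro AE_I2) (simp add: order_trans[OF le abs_ge_self])
  qed
  have "(LBINT y. norm (D y)) \<le> (LBINT y. g y)"
    by (rule integral_mono[OF iD g le])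
  also have "\<dots> = (\<Sum>i\<in>T. LBINT y. B / r i * indicator (cball (x i) (2 * r i)) y)"
    unfolding g_def by (intro Bochner_Integration.integral_sum ig)
  also have "\<dots> = (\<Sum>i\<in>T. C * r i ^ (DIM('a) - 1))"
  proof (rule sum.cong[OF refl])
    fix i assume i: "i \<in> T"
    have "(LBINT y. B / r i * indicator (cball (x i) (2 * r i)) y)
       = B / r i * measure lborel (cball (x i) (2 * r i))" by simp
    also have "measure lborel (cball (x i) (2 * r i)) = unit_ball_vol (real DIM('a)) * (2 * r i) ^ DIM('a)"
      using T(4)[OF i] content_cball[of "2 * r i" "x i"] by simp
    also have "B / r i * \<dots> = C * (r i ^ DIM('a) / r i)"
      by (simp add: C_def power_mult_distrib)
    also have "r i ^ DIM('a) / r i = r i ^ (DIM('a) - 1)"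
      using T(4)[OF i] by (simp add: power_diff)
    finally show "(LBINT y. B / r i * indicator (cball (x i) (2 * r i)) y) = C * r i ^ (DIM('a) - 1)" .
  qed
  also have "\<dots> \<le> \<epsilon>"
    using T(6) C by (simp add: sum_distrib_left[symmetric] field_simps)
  finally have int: "(LBINT y. norm (D y)) \<le> \<epsilon>" .
  show ?thesis
  proof (rule that[OF D(1,2) _ _ _ T(2) _ _ iD int])
    show "0 \<le> \<eta> y" "\<eta> y \<le> 1" for y
      unfolding \<eta>_def by (auto intro!: prod_nonneg prod_le_1 simp: cut_bounds)
    show "open (\<Union>i\<in>T. ball (x i) (r i))" by auto
    show "\<eta> y = 0" if y: "y \<in> (\<Union>i\<in>T. ball (x i) (r i))" for y
    proof -
      obtain i where i: "i \<in> T" "y \<in> ball (x i) (r i)" using y by blast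
      then have "cut (x i) (r i) y = 0" using cut_eq_0[OF T(4)[OF i(1)], of "x i" y] by simp
      then show ?thesis unfolding \<eta>_def using i T(1) by (auto intro: prod_zero)
    qed
    show "\<eta> y = 1" if "\<And>z. z \<in> K \<Longrightarrow> \<delta> \<le> dist z y" for y
    proof -
      have "cut (x i) (r i) y = 1" if i: "i \<in> T" for i
        using \<open>\<And>z. z \<in> K \<Longrightarrow> \<delta> \<le> dist z y\<close>[OF T(3)[OF i]] T(4,5)[OF i] by (intro cut_eq_1) auto
      then show ?thesis unfolding \<eta>_def by simp
    qed
  qed
qed

lemma fmeasurable_ball: "ball x r \<in> fmeasurable (lborel :: 'a::euclidean_space measure)"
  by (rule fmeasurableI[OF _ emeasure_bounded_finite[OF bounded_ball]]) simp

text \<open>A ball of radius \<open>r\<close> sweeps out a set of measure \<open>O(r^(m-1))\<close> when translated along a segment.\<close>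

lemma hausdorff_null_sweep:
  fixes K :: "'a::euclidean_space set"
  assumes K: "compact K" "hausdorff_measure (DIM('a) - 1) K = 0"
  shows "(\<lambda>(k, t). k - t *\<^sub>R d) ` (K \<times> {0..1::real}) \<in> null_sets lborel" (is "?S \<in> _")
proof (rule ccontr)
  have cS: "compact ?S"
    unfolding case_prod_unfold
    by (intro compact_continuous_image compact_Times K(1) compact_Icc continuous_intros)
  have Sm: "?S \<in> sets lborel" using cS by (simp add: compact_imp_closed)
  define M where "M = measure lborel ?S"
  assume "?S \<notin> null_sets lborel"
  then have "emeasure lborel ?S \<noteq> 0" using Sm by (auto simp: null_sets_def)
  moreover have "emeasure lborel ?S < \<infinity>"
    using emeasure_bounded_finite[OF compact_imp_bounded[OF cS]] .
  ultimately have M: "0 < M"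
    by (simp add: M_def measure_def enn2real_positive_iff zero_less_iff_neq_zero)
  define \<omega> where "\<omega> = unit_ball_vol (real DIM('a))"
  have \<omega>: "0 < \<omega>" by (simp add: \<omega>_def)
  \<comment> \<open>At most \<open>norm d / r + 3\<close> balls of radius \<open>2 * r\<close> cover
    what one ball of radius \<open>r < 1\<close> sweeps out; their total volume is at most
    \<open>C * r ^ (DIM('a) - 1)\<close>.\<close>
  define C where "C = \<omega> * 2 ^ DIM('a) * (norm d + 3)"
  have C: "0 < C" using \<omega> unfolding C_def by (intro mult_pos_pos) (auto simp: add_nonneg_pos)
  obtain T :: "nat set" and x :: "nat \<Rightarrow> 'a" and r where T: "finite T" "K \<subseteq> (\<Union>i\<in>T. ball (x i) (r i))"
     "\<And>i. i \<in> T \<Longrightarrow> x i \<in> K" "\<And>i. i \<in> T \<Longrightarrow> 0 < r i" "\<And>i. i \<in> T \<Longrightarrow> r i < 1" "(\<Sum>i\<in>T. r i ^ (DIM('a) - 1)) < M / C"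
    by (rule hausdorff_null_cover[OF K, of "M/C" 1]) (use C M in \<open>auto intro: that\<close>)
  \<comment> \<open>The segment is divided into \<open>n i\<close> steps, each of length at most
    \<open>r i\<close>; the added 1 keeps \<open>n i\<close> positive even for
    \<open>d = 0\<close>.\<close>
  define n where "n i = nat \<lceil>norm d / r i\<rceil> + 1" for i
  define b where "b i j = ball (x i - (real j / real (n i)) *\<^sub>R d) (2 * r i)" for i j
  have sub: "?S \<subseteq> (\<Union>i\<in>T. \<Union>j\<in>{..n i}. b i j)"
  proof
    fix v assume "v \<in> ?S"
    then obtain t where t: "0 \<le> t" "t \<le> 1" "v + t *\<^sub>R d \<in> K" by auto
    then obtain i where i: "i \<in> T" "v + t *\<^sub>R d \<in> ball (x i) (r i)" using T(2) by blast
    have n0: "0 < real (n i)" by (simp add: n_def)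
    define j where "j = nat \<lfloor>t * real (n i)\<rfloor>"
    have fl: "real j = of_int \<lfloor>t * real (n i)\<rfloor>" unfolding j_def using t n0 by simp
    have j1: "real j \<le> t * real (n i)" "t * real (n i) < real j + 1"
      unfolding fl using floor_correct[of "t * real (n i)"] by auto
    have "t * real (n i) \<le> real (n i)" using t(2) n0 by (simp add: mult_left_le_one_le)
    then have "real j \<le> real (n i)" using j1 by linarith
    then have jn: "j \<in> {..n i}" by simp
    have "\<bar>t - real j / real (n i)\<bar> * norm d \<le> (1 / real (n i)) * norm d"
    proof (rule mult_right_mono)
      have "t - real j / real (n i) = (t * real (n i) - real j) / real (n i)"
        using n0 by (simp add: field_simps)
      then show "\<bar>t - real j / real (n i)\<bar> \<le> 1 / real (n i)"
        using j1 n0 by (simp add: abs_of_nonneg divide_right_mono)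
    qed simp
    also have "\<dots> \<le> r i"
    proof -
      have "norm d / r i \<le> real (n i)" unfolding n_def by linarith
      then show ?thesis using T(4)[OF i(1)] n0 by (simp add: field_simps)
    qed
    finally have td: "norm ((t - real j / real (n i)) *\<^sub>R d) \<le> r i" by simp
    have "norm (x i - (v + t *\<^sub>R d)) < r i" using i(2) by (simp add: dist_norm)
    then have lt: "norm (x i - (v + t *\<^sub>R d)) + norm ((t - real j / real (n i)) *\<^sub>R d) < 2 * r i"
      using td by linarith
    have eq: "x i - (real j / real (n i)) *\<^sub>R d - v
       = (x i - (v + t *\<^sub>R d)) + (t - real j / real (n i)) *\<^sub>R d"
      by (simp add: algebra_simps)
    have "norm (x i - (real j / real (n i)) *\<^sub>R d - v) < 2 * r i"
      unfolding eq by (rule norm_triangle_lt[OF lt])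
    then have "v \<in> b i j" by (simp add: b_def dist_norm)
    then show "v \<in> (\<Union>i\<in>T. \<Union>j\<in>{..n i}. b i j)" using i(1) jn by blast
  qed
  have bs: "b i j \<in> fmeasurable lborel" for i j
    unfolding b_def by (rule fmeasurable_ball)
  have fU: "(\<Union>j\<in>{..n i}. b i j) \<in> fmeasurable lborel" for i
    by (rule fmeasurable.finite_UN) (auto simp: bs)
  have "M \<le> measure lborel (\<Union>i\<in>T. \<Union>j\<in>{..n i}. b i j)"
    unfolding M_def by (rule measure_mono_fmeasurable[OF sub]) (auto intro!: fmeasurable.finite_UN fU T(1) simp: Sm[simplified])
  also have "\<dots> \<le> (\<Sum>i\<in>T. measure lborel (\<Union>j\<in>{..n i}. b i j))"
    by (rule measure_UNION_le[OF T(1)]) (use fU in blast)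
  also have "\<dots> \<le> (\<Sum>i\<in>T. C * r i ^ (DIM('a) - 1))"
  proof (rule sum_mono)
    fix i assume i: "i \<in> T"
    note ri = T(4,5)[OF i]
    have "measure lborel (\<Union>j\<in>{..n i}. b i j) \<le> (\<Sum>j\<in>{..n i}. measure lborel (b i j))"
      by (rule measure_UNION_le) (use bs in blast)+
    also have "\<dots> = (real (n i) + 1) * (\<omega> * (2 * r i) ^ DIM('a))"
      using ri by (simp add: b_def content_ball \<omega>_def)
    also have "\<dots> \<le> (norm d / r i + 3) * (\<omega> * (2 * r i) ^ DIM('a))"
    proof (rule mult_right_mono)
      have "0 \<le> norm d / r i" using ri by simp
      then have "real (n i) = of_int \<lceil>norm d / r i\<rceil> + 1" unfolding n_def by (simp add: ceiling_mono order_trans[OF _ ceiling_mono])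
      then show "real (n i) + 1 \<le> norm d / r i + 3" by linarith
    qed (use \<omega> ri in simp)
    also have "\<dots> = \<omega> * 2 ^ DIM('a) * (norm d + 3 * r i) * (r i ^ DIM('a) / r i)"
      using ri by (simp add: power_mult_distrib field_simps)
    also have "r i ^ DIM('a) / r i = r i ^ (DIM('a) - 1)"
      using ri by (simp add: power_diff)
    also have "\<omega> * 2 ^ DIM('a) * (norm d + 3 * r i) * r i ^ (DIM('a) - 1) \<le> C * r i ^ (DIM('a) - 1)"
      unfolding C_def using ri \<omega> by (intro mult_right_mono mult_left_mono) auto
    finally show "measure lborel (\<Union>j\<in>{..n i}. b i j) \<le> C * r i ^ (DIM('a) - 1)" .
  qed
  also have "\<dots> < M" using T(6) C by (simp add: sum_distrib_left[symmetric] field_simps)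
  finally show False by simp
qed

lemma hausdorff_null_negligible:
  fixes K :: "'a::euclidean_space set"
  assumes "compact K" "hausdorff_measure (DIM('a) - 1) K = 0"
  shows "K \<in> null_sets lborel"
proof -
  have "(\<lambda>(k, t). k - t *\<^sub>R 0) ` (K \<times> {0..1::real}) = K" by force
  then show ?thesis using hausdorff_null_sweep[OF assms, of 0] by simp
qed

text \<open>A translate of the segment meets \<open>K\<close> exactly when its starting point lies
  in the swept set. That set is null, so it cannot fill a ball of starting points. Hence an
  arbitrarily small translation frees a segment from \<open>K\<close>, which is how pieces of the
  domain get connected past \<open>closure A\<close>.\<close>

lemma hausdorff_null_segment:
  fixes K :: "'a::euclidean_space set"
  assumes K: "compact K" "hausdorff_measure (DIM('a) - 1) K = 0" and "0 < \<rho>"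
  obtains v where "norm v < \<rho>" "\<And>t. 0 \<le> t \<Longrightarrow> t \<le> 1 \<Longrightarrow> a + v + t *\<^sub>R d \<notin> K"
proof -
  let ?S = "(\<lambda>(k, t). k - t *\<^sub>R d) ` (K \<times> {0..1::real})"
  have "negligible ?S"
    using hausdorff_null_sweep[OF K, of d] by (simp add: negligible_iff_null_sets null_sets_completionI)
  moreover have "\<not> negligible (ball a \<rho>)" by (rule open_not_negligible) (use assms(3) in auto)
  ultimately have "\<not> ball a \<rho> \<subseteq> ?S" using negligible_subset by blast
  then obtain y where y: "y \<in> ball a \<rho>" "y \<notin> ?S" by blast
  show ?thesis
  proof (rule that[of "y - a"])
    show "norm (y - a) < \<rho>" using y(1) by (simp add: dist_norm norm_minus_commute)
    show "a + (y - a) + t *\<^sub>R d \<notin> K" if "0 \<le> t" "t \<le> 1" for t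
    proof
      assume "a + (y - a) + t *\<^sub>R d \<in> K"
      then have "y \<in> ?S" using that by (intro image_eqI[of _ _ "(y + t *\<^sub>R d, t)"]) auto
      then show False using y(2) by simp
    qed
  qed
qed

subsection \<open>Level sets and removable sets\<close>

text \<open>The gradient is a parameter and not \<open>grad g\<close>, so that \<open>- g\<close>
  with gradient \<open>- dg\<close> is an instance and both sides of a level set are covered by the
  same lemmas.\<close>

locale C1_on =
  fixes U :: "'a::euclidean_space set" and g :: "'a \<Rightarrow> real" and dg :: "'a \<Rightarrow> 'a"
  assumes open_U: "open U"
    and G: "\<And>x. x \<in> U \<Longrightarrow> GDERIV g x :> dg x"
    and cont_dg: "continuous_on U dg"
begin

lemma cont_g: "continuous_on U g"
  using G by (rule GDERIV_continuous_on)

lemma C1_on_subset: "open U' \<Longrightarrow> U' \<subseteq> U \<Longrightarrow> C1_on U' g dg"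
  using G cont_dg by unfold_locales (auto intro: continuous_on_subset)

lemma compose:
  assumes X: "\<And>t. (X has_real_derivative X' t) (at t)" "continuous_on UNIV X'"
  shows "\<And>x. x \<in> U \<Longrightarrow> GDERIV (\<lambda>x. X (g x)) x :> X' (g x) *\<^sub>R dg x"
    and "continuous_on U (\<lambda>x. X' (g x) *\<^sub>R dg x)"
    and "continuous_on U (\<lambda>x. X (g x))"
proof -
  show 1: "GDERIV (\<lambda>x. X (g x)) x :> X' (g x) *\<^sub>R dg x" if "x \<in> U" for x
    by (rule GDERIV_DERIV_compose[OF G[OF that] X(1)])
  show "continuous_on U (\<lambda>x. X' (g x) *\<^sub>R dg x)"
    by (intro continuous_intros cont_dg continuous_on_compose2[OF X(2) cont_g]) auto
  show "continuous_on U (\<lambda>x. X (g x))" using 1 by (rule GDERIV_continuous_on)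
qed

text \<open>Integration by parts, with \<open>f X'(g) \<partial>\<^sub>b g = f \<partial>\<^sub>b (X \<circ> g)\<close>. It controls integrals over thin
  layers around the level sets of \<open>g\<close> without any use of surface measure.\<close>

lemma layer_integral:
  assumes f: "C1c U f Df"
    and X: "\<And>t. (X has_real_derivative X' t) (at t)" "continuous_on UNIV X'"
  shows "integrable lborel (\<lambda>x. indicator U x * (f x * X' (g x) * (dg x \<bullet> b)))" (is "integrable _ ?l")
    and "integrable lborel (\<lambda>x. indicator U x * (X (g x) * (Df x \<bullet> b)))" (is "integrable _ ?r")
    and "(LBINT x. indicator U x * (f x * X' (g x) * (dg x \<bullet> b)))
       = - (LBINT x. indicator U x * (X (g x) * (Df x \<bullet> b)))"
proof -
  obtain K where K: "compact K" "K \<subseteq> U" "\<And>x. x \<notin> K \<Longrightarrow> f x = 0" "\<And>x. x \<notin> K \<Longrightarrow> Df x = 0"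
    using C1c_support[OF f] by blast
  note c = compose[OF X]
  show l: "integrable lborel ?l"
  proof (rule integrable_continuous_compact_support[OF _ K(1)])
    have "continuous_on K (\<lambda>x. f x * ((X' (g x) *\<^sub>R dg x) \<bullet> b))"
      by (intro continuous_intros C1c_continuous[OF f] continuous_on_subset[OF c(2) K(2)])
    then show "continuous_on K ?l"
      by (rule continuous_on_eq) (use K(2) in \<open>auto simp: indicator_def\<close>)
  qed (use K(3) in auto)
  show r: "integrable lborel ?r"
  proof (rule integrable_continuous_compact_support[OF _ K(1)])
    have "continuous_on K (\<lambda>x. X (g x) * (Df x \<bullet> b))"
      by (intro continuous_intros C1c_continuous_D[OF f] continuous_on_subset[OF c(3) K(2)])
    then show "continuous_on K ?r"
      by (rule continuous_on_eq) (use K(2) in \<open>auto simp: indicator_def\<close>)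
  qed (use K(4) in auto)
  have "(LBINT x. ?l x + ?r x) = 0"
    using C1c_integral_parts(2)[OF f open_U c(1,2), of b]
    by (simp add: algebra_simps)
  then show "(LBINT x. ?l x) = - (LBINT x. ?r x)"
    using l r by simp
qed

lemma ball_dir_lower_bound:
  assumes "p \<in> U" "0 < dg p \<bullet> b" "open O'" "p \<in> O'"
  obtains r c where "0 < r" "0 < c" "ball p r \<subseteq> U \<inter> O'" "\<And>x. x \<in> ball p r \<Longrightarrow> c \<le> dg x \<bullet> b"
proof -
  have "continuous_on U (\<lambda>x. dg x \<bullet> b)" by (intro continuous_intros cont_dg)
  then have "open (U \<inter> (\<lambda>x. dg x \<bullet> b) -` {dg p \<bullet> b / 2<..})"
    by (rule continuous_open_preimage) (auto simp: open_U)
  moreover have "U \<inter> (\<lambda>x. dg x \<bullet> b) -` {dg p \<bullet> b / 2<..} = {x \<in> U. dg p \<bullet> b / 2 < dg x \<bullet> b}"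
    by auto
  ultimately have "open {x \<in> U. dg p \<bullet> b / 2 < dg x \<bullet> b}" by simp
  then have "open ({x \<in> U. dg p \<bullet> b / 2 < dg x \<bullet> b} \<inter> O')" using assms(3) by blast
  moreover have "p \<in> {x \<in> U. dg p \<bullet> b / 2 < dg x \<bullet> b} \<inter> O'" using assms by auto
  ultimately obtain r where "0 < r" "ball p r \<subseteq> {x \<in> U. dg p \<bullet> b / 2 < dg x \<bullet> b} \<inter> O'"
    using open_contains_ball by blast
  then show ?thesis using assms(2) by (intro that[of r "dg p \<bullet> b / 2"]) (auto intro: less_imp_le)
qed

text \<open>With \<open>X t = arctan (n * t)\<close> the right-hand side of the layer identity is
  bounded, since \<open>\<bar>X t\<bar> \<le> pi / 2\<close>, whereas on the level set
  \<open>X'\<close> equals \<open>n\<close> and \<open>dg x \<bullet> b\<close> is at least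
  \<open>c\<close>. Thus \<open>n * c\<close> times the measure of the level set stays bounded as
  \<open>n\<close> grows.\<close>

lemma level_set_null:
  assumes "p \<in> U" "dg p \<noteq> 0"
  obtains r where "0 < r" "{x \<in> ball p r. g x = 0} \<in> null_sets lborel"
proof -
  define b where "b = dg p"
  have "0 < dg p \<bullet> b" using assms(2) by (simp add: b_def)
  then obtain r c where r: "0 < r" "0 < c" "ball p r \<subseteq> U \<inter> UNIV" "\<And>x. x \<in> ball p r \<Longrightarrow> c \<le> dg x \<bullet> b"
    using ball_dir_lower_bound[OF assms(1), of b UNIV] by blast
  define s where "s = r / 2"
  have s: "0 < s" "2 * s = r" using r(1) by (auto simp: s_def)
  define f where "f x = 1 - cut p s x" for x
  define Df where "Df x = - dcut p s x" for x
  have f: "C1c (ball p r) f Df"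
    unfolding f_def Df_def using C1c_bump[OF s(1), of p] by (simp add: s)
  have f0: "0 \<le> f x" for x by (simp add: f_def cut_bounds)
  have f1: "f x = 1" if "x \<in> ball p s" for x
    using cut_eq_0[OF s(1), of p x] that by (simp add: f_def)
  interpret B: C1_on "ball p r" g dg using C1_on_subset r(3) by auto
  define Z where "Z = {x \<in> ball p s. g x = 0}"
  have "open {x \<in> ball p s. g x \<noteq> 0}"
  proof -
    have "continuous_on (ball p s) g" using cont_g r(3) s(2) s(1) by (auto intro!: continuous_on_subset[OF cont_g] simp: subset_iff)
    then have "open (ball p s \<inter> g -` (- {0}))" by (rule continuous_open_preimage) auto
    moreover have "ball p s \<inter> g -` (- {0}) = {x \<in> ball p s. g x \<noteq> 0}" by auto
    ultimately show ?thesis by simp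
  qed
  moreover have "Z = ball p s - {x \<in> ball p s. g x \<noteq> 0}" by (auto simp: Z_def)
  ultimately have Zm: "Z \<in> sets lborel" by auto
  have Zf: "emeasure lborel Z < \<infinity>"
    by (rule emeasure_bounded_finite[OF bounded_subset[OF bounded_ball[of p s]]]) (auto simp: Z_def)
  define C where "C = (pi / 2) * (LBINT x. norm (Df x \<bullet> b))"
  have iD: "integrable lborel (\<lambda>x. norm (Df x \<bullet> b))"
    by (intro integrable_norm integrable_inner_left C1c_integrable_D[OF f])
  have bd: "real n * c * measure lborel Z \<le> C" for n :: nat
  proof -
    define X where "X t = arctan (real n * t)" for t
    define X' where "X' t = real n / (1 + (real n * t)\<^sup>2)" for t
    have X: "(X has_real_derivative X' t) (at t)" for t
      unfolding X_def[abs_def] X'_def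
      by (auto intro!: derivative_eq_intros simp: add_nonneg_eq_0_iff field_simps)
    have "1 + (real n * t)\<^sup>2 \<noteq> 0" for t :: real
      by (metis add_pos_nonneg less_irrefl zero_le_power2 zero_less_one)
    then have X': "continuous_on UNIV X'" unfolding X'_def[abs_def] by (intro continuous_intros) auto
    note L = B.layer_integral[OF f X X', of b]
    have X'0: "0 \<le> X' t" for t by (simp add: X'_def add_nonneg_nonneg)
    have "real n * c * measure lborel Z = (LBINT x. real n * c * indicator Z x)" by simp
    also have "\<dots> \<le> (LBINT x. indicator (ball p r) x * (f x * X' (g x) * (dg x \<bullet> b)))"
    proof (rule integral_mono[OF _ L(1)])
      show "integrable lborel (\<lambda>x. real n * c * indicator Z x)"
        using Zm Zf by (intro integrable_mult_right integrable_real_indicator) auto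
      fix x
      show "real n * c * indicator Z x \<le> indicator (ball p r) x * (f x * X' (g x) * (dg x \<bullet> b))"
      proof (cases "x \<in> Z")
        case True
        then have x: "x \<in> ball p s" "g x = 0" by (auto simp: Z_def)
        then have "x \<in> ball p r" using s by auto
        moreover have "X' (g x) = real n" using x by (simp add: X'_def)
        ultimately show ?thesis using True f1[OF x(1)] r(4)[of x] by (simp add: mult_left_mono)
      next
        case False
        have "0 \<le> indicator (ball p r) x * (f x * X' (g x) * (dg x \<bullet> b))"
          using f0[of x] X'0[of "g x"] r(4)[of x] r(2)
          by (cases "x \<in> ball p r") (auto intro!: mult_nonneg_nonneg)
        then show ?thesis using False by simp
      qed
    qed
    also have "\<dots> = - (LBINT x. indicator (ball p r) x * (X (g x) * (Df x \<bullet> b)))" by (rule L(3))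
    also have "\<dots> \<le> (LBINT x. (pi / 2) * norm (Df x \<bullet> b))"
      unfolding Bochner_Integration.integral_minus[symmetric]
    proof (rule integral_mono)
      show "integrable lborel (\<lambda>x. - (indicator (ball p r) x * (X (g x) * (Df x \<bullet> b))))"
        using L(2) by (rule Bochner_Integration.integrable_minus)
      show "integrable lborel (\<lambda>x. pi / 2 * norm (Df x \<bullet> b))"
        by (intro integrable_mult_right iD)
      fix x
      have "\<bar>X (g x)\<bar> \<le> pi / 2"
        unfolding X_def using arctan_bounded[of "real n * g x"] by (auto simp: abs_le_iff)
      then have "\<bar>X (g x) * (Df x \<bullet> b)\<bar> \<le> pi / 2 * norm (Df x \<bullet> b)"
        unfolding abs_mult real_norm_def by (rule mult_right_mono) simp
      then show "- (indicator (ball p r) x * (X (g x) * (Df x \<bullet> b))) \<le> pi / 2 * norm (Df x \<bullet> b)"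
        by (cases "x \<in> ball p r") auto
    qed
    also have "\<dots> = C" by (simp add: C_def)
    finally show ?thesis .
  qed
  have "measure lborel Z = 0"
  proof (rule ccontr)
    assume "measure lborel Z \<noteq> 0"
    then have m: "0 < c * measure lborel Z" using r(2) by (simp add: zero_less_measure_iff)
    then obtain n :: nat where "C < real n * (c * measure lborel Z)"
      using reals_Archimedean3 by blast
    then show False using bd[of n] by (simp add: mult.assoc)
  qed
  then have "emeasure lborel Z = 0" using Zf by (simp add: emeasure_eq_ennreal_measure)
  then have "Z \<in> null_sets lborel" using Zm by auto
  then show ?thesis using that[OF s(1)] unfolding Z_def by blast
qed

end

lemma local_equation_C1_on:
  assumes "local_equation M U g"
  shows "C1_on U g (grad g)"
proof
  show "open U" using assms by (simp add: local_equation_def)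
  have c: "Ck_on 1 U g" using assms by (simp only: local_equation_def)
  show "GDERIV g x :> grad g x" if "x \<in> U" for x by (rule Ck_on_1_GDERIV[OF c that])
  show "continuous_on U (grad g)" by (rule Ck_on_1_continuous_grad[OF c])
qed

lemma C1_hypersurface_negligible:
  assumes "C1_hypersurface M"
  shows "negligible M"
proof (rule iffD2[OF locally_negligible_alt], rule ballI)
  fix p assume p: "p \<in> M"
  obtain U g where U: "p \<in> U" "local_equation M U g"
    using assms p by (auto simp: C1_hypersurface_def)
  interpret C1_on U g "grad g" by (rule local_equation_C1_on[OF U(2)])
  have "grad g p \<noteq> 0" using U unfolding local_equation_def by blast
  then obtain r where r: "0 < r" "{x \<in> ball p r. g x = 0} \<in> null_sets lborel"
    using level_set_null[OF U(1)] by blast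
  let ?N = "M \<inter> (U \<inter> ball p r)"
  have "openin (top_of_set M) ?N" using open_U by (intro openin_open_Int) auto
  moreover have "p \<in> ?N" using p U(1) r(1) by simp
  moreover have "negligible ?N"
  proof (rule negligible_subset)
    show "negligible {x \<in> ball p r. g x = 0}"
      using r(2) by (simp add: negligible_iff_null_sets null_sets_completionI)
    show "?N \<subseteq> {x \<in> ball p r. g x = 0}" using U(2) unfolding local_equation_def by blast
  qed
  ultimately show "\<exists>U. openin (top_of_set M) U \<and> p \<in> U \<and> negligible U" by blast
qed

text \<open>\<open>W = \<Omega> - \<Gamma>\<close>, the set \<open>E\<close> is \<open>closure A\<close>, and \<open>M = \<Gamma> - A\<close>.\<close>

locale flux =
  fixes \<Omega> W E M :: "'a::euclidean_space set" and V :: "'a \<Rightarrow> 'a" and H :: "'a \<Rightarrow> real"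
  assumes open_W: "open W" and WO: "W \<subseteq> \<Omega>" and null: "\<Omega> - W \<in> null_sets lborel"
    and E: "compact E" "hausdorff_measure (DIM('a) - 1) E = 0"
    and cover: "\<Omega> - W \<subseteq> M \<union> E" and MW: "M \<inter> W = {}"
    and V_C1: "Ck_on 1 W V" and V_le: "\<And>x. x \<in> W \<Longrightarrow> norm (V x) \<le> 1"
    and V_div: "\<And>x. x \<in> W \<Longrightarrow> divergence V x = H x"
    and H_cont: "continuous_on W H" and H_L1: "locally_L1 \<Omega> H"
begin

text \<open>In the sense of distributions this is \<open>H\<close> minus the divergence of
  \<open>V\<close>, both extended by zero off \<open>W\<close>. It vanishes on functions supported
  in \<open>W\<close>, so it measures the singular part carried by
  \<open>\<Omega> - W\<close>.\<close>

definition J :: "('a \<Rightarrow> real) \<Rightarrow> ('a \<Rightarrow> 'a) \<Rightarrow> real" where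
  "J f Df = (LBINT x. indicator W x * (V x \<bullet> Df x + H x * f x))"

lemma V_cont: "continuous_on W V"
proof -
  have "\<forall>x\<in>W. V differentiable (at x)" using V_C1 by simp
  then show ?thesis
    by (meson continuous_at_imp_continuous_on differentiable_imp_continuous_within)
qed

lemma V_measurable: "(\<lambda>x. indicator W x *\<^sub>R V x) \<in> borel_measurable borel"
  using open_W V_cont by (intro borel_measurable_continuous_on_indicator) auto

lemma H_measurable: "(\<lambda>x. indicator W x *\<^sub>R H x) \<in> borel_measurable borel"
  using open_W H_cont by (intro borel_measurable_continuous_on_indicator) auto

lemma V_bound: "\<bar>indicator W x * (V x \<bullet> X)\<bar> \<le> norm X"
proof (cases "x \<in> W")
  case True
  have "\<bar>V x \<bullet> X\<bar> \<le> norm (V x) * norm X" by (rule Cauchy_Schwarz_ineq2)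
  also have "\<dots> \<le> norm X" using V_le[OF True] by (simp add: mult_left_le_one_le)
  finally show ?thesis using True by simp
qed simp

lemma integrable_V:
  assumes "integrable lborel X"
  shows "integrable lborel (\<lambda>x. indicator W x * (V x \<bullet> X x))"
proof (rule Bochner_Integration.integrable_bound[OF assms])
  have "(\<lambda>x. (indicator W x *\<^sub>R V x) \<bullet> X x) \<in> borel_measurable lborel"
    using V_measurable borel_measurable_integrable[OF assms] by measurable
  then show "(\<lambda>x. indicator W x * (V x \<bullet> X x)) \<in> borel_measurable lborel" by simp
  show "AE x in lborel. norm (indicator W x * (V x \<bullet> X x)) \<le> norm (X x)"
    by (intro AE_I2) (simp only: real_norm_def V_bound)
qed

lemma integrable_H:
  assumes "continuous_on UNIV f" "compact K" "K \<subseteq> \<Omega>" "\<And>x. x \<notin> K \<Longrightarrow> f x = 0"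
  shows "integrable lborel (\<lambda>x. indicator W x * (H x * f x))"
proof -
  obtain B where B: "0 < B" "\<And>x. norm (f x) \<le> B"
    using bounded_continuous_compact_support[OF continuous_on_subset[OF assms(1)] assms(2,4)] by blast
  have fm: "f \<in> borel_measurable borel" by (rule borel_measurable_continuous_onI[OF assms(1)])
  \<comment> \<open>Borel measurability, a consequence of continuity on \<open>W\<close>, is what
    carries integrability over from the completed measure, to which \<open>locally_L1\<close>
    refers, to \<open>lborel\<close>.\<close>
  have m: "(\<lambda>x. indicator W x * (H x * f x)) \<in> borel_measurable borel"
  proof -
    have "(\<lambda>x. (indicator W x *\<^sub>R H x) * f x) \<in> borel_measurable borel"
      using H_measurable fm by measurable
    then show ?thesis by (simp add: mult.assoc)
  qed
  have "integrable lebesgue (\<lambda>x. indicator K x *\<^sub>R H x)"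
    using H_L1 assms(2,3) by (auto simp: locally_L1_def set_integrable_def)
  then have "integrable lebesgue (\<lambda>x. B * (indicator K x *\<^sub>R H x))"
    by (rule integrable_mult_right)
  then have "integrable lebesgue (\<lambda>x. indicator W x * (H x * f x))"
  proof (rule Bochner_Integration.integrable_bound)
    show "(\<lambda>x. indicator W x * (H x * f x)) \<in> borel_measurable lebesgue"
      using m by (intro measurable_completion) simp
    have nb: "norm (indicator W x * (H x * f x)) \<le> norm (B * (indicator K x *\<^sub>R H x))" for x
    proof (cases "x \<in> K \<and> x \<in> W")
      case True
      have "\<bar>H x\<bar> * \<bar>f x\<bar> \<le> \<bar>H x\<bar> * B" using B(2)[of x] by (intro mult_left_mono) auto
      then show ?thesis using True B(1) by (simp add: abs_mult mult.commute)
    qed (use assms(4) in auto)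
    show "AE x in lebesgue. norm (indicator W x * (H x * f x)) \<le> norm (B * (indicator K x *\<^sub>R H x))"
      by (rule AE_I2) (rule nb)
  qed
  then show ?thesis using m by (simp add: integrable_completion)
qed

lemma integrable_J:
  assumes "C1c \<Omega> f Df"
  shows "integrable lborel (\<lambda>x. indicator W x * (V x \<bullet> Df x + H x * f x))"
proof -
  obtain K where K: "compact K" "K \<subseteq> \<Omega>" "\<And>x. x \<notin> K \<Longrightarrow> f x = 0" "\<And>x. x \<notin> K \<Longrightarrow> Df x = 0"
    using C1c_support[OF assms] by blast
  show ?thesis
    using Bochner_Integration.integrable_add[OF integrable_V[OF C1c_integrable_D[OF assms]]
        integrable_H[OF C1c_continuous[OF assms] K(1,2,3)]]
    by (simp add: distrib_left)
qed

lemma J_W: "C1c W f Df \<Longrightarrow> J f Df = 0"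
proof -
  assume f: "C1c W f Df"
  have eq: "indicator W x * (V x \<bullet> Df x + H x * f x) = indicator W x * (V x \<bullet> Df x + divergence V x * f x)" for x
    using V_div by (auto simp: indicator_def)
  show ?thesis unfolding J_def eq by (rule C1c_divergence[OF f open_W V_C1])
qed

lemma J_add:
  assumes "C1c \<Omega> f Df" "C1c \<Omega> g Dg"
  shows "J (\<lambda>x. f x + g x) (\<lambda>x. Df x + Dg x) = J f Df + J g Dg"
  unfolding J_def using Bochner_Integration.integral_add[OF integrable_J[OF assms(1)] integrable_J[OF assms(2)]]
  by (simp add: algebra_simps inner_add_right)

text \<open>Cut-off functions that vanish near \<open>E\<close> and whose gradients are small in \<open>L\<^sup>1\<close> show that
  \<open>E\<close> is removable; this is where \<open>|V| \<le> 1\<close> enters.\<close>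

lemma J_remove_E:
  assumes zero: "\<And>f Df. C1c (O' - E) f Df \<Longrightarrow> J f Df = 0"
    and O: "O' \<subseteq> \<Omega>" and f: "C1c O' f Df"
  shows "J f Df = 0"
proof -
  have fO: "C1c \<Omega> f Df" by (rule C1c_mono[OF f O])
  obtain K where K: "compact K" "K \<subseteq> O'" "\<And>x. x \<notin> K \<Longrightarrow> f x = 0" "\<And>x. x \<notin> K \<Longrightarrow> Df x = 0"
    using C1c_support[OF f] by blast
  obtain B where B: "0 < B" "\<And>x. \<bar>f x\<bar> \<le> B" "\<And>x. norm (Df x) \<le> B"
    using C1c_bounds[OF f] by blast
  define e where "e n = inverse (real (Suc n))" for n
  have e: "0 < e n" for n by (simp add: e_def)
  have e0: "e \<longlonglongrightarrow> 0" unfolding e_def by (rule LIMSEQ_inverse_real_of_nat)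
  \<comment> \<open>The properties of a cut-off are bundled into one predicate, so that a single
    choice over \<open>n\<close> yields the three sequences.\<close>
  define P where "P n \<eta> D U \<longleftrightarrow> (\<forall>y. GDERIV \<eta> y :> D y) \<and> continuous_on UNIV D \<and> (\<forall>y. 0 \<le> \<eta> y) \<and> (\<forall>y. \<eta> y \<le> 1) \<and>
     open U \<and> E \<subseteq> U \<and> (\<forall>y. y \<in> U \<longrightarrow> \<eta> y = 0) \<and> (\<forall>y. (\<forall>z\<in>E. e n \<le> dist z y) \<longrightarrow> \<eta> y = 1) \<and>
     integrable lborel (\<lambda>y. norm (D y)) \<and> (LBINT y. norm (D y)) \<le> e n" for n \<eta> D U
  have "\<exists>\<eta> D U. P n \<eta> D U" for n
  proof (rule hausdorff_null_cutoff[OF E e[of n] e[of n]])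
    fix \<eta> D and U :: "'a set"
    assume "\<And>y. GDERIV \<eta> y :> D y" "continuous_on UNIV D" "\<And>y. 0 \<le> \<eta> y" "\<And>y. \<eta> y \<le> 1"
      "open U" "E \<subseteq> U" "\<And>y. y \<in> U \<Longrightarrow> \<eta> y = 0"
      "\<And>y. (\<And>z. z \<in> E \<Longrightarrow> e n \<le> dist z y) \<Longrightarrow> \<eta> y = 1"
      "integrable lborel (\<lambda>y. norm (D y))" "(LBINT y. norm (D y)) \<le> e n"
    then have "P n \<eta> D U" unfolding P_def by simp
    then show ?thesis by blast
  qed
  then obtain \<eta> D U where c0: "\<And>n. P n (\<eta> n) (D n) (U n)" by metis
  have c: "\<And>n y. GDERIV (\<eta> n) y :> D n y" "\<And>n. continuous_on UNIV (D n)"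
      "\<And>n y. 0 \<le> \<eta> n y" "\<And>n y. \<eta> n y \<le> 1" "\<And>n::nat. open (U n)" "\<And>n. E \<subseteq> U n" "\<And>n y. y \<in> U n \<Longrightarrow> \<eta> n y = 0"
      "\<And>n y. (\<And>z. z\<in>E \<Longrightarrow> e n \<le> dist z y) \<Longrightarrow> \<eta> n y = 1"
      "\<And>n. integrable lborel (\<lambda>y. norm (D n y))"  "\<And>n. (LBINT y. norm (D n y)) \<le> e n"
    using c0 unfolding P_def by blast+
  define a where "a x = indicator W x * (V x \<bullet> Df x + H x * f x)" for x
  define r where "r n x = indicator W x * (V x \<bullet> (f x *\<^sub>R D n x))" for n x
  have ia: "integrable lborel a" unfolding a_def by (rule integrable_J[OF fO])
  have am: "a \<in> borel_measurable borel" using ia by (simp add: borel_measurable_integrable)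
  have \<eta>m: "\<eta> n \<in> borel_measurable borel" for n
    by (rule borel_measurable_continuous_onI[OF GDERIV_continuous_on[OF c(1)]])
  have i\<eta>: "integrable lborel (\<lambda>x. \<eta> n x * a x)" for n
  proof (rule Bochner_Integration.integrable_bound[OF ia])
    show "(\<lambda>x. \<eta> n x * a x) \<in> borel_measurable lborel" using \<eta>m am by simp
    show "AE x in lborel. norm (\<eta> n x * a x) \<le> norm (a x)"
      using c(3,4) by (intro AE_I2) (simp add: abs_mult mult_left_le_one_le)
  qed
  \<comment> \<open>The product of \<open>f\<close> and \<open>\<eta> n\<close> is supported off
    \<open>E\<close>, where \<open>J\<close> is zero by assumption. The part of its gradient that
    falls on \<open>\<eta> n\<close> contributes \<open>r n\<close>, whose integral is at most
    \<open>B * e n\<close>.\<close>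
  have eq: "(LBINT x. \<eta> n x * a x) = - (LBINT x. r n x)"
    and bnd: "\<bar>LBINT x. r n x\<bar> \<le> B * e n" for n
  proof -
    note m = C1c_mult_UNIV[OF f c(1) c(2), of n]
    have "C1c (O' - E) (\<lambda>x. f x * \<eta> n x) (\<lambda>x. f x *\<^sub>R D n x + \<eta> n x *\<^sub>R Df x)"
      unfolding C1c_def
    proof (intro conjI exI)
      show "\<forall>x. GDERIV (\<lambda>x. f x * \<eta> n x) x :> f x *\<^sub>R D n x + \<eta> n x *\<^sub>R Df x"
        using C1c_GDERIV[OF m] by blast
      show "continuous_on UNIV (\<lambda>x. f x *\<^sub>R D n x + \<eta> n x *\<^sub>R Df x)" by (rule C1c_continuous_D[OF m])
      show "K - U n \<subseteq> O' - E" using K(2) c(6) by blast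
      show "compact (K - U n)" by (rule compact_diff[OF K(1) c(5)])
      show "\<forall>x. x \<notin> K - U n \<longrightarrow> f x * \<eta> n x = 0" using K(3) c(7) by auto
    qed
    then have "J (\<lambda>x. f x * \<eta> n x) (\<lambda>x. f x *\<^sub>R D n x + \<eta> n x *\<^sub>R Df x) = 0" by (rule zero)
    then have s: "(LBINT x. \<eta> n x * a x + r n x) = 0"
      unfolding J_def a_def r_def by (simp add: inner_add_right algebra_simps)
    have "integrable lborel (D n)"
      using c(9)[of n] borel_measurable_continuous_onI[OF c(2)[of n]] by (simp add: integrable_norm_iff)
    then have iD: "integrable lborel (\<lambda>x. f x *\<^sub>R D n x)"
    proof -
      have "integrable lborel (\<lambda>x. B * norm (D n x))" using c(9) by (rule integrable_mult_right)
      then show ?thesis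
      proof (rule Bochner_Integration.integrable_bound)
        show "(\<lambda>x. f x *\<^sub>R D n x) \<in> borel_measurable lborel"
          using borel_measurable_continuous_onI[OF c(2)[of n]]
            borel_measurable_continuous_onI[OF C1c_continuous[OF f]] by simp
        show "AE x in lborel. norm (f x *\<^sub>R D n x) \<le> norm (B * norm (D n x))"
          using B by (intro AE_I2) (simp add: abs_mult mult_right_mono)
      qed
    qed
    have ir: "integrable lborel (r n)" unfolding r_def by (rule integrable_V[OF iD])
    show "(LBINT x. \<eta> n x * a x) = - (LBINT x. r n x)"
      using s Bochner_Integration.integral_add[OF i\<eta> ir] by simp
    have "\<bar>LBINT x. r n x\<bar> \<le> (LBINT x. B * norm (D n x))"
    proof (rule order_trans[OF integral_abs_bound integral_mono])
      show "integrable lborel (\<lambda>x. \<bar>r n x\<bar>)" using ir by simp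
      show "integrable lborel (\<lambda>x. B * norm (D n x))" using c(9) by (rule integrable_mult_right)
      show "\<bar>r n x\<bar> \<le> B * norm (D n x)" for x
        unfolding r_def by (rule order_trans[OF V_bound]) (simp add: B mult_right_mono)
    qed
    also have "\<dots> \<le> B * e n" using c(10)[of n] B(1) by simp
    finally show "\<bar>LBINT x. r n x\<bar> \<le> B * e n" .
  qed
  \<comment> \<open>A point off the compact set \<open>E\<close> has positive distance from it, so
    \<open>\<eta> n\<close> is eventually 1 there; \<open>E\<close> itself is null.\<close>
  have "(\<lambda>n. LBINT x. \<eta> n x * a x) \<longlonglongrightarrow> (LBINT x. a x)"
  proof (rule integral_dominated_convergence[where w = "\<lambda>x. norm (a x)"])
    show "AE x in lborel. (\<lambda>n. \<eta> n x * a x) \<longlonglongrightarrow> a x"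
    proof (rule AE_I'[OF hausdorff_null_negligible[OF E]])
      show "{x \<in> space lborel. \<not> (\<lambda>n. \<eta> n x * a x) \<longlonglongrightarrow> a x} \<subseteq> E"
      proof (rule subsetI, rule ccontr)
        fix x assume x: "x \<in> {x \<in> space lborel. \<not> (\<lambda>n. \<eta> n x * a x) \<longlonglongrightarrow> a x}" "x \<notin> E"
        obtain d where d: "0 < d" "\<And>z. z \<in> E \<Longrightarrow> d \<le> dist x z"
          using separate_point_closed[OF compact_imp_closed[OF E(1)] x(2)] by blast
        have "\<forall>\<^sub>F n in sequentially. e n < d" using e0 d(1) by (rule order_tendstoD)
        then have "\<forall>\<^sub>F n in sequentially. \<eta> n x * a x = a x"
        proof eventually_elim
          case (elim n)
          then have "\<eta> n x = 1" using d(2) by (intro c(8)) (metis dist_commute less_imp_le order_trans)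
          then show ?case by simp
        qed
        then show False using tendsto_eventually[of "\<lambda>n. \<eta> n x * a x"] x(1) by simp
      qed
    qed
    show "AE x in lborel. norm (\<eta> n x * a x) \<le> norm (a x)" for n
      using c(3,4) by (intro AE_I2) (simp add: abs_mult mult_left_le_one_le)
  qed (use ia am \<eta>m in auto)
  moreover have "(\<lambda>n. LBINT x. \<eta> n x * a x) \<longlonglongrightarrow> 0"
  proof (rule Lim_null_comparison)
    show "\<forall>\<^sub>F n in sequentially. norm (LBINT x. \<eta> n x * a x) \<le> B * e n"
      using eq bnd by (intro always_eventually) simp
    show "(\<lambda>n. B * e n) \<longlonglongrightarrow> 0" using tendsto_mult_right_zero[OF e0] .
  qed
  ultimately have "(LBINT x. a x) = 0" by (rule LIMSEQ_unique)
  then show ?thesis by (simp add: J_def a_def)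
qed

text \<open>For a function supported off \<open>M\<close>, only \<open>E\<close> is left of the
  complement of \<open>W\<close>. The set \<open>\<Omega> - M\<close> need not be open, since
  \<open>M\<close> may accumulate at points of \<open>E\<close>; a compact support inside it is all
  that \<open>C1c\<close> asks for.\<close>

lemma J_off_M: "C1c (\<Omega> - M) f Df \<Longrightarrow> J f Df = 0"
proof (rule J_remove_E[of "\<Omega> - M"])
  have "\<Omega> - M - E \<subseteq> W" using cover by blast
  then show "J f Df = 0" if "C1c (\<Omega> - M - E) f Df" for f Df
    using J_W C1c_mono that by blast
qed auto

end

subsection \<open>Integrals over thin layers\<close>

text \<open>A one-sided approximation of the Heaviside function. Its derivative is a nonnegative
  bump of integral one that lives strictly inside \<open>t > 0\<close>, so
  \<open>ramp' n (g x)\<close> weights a thin layer on one side of the level set only.\<close>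

definition ramp :: "nat \<Rightarrow> real \<Rightarrow> real" where
  "ramp n t = step (real (Suc n) * t)"

definition ramp' :: "nat \<Rightarrow> real \<Rightarrow> real" where
  "ramp' n t = real (Suc n) * step' (real (Suc n) * t)"

lemma DERIV_ramp: "(ramp n has_real_derivative ramp' n t) (at t)"
  unfolding ramp_def[abs_def] ramp'_def
  using DERIV_chain2[OF DERIV_step DERIV_cmult_Id, of "real (Suc n)" t] by (simp only: mult.commute)

lemma DERIV_ramp_minus: "((\<lambda>t. ramp n (- t)) has_real_derivative - ramp' n (- t)) (at t)"
  using DERIV_chain2[OF DERIV_ramp DERIV_minus[OF DERIV_ident], of n t] by simp

lemma continuous_on_ramp': "continuous_on S (ramp' n)"
  unfolding ramp'_def[abs_def]
  by (intro continuous_intros continuous_on_compose2[OF continuous_on_step'[of UNIV]]) auto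

lemma continuous_on_ramp'_compose [continuous_intros]:
  "continuous_on S f \<Longrightarrow> continuous_on S (\<lambda>x. ramp' n (f x))"
  by (rule continuous_on_compose2[OF continuous_on_ramp'[of UNIV]]) auto

lemma ramp_bounds: "0 \<le> ramp n t" "ramp n t \<le> 1"
  by (simp_all add: ramp_def step_bounds)

lemma ramp'_nonneg: "0 \<le> ramp' n t"
  by (simp add: ramp'_def step'_nonneg)

lemma ramp_eq_0: "t \<le> 1 / real (Suc n) \<Longrightarrow> ramp n t = 0"
  unfolding ramp_def by (rule step_eq_0) (simp add: field_simps)

lemma ramp'_eq_0: "t \<le> 1 / real (Suc n) \<Longrightarrow> ramp' n t = 0"
  unfolding ramp'_def by (subst step'_eq_0) (simp_all add: field_simps)

lemma ramp_nonpos [simp]: "t \<le> 0 \<Longrightarrow> ramp n t = 0"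
  by (rule ramp_eq_0) (simp add: order_trans)

lemma ramp'_nonpos [simp]: "t \<le> 0 \<Longrightarrow> ramp' n t = 0"
  by (rule ramp'_eq_0) (simp add: order_trans)

lemma ramp_tendsto: "(\<lambda>n. ramp n t) \<longlonglongrightarrow> (if 0 < t then 1 else 0)"
proof (cases "0 < t")
  case True
  have "\<forall>\<^sub>F n in sequentially. ramp n t = 1"
  proof -
    obtain N :: nat where N: "2 < real N * t" using reals_Archimedean3[OF True] by blast
    have "ramp n t = 1" if "N \<le> n" for n
      unfolding ramp_def
    proof (rule step_eq_1)
      have "real N * t \<le> real (Suc n) * t" using True that by (intro mult_right_mono) auto
      then show "2 \<le> real (Suc n) * t" using N by linarith
    qed
    then show ?thesis unfolding eventually_sequentially by blast
  qed
  then have "(\<lambda>n. ramp n t) \<longlonglongrightarrow> 1" by (rule tendsto_eventually)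
  then show ?thesis using True by simp
qed simp

text \<open>The even function \<open>even_ramp n\<close> vanishes near \<open>0\<close> and tends to \<open>1\<close> elsewhere; the odd
  function with derivative \<open>abs_ramp' n = |even_ramp' n|\<close> is \<open>\<lambda>t. ramp n t - ramp n (-t)\<close>.\<close>

definition even_ramp :: "nat \<Rightarrow> real \<Rightarrow> real" where
  "even_ramp n t = ramp n t + ramp n (- t)"

definition even_ramp' :: "nat \<Rightarrow> real \<Rightarrow> real" where
  "even_ramp' n t = ramp' n t - ramp' n (- t)"

definition abs_ramp' :: "nat \<Rightarrow> real \<Rightarrow> real" where
  "abs_ramp' n t = ramp' n t + ramp' n (- t)"

lemma DERIV_even_ramp: "(even_ramp n has_real_derivative even_ramp' n t) (at t)"
  unfolding even_ramp_def[abs_def] even_ramp'_def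
  using DERIV_add[OF DERIV_ramp[of n t] DERIV_ramp_minus[of n t]] by simp

lemma DERIV_odd_ramp: "((\<lambda>t. ramp n t - ramp n (- t)) has_real_derivative abs_ramp' n t) (at t)"
  unfolding abs_ramp'_def
  using DERIV_diff[OF DERIV_ramp[of n t] DERIV_ramp_minus[of n t]] by simp

lemma continuous_on_even_ramp': "continuous_on S (even_ramp' n)"
  unfolding even_ramp'_def[abs_def] by (intro continuous_intros)

lemma continuous_on_abs_ramp': "continuous_on S (abs_ramp' n)"
  unfolding abs_ramp'_def[abs_def] by (intro continuous_intros)

lemma even_ramp'_le_abs_ramp': "\<bar>even_ramp' n t\<bar> \<le> abs_ramp' n t"
  using ramp'_nonneg[of n t] ramp'_nonneg[of n "- t"] by (simp add: even_ramp'_def abs_ramp'_def abs_le_iff)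

lemma abs_ramp'_nonneg: "0 \<le> abs_ramp' n t"
  using even_ramp'_le_abs_ramp'[of n t] by linarith

lemma even_ramp_bounds: "0 \<le> even_ramp n t" "even_ramp n t \<le> 1"
  using ramp_bounds[of n t] ramp_bounds[of n "- t"] by (cases "0 \<le> t"; simp add: even_ramp_def)+

lemma even_ramp_tendsto: "t \<noteq> 0 \<Longrightarrow> (\<lambda>n. even_ramp n t) \<longlonglongrightarrow> 1"
  unfolding even_ramp_def using tendsto_add[OF ramp_tendsto[of t] ramp_tendsto[of "- t"]]
  by (cases "0 < t") auto

text \<open>Polynomials are globally C^1 and may multiply functions of class \<open>C1c\<close>;
  they are the approximants that the Stone-Weierstrass theorem provides.\<close>

lemma real_polynomial_function_GDERIV:
  fixes q :: "'a::euclidean_space \<Rightarrow> real"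
  assumes "real_polynomial_function q"
  shows "\<exists>Dq. (\<forall>x. GDERIV q x :> Dq x) \<and> continuous_on UNIV Dq"
  using assms
proof induction
  case (linear f)
  have "f h = h \<bullet> (\<Sum>b\<in>Basis. f b *\<^sub>R b)" for h
  proof -
    have "f (\<Sum>b\<in>Basis. (h \<bullet> b) *\<^sub>R b) = (\<Sum>b\<in>Basis. (h \<bullet> b) * f b)"
      using linear by (simp add: bounded_linear.linear linear_sum linear_cmul)
    then show ?thesis by (simp add: euclidean_representation inner_sum_right mult.commute)
  qed
  then have "f = (\<lambda>h. h \<bullet> (\<Sum>b\<in>Basis. f b *\<^sub>R b))" by (rule ext)
  then have "GDERIV f x :> (\<Sum>b\<in>Basis. f b *\<^sub>R b)" for x
    unfolding gderiv_def by (rule has_derivative_eq_rhs[OF bounded_linear_imp_has_derivative[OF linear]])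
  then show ?case by (intro exI[of _ "\<lambda>_. \<Sum>b\<in>Basis. f b *\<^sub>R b"]) auto
next
  case (const c)
  then show ?case by (intro exI[of _ "\<lambda>_. 0"]) (simp add: GDERIV_const)
next
  case (add f g)
  then obtain Df Dg where "\<forall>x. GDERIV f x :> Df x" "continuous_on UNIV Df"
    "\<forall>x. GDERIV g x :> Dg x" "continuous_on UNIV Dg" by blast
  then show ?case
    by (intro exI[of _ "\<lambda>x. Df x + Dg x"]) (auto intro!: GDERIV_add continuous_intros)
next
  case (mult f g)
  then obtain Df Dg where D: "\<forall>x. GDERIV f x :> Df x" "continuous_on UNIV Df"
    "\<forall>x. GDERIV g x :> Dg x" "continuous_on UNIV Dg" by blast
  then have "continuous_on UNIV f" "continuous_on UNIV g"
    using GDERIV_continuous_on by blast+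
  with D show ?case
    by (intro exI[of _ "\<lambda>x. f x *\<^sub>R Dg x + g x *\<^sub>R Df x"]) (auto intro!: GDERIV_mult continuous_intros)
qed

context C1_on
begin

lemma C1_on_uminus: "C1_on U (\<lambda>x. - g x) (\<lambda>x. - dg x)"
  by unfold_locales (auto intro!: open_U GDERIV_minus G continuous_intros cont_dg)

text \<open>\<open>trace b Df\<close> is the surface integral of \<open>f\<close> over \<open>g = 0\<close> with weight \<open>\<nu> \<bullet> b\<close>.\<close>

definition trace :: "'a \<Rightarrow> ('a \<Rightarrow> 'a) \<Rightarrow> real" where
  "trace b Df = - (LBINT x. indicator {x \<in> U. 0 < g x} x * (Df x \<bullet> b))"

lemma pos_set: "{x \<in> U. 0 < g x} \<in> sets borel"
proof -
  have "open (U \<inter> g -` {0<..})" by (rule continuous_open_preimage[OF cont_g open_U]) auto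
  moreover have "U \<inter> g -` {0<..} = {x \<in> U. 0 < g x}" by auto
  ultimately show ?thesis by simp
qed

text \<open>Integration by parts turns the layer integral into minus a volume integral of
  \<open>ramp n (g x)\<close> against \<open>Df x \<bullet> b\<close>, and
  \<open>ramp n (g x)\<close> tends boundedly to the indicator of \<open>g > 0\<close>.\<close>

lemma trace_limit:
  assumes f: "C1c U f Df"
  shows "(\<lambda>n. LBINT x. indicator U x * (f x * ramp' n (g x) * (dg x \<bullet> b))) \<longlonglongrightarrow> trace b Df"
proof -
  note L = layer_integral[OF f DERIV_ramp continuous_on_ramp', of _ b]
  have iD: "integrable lborel (\<lambda>x. norm (Df x \<bullet> b))"
    by (intro integrable_norm integrable_inner_left C1c_integrable_D[OF f])
  have "(\<lambda>n. LBINT x. indicator U x * (ramp n (g x) * (Df x \<bullet> b)))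
      \<longlonglongrightarrow> (LBINT x. indicator {x \<in> U. 0 < g x} x * (Df x \<bullet> b))"
  proof (rule integral_dominated_convergence[where w = "\<lambda>x. norm (Df x \<bullet> b)"])
    show "(\<lambda>x. indicator {x \<in> U. 0 < g x} x * (Df x \<bullet> b)) \<in> borel_measurable lborel"
      using pos_set borel_measurable_integrable[OF C1c_integrable_D[OF f]] by simp
    show "(\<lambda>x. indicator U x * (ramp n (g x) * (Df x \<bullet> b))) \<in> borel_measurable lborel" for n
      using L(2) by (rule borel_measurable_integrable)
    show "AE x in lborel. (\<lambda>n. indicator U x * (ramp n (g x) * (Df x \<bullet> b))) \<longlonglongrightarrow> indicator {x \<in> U. 0 < g x} x * (Df x \<bullet> b)"
    proof (rule AE_I2)
      fix x
      have "(\<lambda>n. indicator U x * (ramp n (g x) * (Df x \<bullet> b))) \<longlonglongrightarrow> indicator U x * ((if 0 < g x then 1 else 0) * (Df x \<bullet> b))"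
        by (intro tendsto_mult tendsto_const ramp_tendsto)
      also have "indicator U x * ((if 0 < g x then 1 else 0) * (Df x \<bullet> b)) = indicator {x \<in> U. 0 < g x} x * (Df x \<bullet> b)"
        by (auto simp: indicator_def)
      finally show "(\<lambda>n. indicator U x * (ramp n (g x) * (Df x \<bullet> b))) \<longlonglongrightarrow> indicator {x \<in> U. 0 < g x} x * (Df x \<bullet> b)" .
    qed
    show "AE x in lborel. norm (indicator U x * (ramp n (g x) * (Df x \<bullet> b))) \<le> norm (Df x \<bullet> b)" for n
      using ramp_bounds by (intro AE_I2) (auto simp: indicator_def abs_mult mult_left_le_one_le)
  qed (use iD in auto)
  from tendsto_minus[OF this] show ?thesis unfolding L(3) trace_def .
qed

text \<open>Approaching from \<open>g < 0\<close> gives the integral of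
  \<open>Df x \<bullet> b\<close> over that side, with the opposite sign. The two limits agree
  because the integral over the whole space is zero and the level set is null.\<close>

lemma trace_limit_uminus:
  assumes f: "C1c U f Df" and null: "{x \<in> U. g x = 0} \<in> null_sets lborel"
  shows "(\<lambda>n. LBINT x. indicator U x * (f x * ramp' n (- g x) * (dg x \<bullet> b))) \<longlonglongrightarrow> trace b Df"
proof -
  interpret m: C1_on U "\<lambda>x. - g x" "\<lambda>x. - dg x" by (rule C1_on_uminus)
  have "(\<lambda>n. - (LBINT x. indicator U x * (f x * ramp' n (- g x) * (dg x \<bullet> b)))) \<longlonglongrightarrow> m.trace b Df"
    using m.trace_limit[OF f, of b] by simp
  from tendsto_minus[OF this]
  have "(\<lambda>n. LBINT x. indicator U x * (f x * ramp' n (- g x) * (dg x \<bullet> b))) \<longlonglongrightarrow> - m.trace b Df" by simp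
  moreover have "- m.trace b Df = trace b Df"
  proof -
    have iD: "integrable lborel (\<lambda>x. Df x \<bullet> b)" by (intro integrable_inner_left C1c_integrable_D[OF f])
    have i: "integrable lborel (\<lambda>x. indicator S x * (Df x \<bullet> b))" if "S \<in> sets borel" for S
      using integrable_mult_indicator[OF _ iD, of S] that by simp
    have "(LBINT x. indicator {x \<in> U. 0 < g x} x * (Df x \<bullet> b) + indicator {x \<in> U. 0 < - g x} x * (Df x \<bullet> b))
       = (LBINT x. Df x \<bullet> b)"
    proof (rule integral_cong_AE)
      obtain C where C: "C \<subseteq> U" "\<And>x. x \<notin> C \<Longrightarrow> Df x = 0" using C1c_support[OF f] by metis
      show "AE x in lborel. indicator {x \<in> U. 0 < g x} x * (Df x \<bullet> b) + indicator {x \<in> U. 0 < - g x} x * (Df x \<bullet> b) = Df x \<bullet> b"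
      proof (rule AE_I'[OF null])
        have "x \<in> {x \<in> U. g x = 0}" if "indicator {x \<in> U. 0 < g x} x * (Df x \<bullet> b) + indicator {x \<in> U. 0 < - g x} x * (Df x \<bullet> b) \<noteq> Df x \<bullet> b" for x
        proof -
          have "x \<in> C" by (rule ccontr) (use that C(2)[of x] in auto)
          then have "x \<in> U" using C(1) by blast
          then show ?thesis using that by (cases "g x" "0::real" rule: linorder_cases) auto
        qed
        then show "{x \<in> space lborel. indicator {x \<in> U. 0 < g x} x * (Df x \<bullet> b) + indicator {x \<in> U. 0 < - g x} x * (Df x \<bullet> b) \<noteq> Df x \<bullet> b} \<subseteq> {x \<in> U. g x = 0}"
          by blast
      qed
      show "(\<lambda>x. indicator {x \<in> U. 0 < g x} x * (Df x \<bullet> b) + indicator {x \<in> U. 0 < - g x} x * (Df x \<bullet> b)) \<in> borel_measurable lborel"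
        by (intro borel_measurable_add borel_measurable_integrable i pos_set m.pos_set)
      show "(\<lambda>x. Df x \<bullet> b) \<in> borel_measurable lborel" using iD by (rule borel_measurable_integrable)
    qed
    also have "\<dots> = 0" by (rule C1c_integral_D[OF f])
    finally show ?thesis
      using Bochner_Integration.integral_add[OF i[OF pos_set] i[OF m.pos_set]]
      by (simp add: trace_def m.trace_def)
  qed
  ultimately show ?thesis by simp
qed

text \<open>Layer integrals are monotone, as \<open>ramp'\<close> and
  \<open>dg x \<bullet> b\<close> are nonnegative, and the inequality survives the limit.\<close>

lemma trace_mono:
  assumes f: "C1c U f Df" and h: "C1c U h Dh" and le: "\<And>x. f x \<le> c * h x"
    and pos: "\<And>x. x \<in> U \<Longrightarrow> 0 \<le> dg x \<bullet> b"
  shows "trace b Df \<le> c * trace b Dh"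
proof (rule LIMSEQ_le[OF trace_limit[OF f] tendsto_mult[OF tendsto_const trace_limit[OF h]]])
  note L = layer_integral(1)[OF _ DERIV_ramp continuous_on_ramp', of _ _ _ b]
  have "(LBINT x. indicator U x * (f x * ramp' n (g x) * (dg x \<bullet> b)))
    \<le> c * (LBINT x. indicator U x * (h x * ramp' n (g x) * (dg x \<bullet> b)))" for n
  proof -
    have "(LBINT x. indicator U x * (f x * ramp' n (g x) * (dg x \<bullet> b)))
      \<le> (LBINT x. c * (indicator U x * (h x * ramp' n (g x) * (dg x \<bullet> b))))"
    proof (rule integral_mono[OF L[OF f] integrable_mult_right[OF L[OF h]]])
      fix x
      show "indicator U x * (f x * ramp' n (g x) * (dg x \<bullet> b)) \<le> c * (indicator U x * (h x * ramp' n (g x) * (dg x \<bullet> b)))"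
      proof (cases "x \<in> U")
        case True
        have "f x * (ramp' n (g x) * (dg x \<bullet> b)) \<le> (c * h x) * (ramp' n (g x) * (dg x \<bullet> b))"
          using le[of x] ramp'_nonneg[of n "g x"] pos[OF True] by (intro mult_right_mono mult_nonneg_nonneg)
        then show ?thesis using True by (simp add: mult.assoc)
      qed simp
    qed
    then show ?thesis by simp
  qed
  then show "\<exists>N. \<forall>n\<ge>N. (LBINT x. indicator U x * (f x * ramp' n (g x) * (dg x \<bullet> b)))
    \<le> c * (LBINT x. indicator U x * (h x * ramp' n (g x) * (dg x \<bullet> b)))" by blast
qed

end

section \<open>Layer integrals of the field and its jump across a level set\<close>

locale flux_layer = flux \<Omega> W E M V H + C1_on U g dg
  for \<Omega> W E M :: "'a::euclidean_space set" and V H and U :: "'a set" and g dg +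
  assumes UO: "U \<subseteq> \<Omega>" and M_eq: "M \<inter> U = {x \<in> U. g x = 0}"
begin

lemma level_null: "{x \<in> U. g x = 0} \<in> null_sets lborel"
proof -
  have "closedin (top_of_set U) {x \<in> U. g x = 0}"
    using continuous_closedin_preimage_constant[OF cont_g] .
  then obtain C where "closed C" "{x \<in> U. g x = 0} = U \<inter> C" unfolding closedin_closed by blast
  then have "{x \<in> U. g x = 0} \<in> sets lborel" using open_U by simp
  moreover have "{x \<in> U. g x = 0} \<subseteq> \<Omega> - W" using UO M_eq MW by blast
  ultimately show ?thesis using null null_sets_subset by blast
qed

text \<open>The product of \<open>f\<close> and \<open>even_ramp n (g x)\<close> vanishes near the
  level set, so \<open>J\<close> is zero on it. By the product rule the part containing
  \<open>even_ramp'\<close> is minus a part that converges to \<open>J f Df\<close>. The limit is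
  thus obtained without any knowledge of boundary values of \<open>V\<close>.\<close>

lemma layer_limit:
  assumes f: "C1c U f Df"
  shows "\<And>n. integrable lborel (\<lambda>x. indicator W x * (f x * even_ramp' n (g x) * (V x \<bullet> dg x)))"
    and "(\<lambda>n. LBINT x. indicator W x * (f x * even_ramp' n (g x) * (V x \<bullet> dg x))) \<longlonglongrightarrow> - J f Df"
proof -
  obtain C where C: "compact C" "C \<subseteq> U" "\<And>x. x \<notin> C \<Longrightarrow> f x = 0" "\<And>x. x \<notin> C \<Longrightarrow> Df x = 0"
    using C1c_support[OF f] by blast
  have fO: "C1c \<Omega> f Df" by (rule C1c_mono[OF f UO])
  define a where "a x = indicator W x * (V x \<bullet> Df x + H x * f x)" for x
  define r where "r n x = indicator W x * (f x * even_ramp' n (g x) * (V x \<bullet> dg x))" for n x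
  have ia: "integrable lborel a" unfolding a_def by (rule integrable_J[OF fO])
  have a0: "a x = 0" if "x \<notin> U" for x
  proof -
    have "x \<notin> C" using that C(2) by blast
    then show ?thesis by (simp add: a_def C(3,4))
  qed
  have Pm: "(\<lambda>x. indicator U x *\<^sub>R even_ramp n (g x)) \<in> borel_measurable borel" for n
    using open_U compose(3)[OF DERIV_even_ramp continuous_on_even_ramp'] by (intro borel_measurable_continuous_on_indicator) auto
  have iP: "integrable lborel (\<lambda>x. even_ramp n (g x) * a x)" for n
  proof (rule Bochner_Integration.integrable_bound[OF ia])
    have "(\<lambda>x. (indicator U x *\<^sub>R even_ramp n (g x)) * a x) \<in> borel_measurable lborel"
      using Pm[of n] borel_measurable_integrable[OF ia] by simp
    moreover have "(\<lambda>x. (indicator U x *\<^sub>R even_ramp n (g x)) * a x) = (\<lambda>x. even_ramp n (g x) * a x)"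
      using a0 by (auto simp: fun_eq_iff indicator_def)
    ultimately show "(\<lambda>x. even_ramp n (g x) * a x) \<in> borel_measurable lborel" by (simp only:)
    show "AE x in lborel. norm (even_ramp n (g x) * a x) \<le> norm (a x)"
      using even_ramp_bounds by (intro AE_I2) (simp add: abs_mult mult_left_le_one_le)
  qed
  have key: "integrable lborel (r n)" "(LBINT x. r n x) = - (LBINT x. even_ramp n (g x) * a x)" for n
  proof -
    define D where "D x = indicator U x *\<^sub>R (f x *\<^sub>R (even_ramp' n (g x) *\<^sub>R dg x) + even_ramp n (g x) *\<^sub>R Df x)" for x
    have m: "C1c U (\<lambda>x. f x * even_ramp n (g x)) D"
      unfolding D_def by (rule C1c_mult[OF f open_U compose(1,2)[OF DERIV_even_ramp continuous_on_even_ramp']])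
    have "C1c (\<Omega> - M) (\<lambda>x. f x * even_ramp n (g x)) D"
      unfolding C1c_def
    proof (intro conjI exI)
      show "\<forall>x. GDERIV (\<lambda>x. f x * even_ramp n (g x)) x :> D x" using C1c_GDERIV[OF m] by blast
      show "continuous_on UNIV D" by (rule C1c_continuous_D[OF m])
      \<comment> \<open>Where \<open>\<bar>g x\<bar>\<close> is below
        \<open>1 / real (Suc n)\<close> both halves of \<open>even_ramp\<close> vanish, so this
        compact set off the level set carries the product.\<close>
      let ?C = "C \<inter> (\<lambda>x. \<bar>g x\<bar>) -` {1 / real (Suc n)..}"
      show "?C \<subseteq> \<Omega> - M"
      proof
        fix x assume x: "x \<in> ?C"
        then have "g x \<noteq> 0" by auto
        then show "x \<in> \<Omega> - M" using x C(2) UO M_eq by blast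
      qed
      have "closed ?C"
        using C(1,2) by (intro continuous_closed_preimage continuous_intros continuous_on_subset[OF cont_g])
          (auto intro: compact_imp_closed)
      then have "compact (C \<inter> ?C)" by (rule compact_Int_closed[OF C(1)])
      then show "compact ?C" by (simp add: Int_assoc[symmetric])
      show "\<forall>x. x \<notin> ?C \<longrightarrow> f x * even_ramp n (g x) = 0"
      proof (intro allI impI)
        fix x assume "x \<notin> ?C"
        then consider "x \<notin> C" | "\<bar>g x\<bar> < 1 / real (Suc n)" by fastforce
        then show "f x * even_ramp n (g x) = 0"
        proof cases
          case 2
          then have "even_ramp n (g x) = 0" unfolding even_ramp_def by (intro add_nonneg_eq_0_iff[THEN iffD2] conjI ramp_eq_0 ramp_bounds) auto
          then show ?thesis by simp
        qed (simp add: C(3))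
      qed
    qed
    then have "J (\<lambda>x. f x * even_ramp n (g x)) D = 0" by (rule J_off_M)
    moreover have eq: "indicator W x * (V x \<bullet> D x + H x * (f x * even_ramp n (g x))) = r n x + even_ramp n (g x) * a x" for x
    proof (cases "x \<in> U")
      case True
      then show ?thesis by (simp add: D_def r_def a_def inner_add_right algebra_simps)
    next
      case False
      then have "f x = 0" using C by blast
      then show ?thesis using False a0[of x] by (simp add: D_def r_def)
    qed
    ultimately have s: "(LBINT x. r n x + even_ramp n (g x) * a x) = 0" by (simp add: J_def)
    have "integrable lborel (\<lambda>x. r n x + even_ramp n (g x) * a x)"
      using integrable_J[OF C1c_mono[OF m UO]] unfolding eq .
    from Bochner_Integration.integrable_diff[OF this iP[of n]]
    show i: "integrable lborel (r n)" by simp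
    show "(LBINT x. r n x) = - (LBINT x. even_ramp n (g x) * a x)"
      using s Bochner_Integration.integral_add[OF i iP[of n]] by simp
  qed
  show "\<And>n. integrable lborel (\<lambda>x. indicator W x * (f x * even_ramp' n (g x) * (V x \<bullet> dg x)))"
    using key(1) unfolding r_def .
  have "(\<lambda>n. LBINT x. even_ramp n (g x) * a x) \<longlonglongrightarrow> (LBINT x. a x)"
  proof (rule integral_dominated_convergence[where w = "\<lambda>x. norm (a x)"])
    show "AE x in lborel. (\<lambda>n. even_ramp n (g x) * a x) \<longlonglongrightarrow> a x"
    proof (rule AE_I2)
      fix x
      show "(\<lambda>n. even_ramp n (g x) * a x) \<longlonglongrightarrow> a x"
      proof (cases "x \<in> U \<and> x \<in> W")
        case True
        then have "g x \<noteq> 0" using M_eq MW by blast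
        then show ?thesis using tendsto_mult[OF even_ramp_tendsto tendsto_const, of "g x" "a x"] by simp
      next
        case False
        then have "a x = 0" using a0[of x] by (auto simp: a_def)
        then show ?thesis by simp
      qed
    qed
    show "AE x in lborel. norm (even_ramp n (g x) * a x) \<le> norm (a x)" for n
      using even_ramp_bounds by (intro AE_I2) (simp add: abs_mult mult_left_le_one_le)
  qed (use ia iP in auto)
  from tendsto_minus[OF this]
  show "(\<lambda>n. LBINT x. indicator W x * (f x * even_ramp' n (g x) * (V x \<bullet> dg x))) \<longlonglongrightarrow> - J f Df"
    unfolding key(2)[symmetric] r_def by (simp add: J_def a_def)
qed

lemma AE_U: "AE x in lborel. x \<in> U \<longrightarrow> x \<in> W"
  by (rule AE_I'[OF null]) (use UO in auto)

text \<open>The layer integral of \<open>V x \<bullet> dg x\<close> is close to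
  \<open>\<alpha>\<close> times the integral over the upper layer minus \<open>\<beta>\<close> times
  that over the lower one. Both of these tend to the same trace, while the layer integral itself
  tends to \<open>- J f Df = 0\<close>. The error \<open>\<delta>\<close> occurs once on each side,
  hence the factor 2. The trace is not divided out because its positivity is a separate
  matter.\<close>

lemma jump_estimate:
  assumes f: "C1c U f Df" and f0: "\<And>x. 0 \<le> f x" and zero: "J f Df = 0"
    and pos: "\<And>x. x \<in> U \<Longrightarrow> 0 \<le> dg x \<bullet> b"
    and up: "\<And>x. x \<in> U \<Longrightarrow> x \<in> W \<Longrightarrow> 0 < g x \<Longrightarrow> \<bar>V x \<bullet> dg x - \<alpha> * (dg x \<bullet> b)\<bar> \<le> \<delta> * (dg x \<bullet> b)"
    and lo: "\<And>x. x \<in> U \<Longrightarrow> x \<in> W \<Longrightarrow> g x < 0 \<Longrightarrow> \<bar>V x \<bullet> dg x - \<beta> * (dg x \<bullet> b)\<bar> \<le> \<delta> * (dg x \<bullet> b)"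
  shows "\<bar>\<alpha> - \<beta>\<bar> * trace b Df \<le> 2 * \<delta> * trace b Df"
proof -
  define q where "q n x = indicator U x * (f x * ramp' n (g x) * (dg x \<bullet> b))" for n x
  define q' where "q' n x = indicator U x * (f x * ramp' n (- g x) * (dg x \<bullet> b))" for n x
  define r where "r n x = indicator W x * (f x * even_ramp' n (g x) * (V x \<bullet> dg x))" for n x
  interpret m: C1_on U "\<lambda>x. - g x" "\<lambda>x. - dg x" by (rule C1_on_uminus)
  have iq: "integrable lborel (q n)" for n
    unfolding q_def by (rule layer_integral(1)[OF f DERIV_ramp continuous_on_ramp'])
  have iq': "integrable lborel (q' n)" for n
    using m.layer_integral(1)[OF f DERIV_ramp continuous_on_ramp', of n b] unfolding q'_def by simp
  have ir: "integrable lborel (r n)" for n unfolding r_def by (rule layer_limit(1)[OF f])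
  have lq: "(\<lambda>n. LBINT x. q n x) \<longlonglongrightarrow> trace b Df" unfolding q_def by (rule trace_limit[OF f])
  have lq': "(\<lambda>n. LBINT x. q' n x) \<longlonglongrightarrow> trace b Df" unfolding q'_def by (rule trace_limit_uminus[OF f level_null])
  have lr: "(\<lambda>n. LBINT x. r n x) \<longlonglongrightarrow> 0" using layer_limit(2)[OF f] unfolding r_def zero by simp
  have fx: "f x = 0" if "x \<notin> U" for x using C1c_support[OF f] that by (metis subsetD)
  have est: "\<bar>\<alpha> * (LBINT x. q n x) - \<beta> * (LBINT x. q' n x) - (LBINT x. r n x)\<bar>
     \<le> \<delta> * ((LBINT x. q n x) + (LBINT x. q' n x))" for n
  proof -
    have "\<alpha> * (LBINT x. q n x) - \<beta> * (LBINT x. q' n x) - (LBINT x. r n x)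
      = (LBINT x. \<alpha> * q n x - \<beta> * q' n x - r n x)"
      using iq iq' ir by simp
    also have "\<bar>\<dots>\<bar> \<le> (LBINT x. \<bar>\<alpha> * q n x - \<beta> * q' n x - r n x\<bar>)" by (rule integral_abs_bound)
    also have "\<dots> \<le> (LBINT x. \<delta> * (q n x + q' n x))"
    proof (rule integral_mono_AE)
      show "integrable lborel (\<lambda>x. \<bar>\<alpha> * q n x - \<beta> * q' n x - r n x\<bar>)" using iq iq' ir by auto
      show "integrable lborel (\<lambda>x. \<delta> * (q n x + q' n x))" using iq iq' by auto
      show "AE x in lborel. \<bar>\<alpha> * q n x - \<beta> * q' n x - r n x\<bar> \<le> \<delta> * (q n x + q' n x)"
        using AE_U
      proof eventually_elim
        case (elim x)
        show ?case
        proof (cases "x \<in> U")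
          case True
          then have W: "x \<in> W" using elim by blast
          show ?thesis
          proof (cases "g x" "0::real" rule: linorder_cases)
            case less
            have "f x * ramp' n (- g x) * \<bar>V x \<bullet> dg x - \<beta> * (dg x \<bullet> b)\<bar> \<le> f x * ramp' n (- g x) * (\<delta> * (dg x \<bullet> b))"
              using lo[OF True W less] f0 ramp'_nonneg by (intro mult_left_mono mult_nonneg_nonneg) auto
            then have "\<bar>f x * ramp' n (- g x) * (V x \<bullet> dg x - \<beta> * (dg x \<bullet> b))\<bar> \<le> f x * ramp' n (- g x) * (\<delta> * (dg x \<bullet> b))"
              using f0 ramp'_nonneg by (simp add: abs_mult)
            then show ?thesis using True W less by (simp add: q_def q'_def r_def even_ramp'_def algebra_simps)
          next
            case equal
            then show ?thesis using True W by (simp add: q_def q'_def r_def even_ramp'_def)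
          next
            case greater
            have "f x * ramp' n (g x) * \<bar>V x \<bullet> dg x - \<alpha> * (dg x \<bullet> b)\<bar> \<le> f x * ramp' n (g x) * (\<delta> * (dg x \<bullet> b))"
              using up[OF True W greater] f0 ramp'_nonneg by (intro mult_left_mono mult_nonneg_nonneg) auto
            then have "\<bar>f x * ramp' n (g x) * (V x \<bullet> dg x - \<alpha> * (dg x \<bullet> b))\<bar> \<le> f x * ramp' n (g x) * (\<delta> * (dg x \<bullet> b))"
              using f0 ramp'_nonneg by (simp add: abs_mult)
            then show ?thesis using True W greater by (simp add: q_def q'_def r_def even_ramp'_def algebra_simps)
          qed
        next
          case False
          then show ?thesis using fx by (simp add: q_def q'_def r_def)
        qed
      qed
    qed
    also have "\<dots> = \<delta> * ((LBINT x. q n x) + (LBINT x. q' n x))" using iq iq' by simp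
    finally show ?thesis .
  qed
  have "\<bar>\<alpha> * trace b Df - \<beta> * trace b Df - 0\<bar> \<le> \<delta> * (trace b Df + trace b Df)"
    by (rule LIMSEQ_le[OF tendsto_rabs[OF tendsto_diff[OF tendsto_diff[OF tendsto_mult[OF tendsto_const lq] tendsto_mult[OF tendsto_const lq']] lr]]
      tendsto_mult[OF tendsto_const tendsto_add[OF lq lq']]]) (use est in blast)
  moreover have T0: "0 \<le> trace b Df"
  proof (rule LIMSEQ_le_const[OF lq])
    have "0 \<le> (LBINT x. q n x)" for n
      unfolding q_def using f0 ramp'_nonneg pos by (intro Bochner_Integration.integral_nonneg) (auto simp: indicator_def)
    then show "\<exists>N. \<forall>n\<ge>N. 0 \<le> (LBINT x. q n x)" by blast
  qed
  moreover have "\<bar>\<alpha> * trace b Df - \<beta> * trace b Df - 0\<bar> = \<bar>\<alpha> - \<beta>\<bar> * trace b Df"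
  proof -
    have "\<alpha> * trace b Df - \<beta> * trace b Df - 0 = (\<alpha> - \<beta>) * trace b Df"
      by (simp add: left_diff_distrib)
    then show ?thesis by (simp only: abs_mult abs_of_nonneg[OF T0])
  qed
  moreover have "\<delta> * (trace b Df + trace b Df) = 2 * \<delta> * trace b Df" by simp
  ultimately show ?thesis by linarith
qed

end

text \<open>If the normal component of \<open>V\<close> extends continuously across \<open>M\<close>, then it is approximated
  by \<open>q (dg \<bullet> b)\<close> with a polynomial \<open>q\<close>, for which the two sides of the layer cancel.\<close>

lemma (in flux_layer) J_zero_if_continuous:
  assumes U: "U = ball p (2 * r)" and f: "C1c (ball p r) f Df" and r: "0 < r"
    and c: "0 < c" "\<And>x. x \<in> U \<Longrightarrow> c \<le> dg x \<bullet> b"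
    and w: "continuous_on U w" "\<And>x. x \<in> U - M \<Longrightarrow> w x = V x \<bullet> dg x"
  shows "J f Df = 0"
proof -
  have sub: "ball p r \<subseteq> U" using r by (auto simp: U)
  have fU: "C1c U f Df" by (rule C1c_mono[OF f sub])
  obtain C where C: "compact C" "C \<subseteq> ball p r" "\<And>x. x \<notin> C \<Longrightarrow> f x = 0" "\<And>x. x \<notin> C \<Longrightarrow> Df x = 0"
    using C1c_support[OF f] by blast
  have CU: "C \<subseteq> U" using C(2) sub by blast
  obtain B where B: "0 < B" "\<And>x. \<bar>f x\<bar> \<le> B" "\<And>x. norm (Df x) \<le> B"
    using C1c_bounds[OF f] by blast
  \<comment> \<open>The bump is 1 on the support of \<open>f\<close>, so
    \<open>B * \<theta> x\<close> dominates \<open>\<bar>f x\<bar>\<close>; unlike the latter it is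
    a C^1 weight and can be integrated by parts.\<close>
  define \<theta> where "\<theta> x = 1 - cut p r x" for x
  define D\<theta> where "D\<theta> x = - dcut p r x" for x
  have \<theta>: "C1c U \<theta> D\<theta>" unfolding \<theta>_def D\<theta>_def U by (rule C1c_bump[OF r])
  have \<theta>0: "0 \<le> \<theta> x" for x by (simp add: \<theta>_def cut_bounds)
  have \<theta>1: "\<theta> x = 1" if "x \<in> C" for x
    using C(2) that cut_eq_0[OF r, of p x] by (auto simp: \<theta>_def)
  have fle: "\<bar>f x\<bar> \<le> B * \<theta> x" for x
    using B(1) B(2)[of x] C(3)[of x] \<theta>0[of x] \<theta>1[of x] by (cases "x \<in> C") auto
  define T where "T = (LBINT x. norm (D\<theta> x \<bullet> b))"
  have iD: "integrable lborel (\<lambda>x. norm (D\<theta> x \<bullet> b))"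
    by (intro integrable_norm integrable_inner_left C1c_integrable_D[OF \<theta>])
  note LK = layer_integral[OF \<theta> DERIV_odd_ramp continuous_on_abs_ramp', of _ b]
  \<comment> \<open>The layers have bounded mass, uniformly in \<open>n\<close>: the odd ramp is at
    most 1 in absolute value, and the integration by parts leaves only the gradient of
    \<open>\<theta>\<close>.\<close>
  have bK: "(LBINT x. indicator U x * (\<theta> x * abs_ramp' n (g x) * (dg x \<bullet> b))) \<le> T" for n
    unfolding LK(3) T_def Bochner_Integration.integral_minus[symmetric]
  proof (rule integral_mono[OF Bochner_Integration.integrable_minus[OF LK(2)] iD])
    fix x
    have "\<bar>ramp n (g x) - ramp n (- g x)\<bar> \<le> 1"
      using ramp_bounds[of n "g x"] ramp_bounds[of n "- g x"] by (simp add: abs_le_iff)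
    then have "\<bar>ramp n (g x) - ramp n (- g x)\<bar> * \<bar>D\<theta> x \<bullet> b\<bar> \<le> 1 * \<bar>D\<theta> x \<bullet> b\<bar>"
      by (rule mult_right_mono) simp
    then have "\<bar>(ramp n (g x) - ramp n (- g x)) * (D\<theta> x \<bullet> b)\<bar> \<le> norm (D\<theta> x \<bullet> b)"
      by (simp add: abs_mult)
    then show "- (indicator U x * ((ramp n (g x) - ramp n (- g x)) * (D\<theta> x \<bullet> b))) \<le> norm (D\<theta> x \<bullet> b)"
      by (cases "x \<in> U") (auto simp only: indicator_simps abs_le_iff, auto)
  qed
  have "\<bar>J f Df\<bar> \<le> \<delta> * (B * T)" if \<delta>: "0 < \<delta>" for \<delta>
  proof -
    \<comment> \<open>Dividing by \<open>dg x \<bullet> b\<close>, which is at least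
      \<open>c\<close>, brings the approximation of \<open>w\<close> into the form
      \<open>q x * (dg x \<bullet> b)\<close>, to which the layer identity applies.\<close>
    have ch: "continuous_on C (\<lambda>x. w x / (dg x \<bullet> b))"
    proof (intro continuous_intros)
      show "continuous_on C w" "continuous_on C dg"
        using w(1) cont_dg CU continuous_on_subset by blast+
      show "\<forall>x\<in>C. dg x \<bullet> b \<noteq> 0" using c CU by (metis less_le_not_le order_refl subsetD)
    qed
    obtain q where q: "polynomial_function q" "\<And>x. x \<in> C \<Longrightarrow> norm (w x / (dg x \<bullet> b) - q x) < \<delta>"
      using Stone_Weierstrass_polynomial_function[OF C(1) ch \<delta>] by blast
    then have "real_polynomial_function q" by (simp add: real_polynomial_function_eq)
    then obtain Dq where Dq: "\<And>x. GDERIV q x :> Dq x" "continuous_on UNIV Dq"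
      using real_polynomial_function_GDERIV by blast
    have F: "C1c U (\<lambda>x. f x * q x) (\<lambda>x. f x *\<^sub>R Dq x + q x *\<^sub>R Df x)" (is "C1c U ?F ?DF")
      by (rule C1c_mult_UNIV[OF fU Dq])
    define l where "l n x = indicator U x * (f x * q x * even_ramp' n (g x) * (dg x \<bullet> b))" for n x
    define s where "s n x = indicator W x * (f x * even_ramp' n (g x) * (V x \<bullet> dg x))" for n x
    have il: "integrable lborel (l n)" for n
      unfolding l_def by (rule layer_integral(1)[OF F DERIV_even_ramp continuous_on_even_ramp'])
    have is': "integrable lborel (s n)" for n unfolding s_def by (rule layer_limit(1)[OF fU])
    have ls: "(\<lambda>n. LBINT x. s n x) \<longlonglongrightarrow> - J f Df" unfolding s_def by (rule layer_limit(2)[OF fU])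
    have ll: "(\<lambda>n. LBINT x. l n x) \<longlonglongrightarrow> 0"
    proof -
      interpret m: C1_on U "\<lambda>x. - g x" "\<lambda>x. - dg x" by (rule C1_on_uminus)
      have i1: "integrable lborel (\<lambda>x. indicator U x * (?F x * ramp' n (g x) * (dg x \<bullet> b)))" for n
        by (rule layer_integral(1)[OF F DERIV_ramp continuous_on_ramp'])
      have i2: "integrable lborel (\<lambda>x. indicator U x * (?F x * ramp' n (- g x) * (dg x \<bullet> b)))" for n
        using m.layer_integral(1)[OF F DERIV_ramp continuous_on_ramp', of n b] by simp
      have "(LBINT x. l n x) = (LBINT x. indicator U x * (?F x * ramp' n (g x) * (dg x \<bullet> b)))
          - (LBINT x. indicator U x * (?F x * ramp' n (- g x) * (dg x \<bullet> b)))" for n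
        unfolding Bochner_Integration.integral_diff[OF i1 i2, symmetric]
        by (rule Bochner_Integration.integral_cong) (auto simp: l_def even_ramp'_def algebra_simps)
      then show ?thesis
        using tendsto_diff[OF trace_limit[OF F, of b] trace_limit_uminus[OF F level_null, of b]] by simp
    qed
    have est: "\<bar>(LBINT x. s n x) - (LBINT x. l n x)\<bar> \<le> \<delta> * (B * T)" for n
    proof -
      have "(LBINT x. s n x) - (LBINT x. l n x) = (LBINT x. s n x - l n x)"
        using is' il by simp
      also have "\<bar>\<dots>\<bar> \<le> (LBINT x. \<bar>s n x - l n x\<bar>)" by (rule integral_abs_bound)
      also have "\<dots> \<le> (LBINT x. (\<delta> * B) * (indicator U x * (\<theta> x * abs_ramp' n (g x) * (dg x \<bullet> b))))"
      proof (rule integral_mono_AE)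
        show "integrable lborel (\<lambda>x. \<bar>s n x - l n x\<bar>)" using is' il by auto
        show "integrable lborel (\<lambda>x. (\<delta> * B) * (indicator U x * (\<theta> x * abs_ramp' n (g x) * (dg x \<bullet> b))))"
          using LK(1) by (rule integrable_mult_right)
        show "AE x in lborel. \<bar>s n x - l n x\<bar> \<le> (\<delta> * B) * (indicator U x * (\<theta> x * abs_ramp' n (g x) * (dg x \<bullet> b)))"
          using AE_U
        proof eventually_elim
          case (elim x)
          show ?case
          proof (cases "x \<in> C")
            case True
            then have x: "x \<in> U" "x \<in> W" using elim CU by auto
            then have wx: "w x = V x \<bullet> dg x" using w(2) MW by blast
            have d: "0 < dg x \<bullet> b" using c x(1) by force
            have "\<bar>w x - q x * (dg x \<bullet> b)\<bar> = \<bar>w x / (dg x \<bullet> b) - q x\<bar> * (dg x \<bullet> b)"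
              using d by (simp add: abs_mult_pos field_simps)
            also have "\<dots> \<le> \<delta> * (dg x \<bullet> b)"
              using q(2)[OF True] d by (intro mult_right_mono) auto
            finally have e: "\<bar>w x - q x * (dg x \<bullet> b)\<bar> \<le> \<delta> * (dg x \<bullet> b)" .
            have "\<bar>s n x - l n x\<bar> = (\<bar>f x\<bar> * \<bar>even_ramp' n (g x)\<bar>) * \<bar>w x - q x * (dg x \<bullet> b)\<bar>"
              using x by (simp add: s_def l_def wx abs_mult[symmetric] algebra_simps)
            also have "\<dots> \<le> ((B * \<theta> x) * abs_ramp' n (g x)) * (\<delta> * (dg x \<bullet> b))"
              using e fle even_ramp'_le_abs_ramp' B(1) \<theta>0 abs_ramp'_nonneg by (intro mult_mono mult_nonneg_nonneg) auto
            finally show ?thesis using x by (simp add: mult_ac)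
          next
            case False
            then have "f x = 0" by (rule C(3))
            moreover have "0 \<le> (\<delta> * B) * (indicator U x * (\<theta> x * abs_ramp' n (g x) * (dg x \<bullet> b)))"
            proof (cases "x \<in> U")
              case True
              then have "0 \<le> dg x \<bullet> b" using c by force
              then show ?thesis using True \<delta> B(1) \<theta>0 abs_ramp'_nonneg by simp
            qed simp
            ultimately show ?thesis by (simp add: s_def l_def)
          qed
        qed
      qed
      also have "\<dots> = (\<delta> * B) * (LBINT x. indicator U x * (\<theta> x * abs_ramp' n (g x) * (dg x \<bullet> b)))" by simp
      also have "\<dots> \<le> (\<delta> * B) * T" using bK \<delta> B(1) by (intro mult_left_mono) auto
      finally show ?thesis by (simp add: mult.assoc)
    qed
    have "\<bar>- J f Df - 0\<bar> \<le> \<delta> * (B * T)"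
      by (rule LIMSEQ_le_const2[OF tendsto_rabs[OF tendsto_diff[OF ls ll]]]) (use est in blast)
    then show ?thesis by simp
  qed
  then have lim: "\<bar>J f Df\<bar> \<le> \<delta>" if "0 < \<delta>" for \<delta>
  proof -
    have T0: "0 \<le> T" unfolding T_def by (rule Bochner_Integration.integral_nonneg) simp
    then have p: "0 < B * T + 1" using B(1) by (simp add: add_nonneg_pos)
    \<comment> \<open>The added 1 avoids a division by zero when \<open>T = 0\<close>.\<close>
    have "\<bar>J f Df\<bar> \<le> (\<delta> / (B * T + 1)) * (B * T)"
      using p that by (intro \<open>\<And>\<delta>. 0 < \<delta> \<Longrightarrow> \<bar>J f Df\<bar> \<le> \<delta> * (B * T)\<close>) simp
    also have "\<dots> \<le> (\<delta> / (B * T + 1)) * (B * T + 1)"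
      using p that by (intro mult_left_mono) auto
    finally show ?thesis using p by simp
  qed
  show ?thesis using lim[of "\<bar>J f Df\<bar> / 2"] by (cases "J f Df = 0") auto
qed

subsection \<open>Local geometry of a hypersurface\<close>

context C1_on
begin

lemma DERIV_along_line:
  assumes "x + t *\<^sub>R b \<in> U"
  shows "((\<lambda>t. g (x + t *\<^sub>R b)) has_real_derivative dg (x + t *\<^sub>R b) \<bullet> b) (at t)"
proof -
  have "(g has_derivative (\<lambda>v. v \<bullet> dg (x + t *\<^sub>R b))) (at (x + t *\<^sub>R b))"
    using G[OF assms] by (simp add: gderiv_def)
  moreover have "((\<lambda>t. x + t *\<^sub>R b) has_derivative (\<lambda>t. t *\<^sub>R b)) (at t)"
    by (auto intro!: derivative_eq_intros)
  ultimately have "((\<lambda>t. g (x + t *\<^sub>R b)) has_derivative (\<lambda>s. (s *\<^sub>R b) \<bullet> dg (x + t *\<^sub>R b))) (at t)"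
    by (rule has_derivative_compose[rotated])
  then show ?thesis
    by (simp add: has_field_derivative_def inner_commute mult.commute[of _ "dg (x + t *\<^sub>R b) \<bullet> b"] mult_commute_abs)
qed

text \<open>Convexity keeps the segment inside \<open>S\<close>, where the derivative of
  \<open>g\<close> along \<open>b\<close> is at least \<open>c\<close>; this is the mean value
  inequality.\<close>

lemma increase:
  assumes S: "convex S" "S \<subseteq> U" "\<And>x. x \<in> S \<Longrightarrow> c \<le> dg x \<bullet> b"
    and x: "x \<in> S" "x + s *\<^sub>R b \<in> S" "0 \<le> s"
  shows "g x + c * s \<le> g (x + s *\<^sub>R b)"
proof -
  have line: "x + t *\<^sub>R b \<in> S" if "0 \<le> t" "t \<le> s" for t
  proof (cases "s = 0")
    case False
    then have "0 < s" using x(3) by simp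
    have "(1 - t / s) *\<^sub>R x + (t / s) *\<^sub>R (x + s *\<^sub>R b) \<in> S"
      using that \<open>0 < s\<close> by (intro convexD_alt[OF S(1) x(1,2)]) (auto simp: divide_simps)
    moreover have "(1 - t / s) *\<^sub>R x + (t / s) *\<^sub>R (x + s *\<^sub>R b) = x + t *\<^sub>R b"
      using \<open>0 < s\<close> by (simp add: algebra_simps)
    ultimately show ?thesis by simp
  qed (use that x in simp)
  have "(\<lambda>t. g (x + t *\<^sub>R b) - c * t) 0 \<le> (\<lambda>t. g (x + t *\<^sub>R b) - c * t) s"
  proof (rule DERIV_nonneg_imp_nondecreasing[OF x(3)])
    fix t assume t: "0 \<le> t" "t \<le> s"
    have "((\<lambda>t. g (x + t *\<^sub>R b) - c * t) has_real_derivative dg (x + t *\<^sub>R b) \<bullet> b - c) (at t)"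
      using line[OF t] S(2) by (intro DERIV_diff DERIV_along_line DERIV_cmult_Id) auto
    then show "\<exists>y. ((\<lambda>t. g (x + t *\<^sub>R b) - c * t) has_real_derivative y) (at t) \<and> 0 \<le> y"
      using S(3)[OF line[OF t]] by (intro exI[of _ "dg (x + t *\<^sub>R b) \<bullet> b - c"]) simp
  qed
  then show ?thesis by simp
qed

lemma tendsto_g: "x \<in> U \<Longrightarrow> (g \<longlongrightarrow> g x) (nhds x)"
  using GDERIV_isCont[OF G] unfolding isCont_def by (simp only: tendsto_at_iff_tendsto_nhds)

end

text \<open>Two local equations of the same hypersurface that both increase in the direction \<open>b\<close>: moving
  along \<open>b\<close> from a point with \<open>g < 0\<close> one hits the hypersurface, where both equations vanish.\<close>

lemma local_equations_sign_le:
  assumes "C1_on U g dg" "C1_on U' g' dg'" and q: "q \<in> U" "q \<in> U'" "g q = 0"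
    and M: "M \<inter> U = {x \<in> U. g x = 0}" "M \<inter> U' = {x \<in> U'. g' x = 0}"
    and b: "0 < dg q \<bullet> b" "0 < dg' q \<bullet> b"
  shows "\<forall>\<^sub>F x in nhds q. g x < 0 \<longrightarrow> g' x < 0"
proof -
  interpret a: C1_on U g dg by fact
  interpret a': C1_on U' g' dg' by fact
  obtain r1 c where r1: "0 < r1" "0 < c" "ball q r1 \<subseteq> U \<inter> U'" "\<And>x. x \<in> ball q r1 \<Longrightarrow> c \<le> dg x \<bullet> b"
    using a.ball_dir_lower_bound[OF q(1) b(1) a'.open_U q(2)] by blast
  obtain r2 c' where r2: "0 < r2" "0 < c'" "ball q r2 \<subseteq> U' \<inter> U" "\<And>x. x \<in> ball q r2 \<Longrightarrow> c' \<le> dg' x \<bullet> b"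
    using a'.ball_dir_lower_bound[OF q(2) b(2) a.open_U q(1)] by blast
  define \<rho> where "\<rho> = min r1 r2"
  have \<rho>: "0 < \<rho>" "ball q \<rho> \<subseteq> U" "ball q \<rho> \<subseteq> U'" "\<And>x. x \<in> ball q \<rho> \<Longrightarrow> c \<le> dg x \<bullet> b"
      "\<And>x. x \<in> ball q \<rho> \<Longrightarrow> c' \<le> dg' x \<bullet> b"
    using r1 r2 by (auto simp: \<rho>_def)
  have b0: "0 < norm b" using b by auto
  \<comment> \<open>A shift by \<open>t\<close> times \<open>b\<close> with \<open>t \<le> s\<close>
    has length below \<open>\<rho> / 2\<close> and so leads from the ball of radius
    \<open>\<rho> / 2\<close> into that of radius \<open>\<rho>\<close>. Starting from
    \<open>g x > - (c * s)\<close>, the full shift lifts \<open>g\<close> to a nonnegative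
    value.\<close>
  define s where "s = \<rho> / (4 * norm b)"
  have s: "0 < s" "s * norm b < \<rho> / 2" using b0 \<rho>(1) by (auto simp: s_def)
  have "(g \<longlongrightarrow> 0) (nhds q)" using a.tendsto_g[OF q(1)] q(3) by simp
  then have "\<forall>\<^sub>F x in nhds q. - (c * s) < g x"
    using r1(2) s(1) by (intro order_tendstoD(1)) auto
  moreover have "\<forall>\<^sub>F x in nhds q. x \<in> ball q (\<rho> / 2)"
    using \<rho>(1) by (intro eventually_nhds_in_open) auto
  ultimately show ?thesis
  proof eventually_elim
    case (elim x)
    show ?case
    proof
      assume gx: "g x < 0"
      have line: "x + t *\<^sub>R b \<in> ball q \<rho>" if "0 \<le> t" "t \<le> s" for t
      proof -
        have "t * norm b \<le> s * norm b" using that b0 by (simp add: mult_right_mono)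
        then have "dist q x + norm (t *\<^sub>R b) < \<rho>" using elim(2) s(2) that by simp
        moreover have "dist q (x + t *\<^sub>R b) \<le> dist q x + norm (t *\<^sub>R b)"
          using dist_triangle[of q "x + t *\<^sub>R b" x] by (simp add: dist_norm)
        ultimately show ?thesis by simp
      qed
      have x: "x \<in> ball q \<rho>" using line[of 0] s(1) by simp
      have "g x + c * s \<le> g (x + s *\<^sub>R b)"
        using s(1) x by (intro a.increase[OF convex_ball \<rho>(2,4)] line) auto
      then have pos: "0 \<le> g (x + s *\<^sub>R b)" using elim(1) by linarith
      have "\<exists>t\<ge>0. t \<le> s \<and> g (x + t *\<^sub>R b) = 0"
      proof (rule IVT')
        show "g (x + 0 *\<^sub>R b) \<le> 0" using gx by simp
        show "0 \<le> g (x + s *\<^sub>R b)" by (rule pos)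
        show "continuous_on {0..s} (\<lambda>t. g (x + t *\<^sub>R b))"
          by (rule continuous_on_compose2[OF a.cont_g]) (use line \<rho>(2) in \<open>auto intro!: continuous_intros\<close>)
      qed (use s in auto)
      then obtain t where t: "0 \<le> t" "t \<le> s" "g (x + t *\<^sub>R b) = 0" by blast
      have "t \<noteq> 0" using t(3) gx by auto
      then have t0: "0 < t" using t(1) by simp
      have y: "x + t *\<^sub>R b \<in> ball q \<rho>" by (rule line[OF t(1,2)])
      then have "x + t *\<^sub>R b \<in> M" using t(3) M(1) \<rho>(2) by blast
      then have "g' (x + t *\<^sub>R b) = 0" using y M(2) \<rho>(3) by blast
      moreover have "g' x + c' * t \<le> g' (x + t *\<^sub>R b)"
        by (intro a'.increase[OF convex_ball \<rho>(3,5)] x y t(1))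
      moreover have "0 < c' * t" using r2(2) t0 by simp
      ultimately show "g' x < 0" by linarith
    qed
  qed
qed

lemma
  assumes "local_equation M U g"
  shows local_equation_grad_nonzero: "x \<in> U \<Longrightarrow> grad g x \<noteq> 0"
    and local_equation_open: "open U"
    and local_equation_eq: "M \<inter> U = {x \<in> U. g x = 0}"
  using assms unfolding local_equation_def by blast+

lemma norm_unit_normal: "local_equation M U g \<Longrightarrow> x \<in> U \<Longrightarrow> norm (unit_normal g x) = 1"
  using local_equation_grad_nonzero[of M U g x] by (simp add: unit_normal_def)

lemma grad_unit_normal: "grad g p = norm (grad g p) *\<^sub>R unit_normal g p"
  by (cases "grad g p = 0") (auto simp: unit_normal_def)

lemma unit_normal_inner_pos_iff:
  assumes "local_equation M U g" "p \<in> U"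
  shows "0 < unit_normal g p \<bullet> v \<longleftrightarrow> 0 < grad g p \<bullet> v"
    and "unit_normal g p \<bullet> v < 0 \<longleftrightarrow> grad g p \<bullet> v < 0"
  using local_equation_grad_nonzero[OF assms]
  by (auto simp: unit_normal_def zero_less_mult_iff mult_less_0_iff)

text \<open>Unless the two unit normals are opposite, their sum has positive inner product with each
  of them. Both equations then increase along this sum, and the one-sided comparison applies in both
  directions.\<close>

lemma local_equation_signs:
  assumes g: "local_equation M U g" "p \<in> U" and h: "local_equation M U' h" "p \<in> U'" and p: "p \<in> M"
    and n: "unit_normal h p \<noteq> - unit_normal g p"
  shows "\<forall>\<^sub>F x in nhds p. g x < 0 \<longleftrightarrow> h x < 0"
proof -
  let ?n = "unit_normal g p" and ?m = "unit_normal h p"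
  have u: "norm ?n = 1" "norm ?m = 1" using norm_unit_normal g h by blast+
  have "0 < (?n + ?m) \<bullet> (?n + ?m)" using n by (simp add: add_eq_0_iff)
  moreover have "?n \<bullet> ?n = 1" "?m \<bullet> ?m = 1" using u by (simp_all add: dot_square_norm)
  ultimately have "0 < ?n \<bullet> (?n + ?m)" "0 < ?m \<bullet> (?n + ?m)"
    by (simp_all add: inner_add_left inner_add_right inner_commute)
  then have b: "0 < grad g p \<bullet> (?n + ?m)" "0 < grad h p \<bullet> (?n + ?m)"
    using unit_normal_inner_pos_iff(1) g h by blast+
  have z: "g p = 0" "h p = 0"
    using local_equation_eq[OF g(1)] local_equation_eq[OF h(1)] g(2) h(2) p by auto
  note c = local_equation_C1_on[OF g(1)] local_equation_C1_on[OF h(1)]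
  note e = local_equation_eq[OF g(1)] local_equation_eq[OF h(1)]
  show ?thesis
    using local_equations_sign_le[OF c(1,2) g(2) h(2) z(1) e b]
      local_equations_sign_le[OF c(2,1) h(2) g(2) z(2) e(2,1) b(2,1)]
    by eventually_elim auto
qed

text \<open>If the normals were neither equal nor opposite, a small move along their difference
  \<open>v\<close> would make \<open>g\<close> negative and \<open>h\<close> positive, although the
  signs of \<open>g\<close> and \<open>h\<close> agree near \<open>p\<close>.\<close>

lemma unit_normal_unique:
  assumes g: "local_equation M U g" "p \<in> U" and h: "local_equation M U' h" "p \<in> U'" and p: "p \<in> M"
  shows "unit_normal h p = unit_normal g p \<or> unit_normal h p = - unit_normal g p"
proof (rule ccontr)
  let ?n = "unit_normal g p" and ?m = "unit_normal h p"
  assume n: "\<not> (?m = ?n \<or> ?m = - ?n)"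
  interpret a: C1_on U g "grad g" by (rule local_equation_C1_on[OF g(1)])
  interpret b: C1_on U' h "grad h" by (rule local_equation_C1_on[OF h(1)])
  have z: "g p = 0" "h p = 0"
    using local_equation_eq[OF g(1)] local_equation_eq[OF h(1)] g(2) h(2) p by auto
  define v where "v = ?m - ?n"
  have u: "norm ?n = 1" "norm ?m = 1" using norm_unit_normal g h by blast+
  have "0 < v \<bullet> v" using n by (simp add: v_def)
  moreover have "?n \<bullet> ?n = 1" "?m \<bullet> ?m = 1" using u by (simp_all add: dot_square_norm)
  ultimately have "?n \<bullet> v < 0" "0 < ?m \<bullet> v"
    by (simp_all add: v_def inner_diff_left inner_diff_right inner_commute)
  then have d: "grad g p \<bullet> v < 0" "0 < grad h p \<bullet> v"
    using unit_normal_inner_pos_iff g h by blast+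
  have "((\<lambda>t. g (p + t *\<^sub>R v)) has_real_derivative grad g p \<bullet> v) (at 0)"
    using a.DERIV_along_line[of p 0 v] g(2) by simp
  from DERIV_neg_dec_right[OF this d(1)] obtain d1 where
    d1: "0 < d1" "\<And>t. 0 < t \<Longrightarrow> t < d1 \<Longrightarrow> g (p + t *\<^sub>R v) < 0" using z by auto
  have "((\<lambda>t. h (p + t *\<^sub>R v)) has_real_derivative grad h p \<bullet> v) (at 0)"
    using b.DERIV_along_line[of p 0 v] h(2) by simp
  from DERIV_pos_inc_right[OF this d(2)] obtain d2 where
    d2: "0 < d2" "\<And>t. 0 < t \<Longrightarrow> t < d2 \<Longrightarrow> 0 < h (p + t *\<^sub>R v)" using z by auto
  have "\<forall>\<^sub>F x in nhds p. g x < 0 \<longleftrightarrow> h x < 0"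
    using local_equation_signs[OF g h p] n by blast
  moreover have "filterlim (\<lambda>t. p + t *\<^sub>R v) (nhds p) (at_right 0)"
  proof -
    have "((\<lambda>t. p + t *\<^sub>R v) \<longlongrightarrow> p + 0 *\<^sub>R v) (at_right 0)" by (intro tendsto_intros)
    then show ?thesis by simp
  qed
  ultimately have "\<forall>\<^sub>F t in at_right 0. g (p + t *\<^sub>R v) < 0 \<longleftrightarrow> h (p + t *\<^sub>R v) < 0"
    by (rule eventually_compose_filterlim)
  moreover have "\<forall>\<^sub>F t in at_right (0::real). 0 < t \<and> t < min d1 d2"
    using d1(1) d2(1) by (intro eventually_at_rightI[of 0 "min d1 d2"]) auto
  ultimately have "\<forall>\<^sub>F t in at_right (0::real). False"
    by eventually_elim (use d1(2) d2(2) in force)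
  then show False by simp
qed

text \<open>Every function with \<open>f p > 0\<close> has positive trace: compare it with a bump that is constant
  along \<open>b\<close> near the hypersurface, so that its \<open>b\<close>-derivative only lives away from it.\<close>

lemma (in C1_on) trace_pos:
  assumes U: "U = ball p R" "0 < R" and gp: "g p = 0" and b: "norm b = 1"
    and c: "0 < c" "\<And>x. x \<in> U \<Longrightarrow> c \<le> dg x \<bullet> b"
    and f: "C1c U f Df" "\<And>x. 0 \<le> f x" "0 < f p"
  shows "0 < trace b Df"
proof -
  have bb: "b \<bullet> b = 1" using b by (simp add: dot_square_norm)
  define m where "m = f p / 2"
  have m: "0 < m" using f(3) by (simp add: m_def)
  have "isCont f p" using C1c_GDERIV[OF f(1)] GDERIV_isCont by blast
  then have "(f \<longlongrightarrow> f p) (nhds p)" unfolding isCont_def by (simp only: tendsto_at_iff_tendsto_nhds)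
  then have "\<forall>\<^sub>F x in nhds p. m < f x" using f(3) by (intro order_tendstoD(1)) (auto simp: m_def)
  then obtain \<rho>1 where \<rho>1: "0 < \<rho>1" "\<And>x. dist x p < \<rho>1 \<Longrightarrow> m < f x" by (auto simp: eventually_nhds_metric)
  define \<rho> where "\<rho> = min \<rho>1 R"
  have \<rho>: "0 < \<rho>" "\<rho> \<le> R" "\<And>x. x \<in> ball p \<rho> \<Longrightarrow> m < f x"
    using \<rho>1 U(2) by (auto simp: \<rho>_def dist_commute)
  \<comment> \<open>The bump will live in a cylinder about the line through \<open>p\<close> in
    direction \<open>b\<close>, of half-height \<open>2 * \<tau>\<close> and radius
    \<open>2 * r\<close>. These add up to at most \<open>\<rho> / 2\<close>, which keeps it where
    \<open>f\<close> exceeds \<open>m\<close>.\<close>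
  define \<tau> where "\<tau> = \<rho> / 8"
  have \<tau>: "0 < \<tau>" using \<rho> by (simp add: \<tau>_def)
  have pU: "p \<in> U" using U by simp
  have "(g \<longlongrightarrow> 0) (nhds p)" using tendsto_g[OF pU] gp by simp
  then have "((\<lambda>x. \<bar>g x\<bar>) \<longlongrightarrow> 0) (nhds p)" by (rule tendsto_rabs_zero)
  then have "\<forall>\<^sub>F x in nhds p. \<bar>g x\<bar> < c * \<tau>" using c(1) \<tau> by (intro order_tendstoD(2)) auto
  then obtain r1 where r1: "0 < r1" "\<And>x. dist x p < r1 \<Longrightarrow> \<bar>g x\<bar> < c * \<tau>" by (auto simp: eventually_nhds_metric)
  define r where "r = min (r1 / 2) (\<rho> / 8)"
  have r: "0 < r" "2 * r \<le> r1" "r \<le> \<rho> / 8" using r1 \<rho> by (auto simp: r_def)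
  \<comment> \<open>Cylindrical coordinates: \<open>t\<close> along \<open>b\<close>, and
    \<open>y\<close> the squared distance from the axis. The factor \<open>\<alpha>\<close> below
    depends on \<open>y\<close> alone, so its derivative along \<open>b\<close> vanishes and only
    that of \<open>S\<close> enters the trace.\<close>
  define t where "t x = (x - p) \<bullet> b" for x
  define y where "y x = (x - p) \<bullet> (x - p) - (t x)\<^sup>2" for x
  have Dt: "GDERIV t x :> b" for x
    unfolding t_def[abs_def] gderiv_def by (auto intro!: derivative_eq_intros)
  have ct: "continuous_on S t" for S using GDERIV_continuous_on[OF Dt] by blast
  have Dt2: "GDERIV (\<lambda>x. (t x)\<^sup>2 / \<tau>\<^sup>2) x :> (2 * t x / \<tau>\<^sup>2) *\<^sub>R b" for x
  proof (rule GDERIV_DERIV_compose[OF Dt, where g = "\<lambda>s. s\<^sup>2 / \<tau>\<^sup>2"], rule DERIV_cdivide)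
    show "((\<lambda>s. s\<^sup>2) has_real_derivative 2 * t x) (at (t x))"
      by (auto intro!: derivative_eq_intros)
  qed
  have Dy: "GDERIV (\<lambda>x. y x / r\<^sup>2) x :> (2 / r\<^sup>2) *\<^sub>R ((x - p) - t x *\<^sub>R b)" for x
    unfolding y_def[abs_def] t_def[abs_def] gderiv_def divide_inverse
    by (auto intro!: derivative_eq_intros simp: inner_commute algebra_simps)
  have cy: "continuous_on S y" for S unfolding y_def[abs_def] by (intro continuous_intros ct)
  have ynorm: "y x = (norm (x - p - t x *\<^sub>R b))\<^sup>2" for x
    unfolding power2_norm_eq_inner y_def
    by (simp add: inner_diff_left inner_diff_right bb t_def power2_eq_square inner_commute algebra_simps)
  define S where "S x = 1 - step ((t x)\<^sup>2 / \<tau>\<^sup>2)" for x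
  define \<alpha> where "\<alpha> x = 1 - step (y x / r\<^sup>2)" for x
  define DS where "DS x = - (step' ((t x)\<^sup>2 / \<tau>\<^sup>2) *\<^sub>R ((2 * t x / \<tau>\<^sup>2) *\<^sub>R b))" for x
  define D\<alpha> where "D\<alpha> x = - (step' (y x / r\<^sup>2) *\<^sub>R ((2 / r\<^sup>2) *\<^sub>R ((x - p) - t x *\<^sub>R b)))" for x
  have GS: "GDERIV S x :> DS x" for x
    unfolding S_def[abs_def] DS_def
    using GDERIV_diff[OF GDERIV_const[of 1 x] GDERIV_DERIV_compose[OF Dt2[of x] DERIV_step]] by simp
  have G\<alpha>: "GDERIV \<alpha> x :> D\<alpha> x" for x
    unfolding \<alpha>_def[abs_def] D\<alpha>_def
    using GDERIV_diff[OF GDERIV_const[of 1 x] GDERIV_DERIV_compose[OF Dy[of x] DERIV_step]] by simp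
  have cDS: "continuous_on UNIV DS" unfolding DS_def[abs_def]
    using \<tau> by (intro continuous_intros continuous_on_compose2[OF continuous_on_step'[of UNIV]] ct) auto
  have cD\<alpha>: "continuous_on UNIV D\<alpha>" unfolding D\<alpha>_def[abs_def]
    using r by (intro continuous_intros continuous_on_compose2[OF continuous_on_step'[of UNIV]] ct cy) auto
  have c\<alpha>: "continuous_on UNIV \<alpha>" using G\<alpha> GDERIV_continuous_on by blast
  have cS: "continuous_on UNIV S" using GS GDERIV_continuous_on by blast
  have b01: "0 \<le> S x" "S x \<le> 1" "0 \<le> \<alpha> x" "\<alpha> x \<le> 1" for x by (auto simp: S_def \<alpha>_def step_bounds)
  have four: "(2 * s)\<^sup>2 = 4 * s\<^sup>2" for s :: real by simp
  have S0: "\<bar>t x\<bar> < 2 * \<tau>" if "S x \<noteq> 0" for x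
  proof (rule ccontr)
    assume "\<not> \<bar>t x\<bar> < 2 * \<tau>"
    then have "(2 * \<tau>)\<^sup>2 \<le> \<bar>t x\<bar>\<^sup>2" using \<tau> by (intro power_mono) auto
    then have "2 * \<tau>\<^sup>2 \<le> (t x)\<^sup>2"
      using zero_le_power2[of \<tau>] four[of \<tau>] power2_abs[of "t x"] by linarith
    then have "2 \<le> (t x)\<^sup>2 / \<tau>\<^sup>2" using \<tau> by (simp add: field_simps)
    then show False using that step_eq_1 by (simp add: S_def)
  qed
  have \<alpha>0: "norm (x - p - t x *\<^sub>R b) < 2 * r" if "\<alpha> x \<noteq> 0" for x
  proof (rule ccontr)
    assume "\<not> norm (x - p - t x *\<^sub>R b) < 2 * r"
    then have "(2 * r)\<^sup>2 \<le> y x" unfolding ynorm using r by (intro power_mono) auto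
    then have "2 * r\<^sup>2 \<le> y x"
      using zero_le_power2[of r] four[of r] by linarith
    then have "2 \<le> y x / r\<^sup>2" using r(1) by (simp add: field_simps)
    then show False using that step_eq_1 by (simp add: \<alpha>_def)
  qed
  define \<psi> where "\<psi> x = \<alpha> x * S x" for x
  define D\<psi> where "D\<psi> x = \<alpha> x *\<^sub>R DS x + S x *\<^sub>R D\<alpha> x" for x
  have supp: "norm (x - p) < \<rho> / 2 + \<rho> / 4" if "\<bar>t x\<bar> < 2 * \<tau>" "\<alpha> x \<noteq> 0" for x
  proof -
    have "norm (x - p) \<le> norm (x - p - t x *\<^sub>R b) + norm (t x *\<^sub>R b)"
      using norm_triangle_ineq[of "x - p - t x *\<^sub>R b" "t x *\<^sub>R b"] by simp
    also have "\<dots> < 2 * r + 2 * \<tau>" using \<alpha>0[OF that(2)] that(1) b by simp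
    finally show ?thesis using r(3) \<rho>(1) unfolding \<tau>_def by linarith
  qed
  have \<psi>C: "C1c U \<psi> D\<psi>"
    unfolding C1c_def
  proof (intro conjI allI exI impI)
    show "GDERIV \<psi> x :> D\<psi> x" for x
      unfolding \<psi>_def[abs_def] D\<psi>_def by (rule GDERIV_mult[OF G\<alpha> GS])
    show "continuous_on UNIV D\<psi>" unfolding D\<psi>_def[abs_def]
      by (intro continuous_intros c\<alpha> cS cDS cD\<alpha>)
    show "cball p (3/4 * \<rho>) \<subseteq> U" using \<rho>(1,2) by (auto simp: U(1))
    show "\<psi> x = 0" if "x \<notin> cball p (3/4 * \<rho>)" for x
    proof (rule ccontr)
      assume "\<psi> x \<noteq> 0"
      then have "norm (x - p) < \<rho> / 2 + \<rho> / 4" using S0 supp by (simp add: \<psi>_def)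
      then show False using that by (simp add: dist_norm norm_minus_commute)
    qed
  qed auto
  have le: "\<psi> x \<le> (1 / m) * f x" for x
  proof (cases "\<psi> x = 0")
    case True
    then show ?thesis using m f(2)[of x] by simp
  next
    case False
    then have "norm (x - p) < \<rho>" using S0 supp[of x] \<rho>(1) by (simp add: \<psi>_def)
    then have "m < f x" using \<rho>(3) by (simp add: dist_norm norm_minus_commute)
    moreover have "\<psi> x \<le> 1" unfolding \<psi>_def using b01 by (simp add: mult_le_one)
    ultimately have "m * \<psi> x \<le> f x" using m mult_left_le[of "\<psi> x" m] by linarith
    then show ?thesis using m by (simp add: field_simps)
  qed
  \<comment> \<open>The integrand of the trace in closed form; the maximum with 0 stands for the
    restriction to \<open>g > 0\<close>.\<close>
  define k where "k x = \<alpha> x * step' ((t x)\<^sup>2 / \<tau>\<^sup>2) * (2 * max (t x) 0 / \<tau>\<^sup>2)" for x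
  have Db: "D\<psi> x \<bullet> b = - (\<alpha> x * step' ((t x)\<^sup>2 / \<tau>\<^sup>2) * (2 * t x / \<tau>\<^sup>2))" for x
  proof -
    have "D\<alpha> x \<bullet> b = 0" by (simp add: D\<alpha>_def inner_diff_left bb t_def)
    moreover have "DS x \<bullet> b = - (step' ((t x)\<^sup>2 / \<tau>\<^sup>2) * (2 * t x / \<tau>\<^sup>2))" by (simp add: DS_def bb)
    ultimately show ?thesis by (simp add: D\<psi>_def inner_add_left)
  qed
  \<comment> \<open>Where \<open>\<bar>t x\<bar> \<le> \<tau>\<close> the factor
    \<open>step'\<close> vanishes. Farther out, \<open>g\<close> changes by more than
    \<open>c * \<tau>\<close> between the foot point \<open>z\<close> and \<open>x\<close>, while
    \<open>\<bar>g z\<bar> < c * \<tau>\<close>; hence \<open>g x\<close> has the sign of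
    \<open>t x\<close>.\<close>
  have kk: "- (indicator {x \<in> U. 0 < g x} x * (D\<psi> x \<bullet> b)) = k x" for x
  proof (cases "\<alpha> x = 0 \<or> step' ((t x)\<^sup>2 / \<tau>\<^sup>2) = 0")
    case True
    then show ?thesis unfolding Db k_def by auto
  next
    case False
    then have "\<not> ((t x)\<^sup>2 / \<tau>\<^sup>2 \<le> 1 \<or> 2 \<le> (t x)\<^sup>2 / \<tau>\<^sup>2)" using step'_eq_0 by blast
    then have t: "\<tau>\<^sup>2 < \<bar>t x\<bar>\<^sup>2" "\<bar>t x\<bar>\<^sup>2 < 2 * \<tau>\<^sup>2" using \<tau> by (auto simp: field_simps)
    have t1: "\<tau> < \<bar>t x\<bar>" using t(1) by (rule power_less_imp_less_base) simp
    have "\<bar>t x\<bar>\<^sup>2 < (2 * \<tau>)\<^sup>2"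
      using t(2) zero_less_power[OF \<tau>, of 2] four[of \<tau>] by linarith
    then have t2: "\<bar>t x\<bar> < 2 * \<tau>" by (rule power_less_imp_less_base) (use \<tau> in simp)
    define z where "z = x - t x *\<^sub>R b"
    have zp: "norm (z - p) < 2 * r" using \<alpha>0[of x] False by (simp add: z_def algebra_simps)
    have xU: "x \<in> U" using supp[OF t2] False \<rho> by (simp add: U(1) dist_norm norm_minus_commute)
    have zU: "z \<in> U" using zp r(3) \<rho> by (simp add: U(1) dist_norm norm_minus_commute)
    have gz: "\<bar>g z\<bar> < c * \<tau>" using r1(2)[of z] zp r(2) by (simp add: dist_norm)
    have cU: "convex U" using U(1) by simp
    show ?thesis
    proof (cases "0 < t x")
      case True
      have "g z + c * t x \<le> g (z + t x *\<^sub>R b)"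
        using True xU zU by (intro increase[OF cU order_refl c(2)]) (auto simp: z_def)
      moreover have "c * \<tau> < c * t x" using t1 True c(1) by simp
      ultimately have "0 < g x" using gz by (simp add: z_def)
      then show ?thesis using xU True unfolding Db k_def by simp
    next
      case False
      have "g x + c * (- t x) \<le> g (x + (- t x) *\<^sub>R b)"
        using False xU zU by (intro increase[OF cU order_refl c(2)]) (auto simp: z_def)
      moreover have "c * \<tau> < c * (- t x)" using t1 False c(1) by (intro mult_strict_left_mono) auto
      ultimately have "g x < 0" using gz by (simp add: z_def)
      then show ?thesis using False unfolding k_def by simp
    qed
  qed
  have k0: "0 \<le> k x" for x using b01 step'_nonneg by (simp add: k_def)
  have ck: "continuous_on UNIV k" unfolding k_def[abs_def]
    using \<tau> by (intro continuous_intros c\<alpha> continuous_on_compose2[OF continuous_on_step'[of UNIV]] ct) auto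
  have ik: "integrable lborel k"
  proof -
    have "integrable lborel (\<lambda>x. indicator {x \<in> U. 0 < g x} x *\<^sub>R (D\<psi> x \<bullet> b))"
      by (rule integrable_mult_indicator) (use pos_set in \<open>auto intro!: integrable_inner_left C1c_integrable_D[OF \<psi>C]\<close>)
    then have "integrable lborel (\<lambda>x. - (indicator {x \<in> U. 0 < g x} x * (D\<psi> x \<bullet> b)))" by simp
    then show ?thesis unfolding kk .
  qed
  have tr: "trace b D\<psi> = (LBINT x. k x)"
    unfolding trace_def Bochner_Integration.integral_minus[symmetric] kk ..
  have "(LBINT x. k x) \<noteq> 0"
  proof
    assume "(LBINT x. k x) = 0"
    then have "AE x in lborel. k x = 0"
      using integral_nonneg_eq_0_iff_AE[OF ik] k0 by simp
    moreover have o: "open {x. k x \<noteq> 0}"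
      using open_Collect_neq[OF ck continuous_on_const] .
    ultimately have "{x. k x \<noteq> 0} \<in> null_sets lborel"
      using AE_iff_null_sets[of "{x. k x \<noteq> 0}" lborel] by simp
    then have "negligible {x. k x \<noteq> 0}"
      by (simp add: negligible_iff_null_sets null_sets_completionI)
    \<comment> \<open>On the axis at height \<open>6/5 * \<tau>\<close> the argument of
      \<open>step'\<close> is \<open>36/25\<close>, strictly between 1 and 2, and
      \<open>\<alpha>\<close> is 1.\<close>
    moreover have "k (p + (6/5 * \<tau>) *\<^sub>R b) \<noteq> 0"
    proof -
      have t: "t (p + (6/5 * \<tau>) *\<^sub>R b) = 6/5 * \<tau>" by (simp add: t_def bb)
      have "y (p + (6/5 * \<tau>) *\<^sub>R b) = 0" unfolding ynorm t by simp
      then have "\<alpha> (p + (6/5 * \<tau>) *\<^sub>R b) = 1" by (simp add: \<alpha>_def step_eq_0)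
      moreover have e: "(6/5 * \<tau>)\<^sup>2 / \<tau>\<^sup>2 = 36/25" using \<tau> by (simp add: power2_eq_square)
      moreover have "0 < step' (36/25)"
        unfolding step'_def using step_denominator_pos[of "36/25"]
        by (intro divide_pos_pos add_pos_nonneg mult_pos_pos mult_nonneg_nonneg flat_pos flat_nonneg) auto
      ultimately show ?thesis using \<tau> unfolding k_def t e by simp
    qed
    ultimately show False using o open_not_negligible by blast
  qed
  moreover have "0 \<le> (LBINT x. k x)" using k0 by simp
  ultimately have "0 < trace b D\<psi>" unfolding tr by simp
  also have "trace b D\<psi> \<le> (1 / m) * trace b Df"
    by (rule trace_mono[OF \<psi>C f(1) le]) (use c in force)
  finally show ?thesis using m by (simp add: zero_less_divide_iff)
qed

text \<open>Values at the added points are limits of values of \<open>f\<close> at nearby points of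
  \<open>S\<close>, so closeness of the latter passes to the extension. This serves to extend the
  normal component of the field across the hypersurface.\<close>

lemma continuous_extension_to_closure:
  fixes f :: "'a::metric_space \<Rightarrow> real"
  assumes B: "open B" and S: "S \<subseteq> B" "B \<subseteq> closure S" and f: "continuous_on S f"
    and lim: "\<And>q. q \<in> B - S \<Longrightarrow> \<exists>L. (f \<longlongrightarrow> L) (at q within S)"
  obtains w where "continuous_on B w" "\<And>x. x \<in> S \<Longrightarrow> w x = f x"
proof -
  have "\<exists>L. (x \<in> S \<longrightarrow> L = f x) \<and> (x \<in> B \<longrightarrow> (f \<longlongrightarrow> L) (at x within S))" for x
    using f lim by (cases "x \<in> S") (auto simp: continuous_on_def)
  then obtain w where w: "\<And>x. x \<in> S \<Longrightarrow> w x = f x" "\<And>x. x \<in> B \<Longrightarrow> (f \<longlongrightarrow> w x) (at x within S)"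
    by metis
  have near: "\<exists>d>0. \<forall>z\<in>S. dist z x < d \<longrightarrow> dist (f z) (w x) < e" if xe: "x \<in> B" "0 < e" for x e
  proof -
    obtain d where "0 < d" "\<And>z. z \<in> S \<Longrightarrow> z \<noteq> x \<Longrightarrow> dist z x < d \<Longrightarrow> dist (f z) (w x) < e"
      using w(2)[OF xe(1)] xe(2) unfolding tendsto_iff eventually_at by metis
    then show ?thesis using w(1)[of x] xe(2) by (intro exI[of _ d]) (metis dist_self)
  qed
  have "\<exists>d>0. \<forall>z\<in>B. dist z x < d \<longrightarrow> dist (w z) (w x) < e" if x: "x \<in> B" "0 < e" for x e
  proof -
    obtain d where d: "0 < d" "\<And>z. z \<in> S \<Longrightarrow> dist z x < d \<Longrightarrow> dist (f z) (w x) < e / 2"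
      using near[OF x(1), of "e/2"] x(2) by auto
    have "dist (w z) (w x) < e" if z: "z \<in> B" "dist z x < d" for z
    proof -
      obtain d' where d': "0 < d'" "\<And>y. y \<in> S \<Longrightarrow> dist y z < d' \<Longrightarrow> dist (f y) (w z) < e / 2"
        using near[OF z(1), of "e/2"] x(2) by auto
      have "z \<in> closure S" "0 < min d' (d - dist z x)" using z S(2) d'(1) by auto
      then obtain y where y: "y \<in> S" "dist y z < min d' (d - dist z x)"
        unfolding closure_approachable by blast
      have "dist y x < d" using y(2) dist_triangle[of y x z] by simp
      then have "dist (f y) (w x) < e / 2" by (rule d(2)[OF y(1)])
      moreover have "dist (f y) (w z) < e / 2" using y(2) by (intro d'(2)[OF y(1)]) simp
      ultimately show ?thesis using dist_triangle3[of "w z" "w x" "f y"] by linarith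
    qed
    then show ?thesis using d(1) by blast
  qed
  then have "continuous_on B w" unfolding continuous_on_iff by blast
  then show ?thesis using w(1) that by blast
qed

section \<open>Pieces of the domain on the two sides of the hypersurface\<close>

locale cut_domain =
  fixes \<Omega> \<Gamma> A :: "'a::euclidean_space set" and I :: "nat set" and \<Omega>s :: "nat \<Rightarrow> 'a set"
  assumes open_\<Omega>: "open \<Omega>" and bdd: "bounded \<Omega>" and A\<Gamma>: "A \<subseteq> \<Gamma>" and \<Gamma>\<Omega>: "\<Gamma> \<subseteq> \<Omega>"
    and closed_\<Gamma>: "closedin (top_of_set \<Omega>) \<Gamma>"
    and A_null: "hausdorff_measure (DIM('a) - 1) (closure A) = 0"
    and hyp: "C1_hypersurface (\<Gamma> - A)"
    and dom: "\<And>j. j \<in> I \<Longrightarrow> domain (\<Omega>s j)"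
    and disj: "disjoint_family_on \<Omega>s I"
    and un: "\<Omega> - \<Gamma> = (\<Union>j\<in>I. \<Omega>s j)"
begin

lemma compact_A: "compact (closure A)"
  using bounded_subset[OF bdd] A\<Gamma> \<Gamma>\<Omega> by (simp add: compact_closure)

lemma open_W: "open (\<Omega> - \<Gamma>)"
proof -
  obtain C where "closed C" "\<Gamma> = \<Omega> \<inter> C" using closed_\<Gamma> unfolding closedin_closed by blast
  then have "\<Omega> - \<Gamma> = \<Omega> - C" by blast
  then show ?thesis using open_\<Omega> \<open>closed C\<close> by auto
qed

lemma negligible_\<Gamma>: "negligible \<Gamma>"
proof (rule negligible_subset)
  have "negligible (closure A)"
    using hausdorff_null_negligible[OF compact_A A_null]
    by (simp add: negligible_iff_null_sets null_sets_completionI)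
  then show "negligible (closure A \<union> (\<Gamma> - A))"
    using C1_hypersurface_negligible[OF hyp] by (rule negligible_Un)
  show "\<Gamma> \<subseteq> closure A \<union> (\<Gamma> - A)" using closure_subset by blast
qed

lemma exists_off_\<Gamma>:
  assumes "open S" "x \<in> S"
  obtains y where "y \<in> S" "y \<notin> \<Gamma>"
proof -
  have "\<not> S \<subseteq> \<Gamma>" using assms open_not_negligible negligible_subset[OF negligible_\<Gamma>] by blast
  then show ?thesis using that by blast
qed

text \<open>Some small translate of the segment from \<open>x\<close> to \<open>y\<close> misses
  \<open>closure A\<close> and hence \<open>\<Gamma>\<close>. It is connected, starts in the open
  piece containing \<open>x\<close> and ends in that containing \<open>y\<close>, so these disjoint
  pieces coincide. All small translates have to stay in \<open>S\<close>, because the good one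
  cannot be prescribed.\<close>

lemma same_piece:
  assumes j: "j \<in> I" "x \<in> \<Omega>s j" and l: "l \<in> I" "y \<in> \<Omega>s l"
    and S: "S \<subseteq> \<Omega>" "S \<inter> \<Gamma> \<subseteq> closure A"
    and \<delta>: "0 < \<delta>" "\<And>v t. norm v < \<delta> \<Longrightarrow> 0 \<le> t \<Longrightarrow> t \<le> 1 \<Longrightarrow> x + v + t *\<^sub>R (y - x) \<in> S"
  shows "j = l"
proof (rule ccontr)
  assume "j \<noteq> l"
  have op: "open (\<Omega>s i)" if "i \<in> I" for i using dom[OF that] by (simp add: domain_def)
  obtain d1 where d1: "0 < d1" "ball x d1 \<subseteq> \<Omega>s j" using op[OF j(1)] j(2) open_contains_ball by blast
  obtain d2 where d2: "0 < d2" "ball y d2 \<subseteq> \<Omega>s l" using op[OF l(1)] l(2) open_contains_ball by blast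
  have "0 < min \<delta> (min d1 d2)" using \<delta>(1) d1(1) d2(1) by simp
  then obtain v where v: "norm v < min \<delta> (min d1 d2)"
      "\<And>t. 0 \<le> t \<Longrightarrow> t \<le> 1 \<Longrightarrow> x + v + t *\<^sub>R (y - x) \<notin> closure A"
    using hausdorff_null_segment[OF compact_A A_null] by blast
  define L where "L = (\<lambda>t. x + v + t *\<^sub>R (y - x)) ` {0..1::real}"
  have "connected L" unfolding L_def
    by (intro connected_continuous_image continuous_intros) simp
  moreover have "L \<subseteq> \<Omega>s j \<union> (\<Union>i\<in>I - {j}. \<Omega>s i)"
  proof
    fix z assume "z \<in> L"
    then obtain t where t: "0 \<le> t" "t \<le> 1" "z = x + v + t *\<^sub>R (y - x)" by (auto simp: L_def)
    have "z \<in> S" "z \<notin> closure A" using \<delta>(2)[of v t] v t by auto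
    then have "z \<in> \<Omega> - \<Gamma>" using S by blast
    then show "z \<in> \<Omega>s j \<union> (\<Union>i\<in>I - {j}. \<Omega>s i)" unfolding un by blast
  qed
  moreover have "\<Omega>s j \<inter> (\<Union>i\<in>I - {j}. \<Omega>s i) \<inter> L = {}"
    using disj j(1) unfolding disjoint_family_on_def by blast
  moreover have "x + v \<in> \<Omega>s j \<inter> L"
  proof -
    have "x + v \<in> ball x d1" using v(1) by (simp add: dist_norm)
    moreover have "x + v \<in> L" unfolding L_def by (rule image_eqI[of _ _ 0]) auto
    ultimately show ?thesis using d1(2) by blast
  qed
  moreover have "y + v \<in> (\<Union>i\<in>I - {j}. \<Omega>s i) \<inter> L"
  proof -
    have "y + v \<in> ball y d2" using v(1) by (simp add: dist_norm)
    moreover have "y + v \<in> L" unfolding L_def by (rule image_eqI[of _ _ 1]) auto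
    ultimately show ?thesis using d2(2) l(1) \<open>j \<noteq> l\<close> by blast
  qed
  ultimately show False
    using op j(1) connectedD[of L "\<Omega>s j" "\<Union>i\<in>I - {j}. \<Omega>s i"] by blast
qed

text \<open>Points with \<open>g < 0\<close> near \<open>p\<close> are shifted by
  \<open>- \<sigma>\<close> times \<open>b\<close>. On the way \<open>g\<close> only decreases, and
  they arrive in a small ball about \<open>z\<close> on which \<open>g\<close> is negative. All of
  them thus belong to the piece of one reference point \<open>y0\<close> of that ball; the paths may
  meet \<open>\<Gamma>\<close> only in \<open>closure A\<close>, which \<open>same_piece\<close>
  handles.\<close>

lemma side_piece:
  assumes g: "local_equation (\<Gamma> - A) U g" and p: "p \<in> (\<Gamma> - A) \<inter> U"
  obtains \<rho> j where "0 < \<rho>" "j \<in> I" "{x \<in> ball p \<rho>. g x < 0} - \<Gamma> \<subseteq> \<Omega>s j"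
proof -
  interpret C1_on U g "grad g" by (rule local_equation_C1_on[OF g])
  define b where "b = grad g p"
  have pU: "p \<in> U" "p \<in> \<Omega>" using p \<Gamma>\<Omega> by auto
  have b0: "b \<noteq> 0" using local_equation_grad_nonzero[OF g pU(1)] by (simp add: b_def)
  have gp: "g p = 0" using local_equation_eq[OF g] p by blast
  have "0 < grad g p \<bullet> b" using b0 by (simp add: b_def)
  then obtain R c where R: "0 < R" "0 < c" "ball p R \<subseteq> U \<inter> \<Omega>" "\<And>x. x \<in> ball p R \<Longrightarrow> c \<le> grad g x \<bullet> b"
    using ball_dir_lower_bound[OF pU(1) _ open_\<Omega> pU(2)] by blast
  have RU: "ball p R \<subseteq> U" using R(3) by blast
  note inc = increase[OF convex_ball RU R(4)]
  define \<sigma> where "\<sigma> = R / (4 * norm b)"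
  have \<sigma>: "0 < \<sigma>" "\<sigma> * norm b < R / 2" using R(1) b0 by (auto simp: \<sigma>_def)
  define z where "z = p - \<sigma> *\<^sub>R b"
  have zp: "dist p z < R / 2" using \<sigma> by (simp add: z_def dist_norm)
  then have zR: "z \<in> ball p R" using R(1) by simp
  have "g z + c * \<sigma> \<le> g (z + \<sigma> *\<^sub>R b)"
    using zR \<sigma>(1) R(1) by (intro inc) (auto simp: z_def)
  moreover have "0 < c * \<sigma>" using R(2) \<sigma>(1) by simp
  ultimately have gz: "g z < 0" using gp by (simp add: z_def)
  have "(g \<longlongrightarrow> g z) (nhds z)"
    using tendsto_g[of z] zR RU by blast
  then have "\<forall>\<^sub>F x in nhds z. g x < 0" using gz by (rule order_tendstoD(2))
  then obtain d where d: "0 < d" "\<And>x. dist x z < d \<Longrightarrow> g x < 0" by (auto simp: eventually_nhds_metric)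
  \<comment> \<open>One radius serves both the ball about \<open>p\<close> and its shift about
    \<open>z\<close>: \<open>d\<close> keeps \<open>g\<close> negative on the latter, and
    \<open>R / 2\<close> keeps it inside \<open>ball p R\<close>.\<close>
  define \<rho> where "\<rho> = min d (R / 2)"
  have \<rho>: "0 < \<rho>" "\<rho> \<le> d" "\<rho> \<le> R / 2" using d(1) R(1) by (auto simp: \<rho>_def)
  define S where "S = {x \<in> ball p R. g x < 0}"
  have S: "S \<subseteq> \<Omega>" using R(3) by (auto simp: S_def)
  have S\<Gamma>: "S \<inter> \<Gamma> \<subseteq> closure A"
  proof
    fix x assume x: "x \<in> S \<inter> \<Gamma>"
    then have "x \<in> U" "g x < 0" using RU by (auto simp: S_def)
    then have "x \<notin> \<Gamma> - A" using local_equation_eq[OF g] by force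
    then show "x \<in> closure A" using x closure_subset by blast
  qed
  have B: "ball z \<rho> \<subseteq> S"
  proof
    fix x assume x: "x \<in> ball z \<rho>"
    then have "dist p x < R" using zp \<rho>(3) dist_triangle[of p x z] by simp
    then show "x \<in> S" using d(2)[of x] x \<rho>(2) by (simp add: S_def dist_commute)
  qed
  obtain y0 where y0: "y0 \<in> ball z \<rho>" "y0 \<notin> \<Gamma>" using exists_off_\<Gamma>[of "ball z \<rho>" z] \<rho>(1) by auto
  then have "y0 \<in> \<Omega> - \<Gamma>" using B S by blast
  then obtain j where j: "j \<in> I" "y0 \<in> \<Omega>s j" unfolding un by blast
  have "x \<in> \<Omega>s j" if x: "x \<in> {x \<in> ball p \<rho>. g x < 0} - \<Gamma>" for x
  proof -
    have xR: "ball p \<rho> \<subseteq> ball p R" using \<rho> R(1) by auto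
    have "x \<in> \<Omega> - \<Gamma>" using x xR R(3) by blast
    then obtain l where l: "l \<in> I" "x \<in> \<Omega>s l" unfolding un by blast
    have xU: "x \<in> U" using x xR RU by blast
    have "(g \<longlongrightarrow> g x) (nhds x)"
      by (rule tendsto_g[OF xU])
    then have "\<forall>\<^sub>F y in nhds x. g y < 0" using x by (intro order_tendstoD(2)) auto
    moreover have "\<forall>\<^sub>F y in nhds x. y \<in> ball p \<rho>" using x by (intro eventually_nhds_in_open) auto
    ultimately have "\<forall>\<^sub>F y in nhds x. g y < 0 \<and> y \<in> ball p \<rho>" by eventually_elim simp
    then obtain e where e: "0 < e" "\<And>y. dist y x < e \<Longrightarrow> g y < 0 \<and> y \<in> ball p \<rho>"
      by (auto simp: eventually_nhds_metric)
    \<comment> \<open>The shifted point may lie on \<open>\<Gamma>\<close> and then belongs to no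
      piece. A nearby \<open>y\<close> off \<open>\<Gamma>\<close> replaces it, with deviation
      \<open>w\<close>.\<close>
    obtain y where y: "y \<in> ball (x - \<sigma> *\<^sub>R b) (e / 2)" "y \<notin> \<Gamma>"
      using exists_off_\<Gamma>[of "ball (x - \<sigma> *\<^sub>R b) (e / 2)" "x - \<sigma> *\<^sub>R b"] e(1) by auto
    define w where "w = y - (x - \<sigma> *\<^sub>R b)"
    have w: "norm w < e / 2" using y(1) by (simp add: w_def dist_norm norm_minus_commute)
    have line: "x + v + t *\<^sub>R (y - x) \<in> S" if v: "norm v < e / 2" and t: "0 \<le> t" "t \<le> 1" for v t
    proof -
      define x' where "x' = x + v + t *\<^sub>R w"
      have "norm (t *\<^sub>R w) \<le> norm w" using t by (simp add: mult_left_le_one_le)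
      then have "norm (v + t *\<^sub>R w) < e"
        using v w norm_triangle_ineq[of v "t *\<^sub>R w"] by linarith
      then have "dist x' x < e" by (simp add: x'_def dist_norm add.assoc)
      then have x': "g x' < 0" "x' \<in> ball p \<rho>" using e(2) by blast+
      define y' where "y' = x' - (t * \<sigma>) *\<^sub>R b"
      have eq: "x + v + t *\<^sub>R (y - x) = y'"
        by (simp add: y'_def x'_def w_def algebra_simps)
      have "norm ((t * \<sigma>) *\<^sub>R b) \<le> \<sigma> * norm b"
        using t \<sigma>(1) by (simp add: abs_mult mult_left_le_one_le mult_right_mono mult.assoc)
      then have "dist x' y' < R / 2" using \<sigma>(2) by (simp add: y'_def dist_norm)
      moreover have "dist p x' < R / 2" using x'(2) \<rho>(3) by simp
      ultimately have y'R: "y' \<in> ball p R" using dist_triangle[of p y' x'] by simp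
      have "g y' + c * (t * \<sigma>) \<le> g (y' + (t * \<sigma>) *\<^sub>R b)"
        using y'R x'(2) xR t \<sigma>(1) by (intro inc) (auto simp: y'_def)
      moreover have "0 \<le> c * (t * \<sigma>)" using R(2) t \<sigma>(1) by simp
      ultimately have "g y' < 0" using x'(1) by (simp add: y'_def)
      then show ?thesis unfolding eq S_def using y'R by simp
    qed
    have "y \<in> S" using line[of 0 1] e(1) by simp
    then have "y \<in> \<Omega> - \<Gamma>" using y(2) S by blast
    then obtain i where i: "i \<in> I" "y \<in> \<Omega>s i" unfolding un by blast
    have "l = i"
      by (rule same_piece[OF l i S S\<Gamma>, of "e / 2"]) (use e(1) line in auto)
    have yB: "y \<in> ball z \<rho>"
    proof -
      have "norm w < e" using w e(1) by linarith
      then have "dist (x + w) x < e" by (simp add: dist_norm)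
      then have "x + w \<in> ball p \<rho>" using e(2) by blast
      moreover have "z - y = p - (x + w)" by (simp add: z_def w_def)
      ultimately show ?thesis by (simp add: dist_norm)
    qed
    obtain d' where d': "0 < d'" "ball y d' \<subseteq> ball z \<rho>" "ball y0 d' \<subseteq> ball z \<rho>"
    proof -
      obtain d1 where "0 < d1" "ball y d1 \<subseteq> ball z \<rho>" by (rule openE[OF open_ball yB]) (rule that)
      moreover obtain d2 where "0 < d2" "ball y0 d2 \<subseteq> ball z \<rho>" by (rule openE[OF open_ball y0(1)]) (rule that)
      ultimately show ?thesis by (intro that[of "min d1 d2"]) auto
    qed
    have "i = j"
    proof (rule same_piece[OF i j S S\<Gamma> d'(1)])
      fix v :: 'a and t :: real assume v: "norm v < d'" and t: "0 \<le> t" "t \<le> 1"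
      have "y + v \<in> ball z \<rho>" "y0 + v \<in> ball z \<rho>"
        using d' v by (auto simp: dist_norm subset_iff)
      then have "(1 - t) *\<^sub>R (y + v) + t *\<^sub>R (y0 + v) \<in> ball z \<rho>"
        using t by (intro convexD_alt[OF convex_ball]) auto
      moreover have "(1 - t) *\<^sub>R (y + v) + t *\<^sub>R (y0 + v) = y + v + t *\<^sub>R (y0 - y)"
        by (simp add: algebra_simps)
      ultimately show "y + v + t *\<^sub>R (y0 - y) \<in> S" using B by auto
    qed
    then show ?thesis using l \<open>l = i\<close> by simp
  qed
  then show ?thesis using that[OF \<rho>(1) j(1)] by blast
qed

end

subsection \<open>Smooth test functions and the weak gradient\<close>

text \<open>The class is closed under directional derivatives, because that of \<open>flat k\<close>
  combines \<open>flat (k + 2)\<close> and \<open>flat (k + 1)\<close>. Membership therefore yields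
  \<open>Ck_on\<close> for every order by induction.\<close>

inductive smooth_class :: "('a::euclidean_space \<Rightarrow> real) \<Rightarrow> bool" where
  const: "smooth_class (\<lambda>x. c)"
| flat: "smooth_class (\<lambda>x. flat k (x \<bullet> v + c))"
| add: "smooth_class f \<Longrightarrow> smooth_class g \<Longrightarrow> smooth_class (\<lambda>x. f x + g x)"
| mult: "smooth_class f \<Longrightarrow> smooth_class g \<Longrightarrow> smooth_class (\<lambda>x. f x * g x)"

lemma smooth_class_derivative:
  assumes "smooth_class f"
  shows "\<exists>D. (\<forall>x. (f has_derivative (\<lambda>v. D v x)) (at x)) \<and> (\<forall>v. smooth_class (D v))"
  using assms
proof induction
  case (const c)
  show ?case by (intro exI[of _ "\<lambda>v x. 0"]) (auto intro: smooth_class.const)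
next
  case (flat k w c)
  let ?D = "\<lambda>v x. (flat (k + 2) (x \<bullet> w + c) + (- real k) * flat (k + 1) (x \<bullet> w + c)) * (v \<bullet> w)"
  have "((\<lambda>x. flat k (x \<bullet> w + c)) has_derivative (\<lambda>v. ?D v x)) (at x)" for x
  proof -
    have "((\<lambda>x. x \<bullet> w + c) has_derivative (\<lambda>v. v \<bullet> w)) (at x)"
      by (auto intro!: derivative_eq_intros)
    from has_derivative_compose[OF this DERIV_flat[unfolded has_field_derivative_def]]
    show ?thesis by (rule has_derivative_eq_rhs) (simp add: fun_eq_iff)
  qed
  moreover have "smooth_class (?D v)" for v
    by (intro smooth_class.intros)
  ultimately show ?case by (intro exI[of _ ?D]) blast
next
  case (add f g)
  then obtain D E where "\<forall>x. (f has_derivative (\<lambda>v. D v x)) (at x)" "\<forall>v. smooth_class (D v)"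
    "\<forall>x. (g has_derivative (\<lambda>v. E v x)) (at x)" "\<forall>v. smooth_class (E v)" by blast
  then show ?case
    by (intro exI[of _ "\<lambda>v x. D v x + E v x"]) (auto intro: smooth_class.add has_derivative_add)
next
  case (mult f g)
  then obtain D E where D: "\<forall>x. (f has_derivative (\<lambda>v. D v x)) (at x)" "\<forall>v. smooth_class (D v)"
    "\<forall>x. (g has_derivative (\<lambda>v. E v x)) (at x)" "\<forall>v. smooth_class (E v)" by blast
  have "((\<lambda>x. f x * g x) has_derivative (\<lambda>v. f x * E v x + D v x * g x)) (at x)" for x
    using D by (intro has_derivative_mult) auto
  moreover have "smooth_class (\<lambda>x. f x * E v x + D v x * g x)" for v
    using D mult by (intro smooth_class.add smooth_class.mult) auto
  ultimately show ?case
    by (intro exI[of _ "\<lambda>v x. f x * E v x + D v x * g x"]) blast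
qed

lemma smooth_class_Ck_on: "smooth_class f \<Longrightarrow> Ck_on k S f"
proof (induction k arbitrary: f)
  case 0
  obtain D where "\<And>x. (f has_derivative (\<lambda>v. D v x)) (at x)"
    using smooth_class_derivative[OF 0] by blast
  then have "\<forall>x\<in>S. isCont f x" using has_derivative_continuous by blast
  then show ?case by (simp add: continuous_at_imp_continuous_on)
next
  case (Suc k)
  obtain D where D: "\<And>x. (f has_derivative (\<lambda>v. D v x)) (at x)" "\<And>v. smooth_class (D v)"
    using smooth_class_derivative[OF Suc.prems] by blast
  have "frechet_derivative f (at x) = (\<lambda>v. D v x)" for x
    using frechet_derivative_at[OF D(1)] by simp
  then have eq: "(\<lambda>x. frechet_derivative f (at x) b) = D b" for b by (simp add: fun_eq_iff)
  show ?case
    unfolding Ck_on.simps eq using D Suc.IH differentiableI by blast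
qed

lemma smooth_class_prod:
  "finite I \<Longrightarrow> (\<And>i. i \<in> I \<Longrightarrow> smooth_class (f i)) \<Longrightarrow> smooth_class (\<lambda>x. \<Prod>i\<in>I. f i x)"
proof (induction I rule: finite_induct)
  case (insert i I)
  then have "smooth_class (\<lambda>x. f i x * (\<Prod>i\<in>I. f i x))" by (intro smooth_class.mult) auto
  then show ?case using insert.hyps by simp
qed (simp add: smooth_class.const)

text \<open>Positive exactly on the open box. The factor \<open>Suc n\<close> leaves the support in
  place and sharpens the profile: as \<open>flat 0\<close> tends to 1 at infinity, the limit is the
  indicator of the box.\<close>

definition box_fun :: "nat \<Rightarrow> 'a::euclidean_space \<Rightarrow> 'a \<Rightarrow> 'a \<Rightarrow> real" where
  "box_fun n a b x = (\<Prod>i\<in>Basis. flat 0 (real (Suc n) * ((x - a) \<bullet> i)) * flat 0 (real (Suc n) * ((b - x) \<bullet> i)))"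

lemma smooth_class_box_fun: "smooth_class (box_fun n a b)"
proof -
  have "flat 0 (real (Suc n) * ((x - a) \<bullet> i)) = flat 0 (x \<bullet> (real (Suc n) *\<^sub>R i) + (- real (Suc n) * (a \<bullet> i)))"
    and "flat 0 (real (Suc n) * ((b - x) \<bullet> i)) = flat 0 (x \<bullet> (- real (Suc n) *\<^sub>R i) + real (Suc n) * (b \<bullet> i))" for x i :: 'a
    by (simp_all add: inner_diff_left algebra_simps)
  then show ?thesis unfolding box_fun_def[abs_def]
    by (intro smooth_class_prod) (auto simp only: finite_Basis intro!: smooth_class.intros)
qed

lemma box_fun_bounds: "0 \<le> box_fun n a b x" "box_fun n a b x \<le> 1"
  unfolding box_fun_def
  by (auto intro!: prod_nonneg prod_le_1 mult_nonneg_nonneg mult_le_one simp: flat_nonneg flat_0_le_1)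

lemma box_fun_pos: "x \<in> box a b \<Longrightarrow> 0 < box_fun n a b x"
  unfolding box_fun_def
  by (intro prod_pos mult_pos_pos flat_pos) (auto simp: mem_box inner_diff_left)

lemma box_fun_eq_0: "x \<notin> box a b \<Longrightarrow> box_fun n a b x = 0"
proof -
  assume "x \<notin> box a b"
  then obtain i where i: "i \<in> Basis" "x \<bullet> i \<le> a \<bullet> i \<or> b \<bullet> i \<le> x \<bullet> i" by (auto simp: mem_box not_less)
  then have "real (Suc n) * ((x - a) \<bullet> i) \<le> 0 \<or> real (Suc n) * ((b - x) \<bullet> i) \<le> 0"
    by (auto simp: inner_diff_left mult_le_0_iff)
  then have "flat 0 (real (Suc n) * ((x - a) \<bullet> i)) * flat 0 (real (Suc n) * ((b - x) \<bullet> i)) = 0"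
    using flat_zero by fastforce
  then show ?thesis unfolding box_fun_def using i(1) by (auto intro!: prod_zero)
qed

lemma box_fun_tendsto: "(\<lambda>n. box_fun n a b x) \<longlonglongrightarrow> indicator (box a b) x"
proof (cases "x \<in> box a b")
  case True
  have f: "(\<lambda>n. flat 0 (real (Suc n) * s)) \<longlonglongrightarrow> 1" if "0 < s" for s :: real
  proof -
    have "(\<lambda>n. exp (- (inverse (real (Suc n)) * inverse s))) \<longlonglongrightarrow> exp (- (0 * inverse s))"
      by (intro tendsto_intros LIMSEQ_inverse_real_of_nat)
    moreover have "exp (- (inverse (real (Suc n)) * inverse s)) = flat 0 (real (Suc n) * s)" for n
      using that by (simp add: flat_def)
    ultimately show ?thesis by simp
  qed
  have "(\<lambda>n. box_fun n a b x) \<longlonglongrightarrow> (\<Prod>i\<in>(Basis::'a set). 1 * 1)"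
    unfolding box_fun_def using True
    by (intro tendsto_prod tendsto_mult f) (auto simp: mem_box inner_diff_left)
  then show ?thesis using True by simp
qed (simp add: box_fun_eq_0)

lemma test_functions_C1c:
  assumes "\<phi> \<in> test_functions \<Omega>"
  shows "C1c \<Omega> \<phi> (grad \<phi>)"
proof -
  have C: "Ck_on 1 UNIV \<phi>" using assms unfolding test_functions_def by blast
  have K: "compact (closure {x. \<phi> x \<noteq> 0})" "closure {x. \<phi> x \<noteq> 0} \<subseteq> \<Omega>"
    using assms unfolding test_functions_def by blast+
  have "\<phi> x = 0" if "x \<notin> closure {x. \<phi> x \<noteq> 0}" for x
    using that closure_subset[of "{x. \<phi> x \<noteq> 0}"] by blast
  then show ?thesis
    unfolding C1c_def using Ck_on_1_GDERIV[OF C] Ck_on_1_continuous_grad[OF C] K by blast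
qed

lemma box_fun_test:
  assumes "closure (box a b) \<subseteq> W"
  shows "box_fun n a b \<in> test_functions W" and "C1c W (box_fun n a b) (grad (box_fun n a b))"
proof -
  have sub: "closure {x. box_fun n a b x \<noteq> 0} \<subseteq> closure (box a b)"
    using box_fun_eq_0 by (intro closure_mono) blast
  moreover have "compact (closure {x. box_fun n a b x \<noteq> 0})"
    using bounded_subset[OF bounded_closure[OF bounded_box] sub] by (simp add: compact_eq_bounded_closed)
  ultimately show t: "box_fun n a b \<in> test_functions W"
    unfolding test_functions_def using smooth_class_Ck_on[OF smooth_class_box_fun] assms by blast
  show "C1c W (box_fun n a b) (grad (box_fun n a b))" by (rule test_functions_C1c[OF t])
qed

lemma test_functions_mono: "\<Omega> \<subseteq> \<Omega>' \<Longrightarrow> test_functions \<Omega> \<subseteq> test_functions \<Omega>'"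
  unfolding test_functions_def by blast

lemma exists_test_bump:
  fixes p :: "'a::euclidean_space"
  assumes "open S" "p \<in> S"
  obtains \<phi> where "\<phi> \<in> test_functions S" "C1c S \<phi> (grad \<phi>)" "\<And>x. 0 \<le> \<phi> x" "0 < \<phi> p"
proof -
  obtain a b where ab: "p \<in> box a b" "cbox a b \<subseteq> S" using open_contains_cbox[OF assms] by metis
  have "closure (box a b) \<subseteq> S"
    using ab(2) closure_minimal[OF box_subset_cbox closed_cbox] by blast
  from box_fun_test[OF this] show ?thesis
    using box_fun_bounds(1) box_fun_pos[OF ab(1)] by (rule that)
qed

section \<open>Agreement of the weak and the classical gradient\<close>

text \<open>The sets over which \<open>f\<close> integrates to zero form a Dynkin system, and boxes
  are stable under intersection and generate the Borel sets. Since \<open>f\<close> vanishes off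
  \<open>box c d\<close>, any box may be replaced by its intersection with \<open>box c d\<close>,
  which is again a box.\<close>

lemma AE_zero_if_box_integrals_zero:
  fixes f :: "'a::euclidean_space \<Rightarrow> real"
  assumes f: "integrable lborel f" and off: "\<And>x. x \<notin> box c d \<Longrightarrow> f x = 0"
    and zero: "\<And>a b. box a b \<subseteq> box c d \<Longrightarrow> (LBINT x. indicator (box a b) x * f x) = 0"
  shows "AE x in lborel. f x = 0"
proof -
  let ?E = "range (\<lambda>(a, b). box a b::'a set)"
  have int: "integrable lborel (\<lambda>x. indicator S x * f x)" if "S \<in> sets borel" for S
    using integrable_mult_indicator[OF _ f, of S] that by simp
  have tot: "(LBINT x. f x) = 0"
  proof -
    have "(LBINT x. f x) = (LBINT x. indicator (box c d) x * f x)"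
      using off by (intro Bochner_Integration.integral_cong) (auto simp: indicator_def)
    then show ?thesis using zero[OF order_refl] by simp
  qed
  have all: "(LBINT x. indicator S x * f x) = 0" if "S \<in> sets borel" for S
  proof -
    have "Int_stable ?E" by (auto simp: Int_stable_def box_Int_box)
    moreover have "?E \<subseteq> Pow UNIV" by simp
    moreover have "S \<in> sigma_sets UNIV ?E" using that by (simp add: borel_eq_box)
    ultimately show ?thesis
    proof (induction rule: sigma_sets_induct_disjoint)
      case (basic B)
      then obtain a b where B: "B = box a b" by auto
      obtain a' b' where i: "box a b \<inter> box c d = box a' b'" using box_Int_box[of a b c d] by blast
      have "(LBINT x. indicator B x * f x) = (LBINT x. indicator (box a' b') x * f x)"
        unfolding B i[symmetric] using off
        by (intro Bochner_Integration.integral_cong) (auto simp: indicator_def)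
      also have "\<dots> = 0" using i by (intro zero) blast
      finally show ?case .
    next
      case empty
      show ?case by simp
    next
      case (compl B)
      have B: "B \<in> sets borel" using compl.hyps by (simp add: borel_eq_box)
      have "(LBINT x. indicator (UNIV - B) x * f x) = (LBINT x. f x - indicator B x * f x)"
        by (intro Bochner_Integration.integral_cong) (auto simp: indicator_def)
      also have "\<dots> = 0" using compl.IH tot int[OF B] f by simp
      finally show ?case .
    next
      case (union B)
      have B: "B i \<in> sets lborel" for i
      proof -
        have "B i \<in> sigma_sets UNIV ?E" using union.hyps(2) by blast
        then show ?thesis by (simp add: borel_eq_box)
      qed
      have "(LINT x:(\<Union>i. B i)|lborel. f x) = (\<Sum>i. (LINT x:(B i)|lborel. f x))"
      proof (rule lebesgue_integral_countable_add)
        show "B i \<inter> B j = {}" if "i \<noteq> j" for i j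
          using union.hyps(1) that by (auto simp: disjoint_family_on_def)
        show "set_integrable lborel (\<Union>i. B i) f"
          using int[of "\<Union>i. B i"] B by (auto simp: set_integrable_def)
      qed (rule B)
      then show ?case using union.IH by (simp add: set_lebesgue_integral_def)
    qed
  qed
  show ?thesis
  proof (rule density_unique_real[OF f])
    show "integrable lborel (\<lambda>x. 0::real)" by simp
    show "(LINT x:S|lborel. f x) = (LINT x:S|lborel. 0)" if "S \<in> sets lborel" for S
      using all[of S] that by (simp add: set_lebesgue_integral_def)
  qed
qed

lemma integral_lebesgue_lborel:
  fixes f :: "'a::euclidean_space \<Rightarrow> real"
  assumes "integrable lborel f"
  shows "integrable lebesgue f" "(\<integral>x. f x \<partial>lebesgue) = (LBINT x. f x)"
  using borel_measurable_integrable[OF assms] assms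
  by (simp_all add: integrable_completion integral_completion)

text \<open>Inside \<open>W\<close> both gradients satisfy the same integration by parts against
  \<open>box_fun\<close>. Letting \<open>n\<close> grow, each component of their difference
  integrates to zero over every small box. Null sets can be recognised locally, so one box about
  each point is enough.\<close>

lemma weak_gradient_eq_grad:
  fixes u :: "'a::euclidean_space \<Rightarrow> real"
  assumes W: "open W" "W \<subseteq> \<Omega>" and u: "Ck_on 1 W u" and Du: "weak_gradient \<Omega> u Du"
  shows "negligible {x \<in> W. Du x \<noteq> grad u x}"
proof (rule iffD2[OF locally_negligible_alt], rule ballI)
  fix p assume p: "p \<in> {x \<in> W. Du x \<noteq> grad u x}"
  have cu: "continuous_on W u" "continuous_on W (grad u)"
    using Ck_on_1_GDERIV[OF u] Ck_on_1_continuous_grad[OF u] GDERIV_continuous_on by blast+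
  obtain c d where cd: "p \<in> box c d" "cbox c d \<subseteq> W"
  proof -
    have "p \<in> W" using p by blast
    then show ?thesis using open_contains_cbox[OF W(1), of p] that by metis
  qed
  have bc: "box c d \<subseteq> cbox c d" by (rule box_subset_cbox)
  have "locally_L1 \<Omega> Du" using Du by (simp add: weak_gradient_def)
  then have L1: "Du absolutely_integrable_on cbox c d"
    using cd(2) W(2) compact_cbox unfolding locally_L1_def by blast
  have "AE x in lebesgue. x \<in> box c d \<longrightarrow> Du x \<bullet> i = grad u x \<bullet> i" if i: "i \<in> Basis" for i
  proof -
    define D where "D x = indicator (cbox c d) x * (Du x \<bullet> i)" for x
    define G where "G x = indicator (cbox c d) x * (grad u x \<bullet> i)" for x
    have iD: "integrable lebesgue D"
      unfolding D_def using integrable_inner_left[OF L1[unfolded set_integrable_def], of i] by simp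
    have iG: "integrable lborel G"
    proof -
      have "integrable lborel (\<lambda>x. indicator (cbox c d) x *\<^sub>R (grad u x \<bullet> i))"
        by (intro borel_integrable_compact compact_cbox continuous_intros continuous_on_subset[OF cu(2) cd(2)])
      then show ?thesis unfolding G_def[abs_def] by simp
    qed
    define f where "f x = indicator (box c d) x * (D x - G x)" for x
    have ibox: "integrable lebesgue f"
    proof -
      have "integrable lebesgue (\<lambda>x. D x - G x)"
        using iD integral_lebesgue_lborel(1)[OF iG] by (rule Bochner_Integration.integrable_diff)
      then have "integrable lebesgue (\<lambda>x. indicator (box c d) x *\<^sub>R (D x - G x))"
        by (intro integrable_mult_indicator) auto
      then show ?thesis unfolding f_def[abs_def] by simp
    qed
    \<comment> \<open>The weak gradient is only Lebesgue measurable. \<open>f2\<close> will be a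
      Borel function that agrees almost everywhere with the difference on \<open>box c d\<close> and
      vanishes off the box everywhere, not just almost everywhere.\<close>
    obtain f1 where f1: "f1 \<in> borel_measurable lborel" "AE x in lborel. f x = f1 x"
      using completion_ex_borel_measurable_real[OF borel_measurable_integrable[OF ibox]] by blast
    define f2 where "f2 x = indicator (box c d) x * f1 x" for x
    have f2m: "f2 \<in> borel_measurable lborel" unfolding f2_def using f1(1) by simp
    have "AE x in lborel. f x = f2 x"
      using f1(2) by eventually_elim (auto simp: f2_def f_def indicator_def)
    then have eq2: "AE x in lebesgue. f x = f2 x" by (rule AE_completion)
    have f2ml: "f2 \<in> borel_measurable lebesgue" using f2m by (rule measurable_completion)
    have "integrable lebesgue f2"
      using integrable_cong_AE_imp[OF ibox f2ml] eq2 by (simp add: eq_commute)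
    then have if2: "integrable lborel f2" using f2m by (simp add: integrable_completion)
    have "AE x in lborel. f2 x = 0"
    proof (rule AE_zero_if_box_integrals_zero[OF if2])
      show "f2 x = 0" if "x \<notin> box c d" for x using that by (simp add: f2_def)
      fix a b assume ab: "box a b \<subseteq> box c d"
      define K where "K = closure (box a b)"
      have K: "compact K" "K \<subseteq> cbox c d"
        unfolding K_def using compact_closure[of "box a b"] bounded_box
          closure_minimal[OF order_trans[OF ab bc] closed_cbox] by auto
      have KW: "K \<subseteq> W" using K(2) cd(2) by blast
      have z: "(LBINT x. box_fun n a b x * f2 x) = 0" for n
      proof -
        define \<phi> where "\<phi> = box_fun n a b"
        have t: "\<phi> \<in> test_functions \<Omega>" "C1c W \<phi> (grad \<phi>)"
          using box_fun_test[of a b W n] KW test_functions_mono[OF W(2)] unfolding \<phi>_def K_def by blast+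
        have b: "\<bar>\<phi> x\<bar> \<le> 1" for x using box_fun_bounds[of n a b x] by (simp add: \<phi>_def)
        have \<phi>0: "\<phi> x = 0" if "x \<notin> box a b" for x using box_fun_eq_0[OF that] by (simp add: \<phi>_def)
        have \<phi>m: "\<phi> \<in> borel_measurable borel"
          by (rule borel_measurable_continuous_onI[OF C1c_continuous[OF t(2)]])
        then have \<phi>ml: "\<phi> \<in> borel_measurable lebesgue" by (intro measurable_completion) simp
        obtain C where C: "compact C" "C \<subseteq> W" "\<And>x. x \<notin> C \<Longrightarrow> \<phi> x = 0" "\<And>x. x \<notin> C \<Longrightarrow> grad \<phi> x = 0"
          using C1c_support[OF t(2)] by blast
        define r where "r x = indicator W x * (u x * (grad \<phi> x \<bullet> i))" for x
        have ir: "integrable lborel r"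
        proof (rule integrable_continuous_compact_support[OF _ C(1)])
          have "continuous_on C (\<lambda>x. u x * (grad \<phi> x \<bullet> i))"
            by (intro continuous_intros continuous_on_subset[OF cu(1) C(2)] C1c_continuous_D[OF t(2)])
          then show "continuous_on C r"
            by (rule continuous_on_eq) (use C(2) in \<open>auto simp: r_def indicator_def\<close>)
        qed (simp add: r_def C(4))
        have iG\<phi>: "integrable lborel (\<lambda>x. \<phi> x * G x)"
          by (rule Bochner_Integration.integrable_bound[OF iG])
            (use \<phi>m iG b in \<open>auto intro!: AE_I2 borel_measurable_times simp: abs_mult mult_left_le_one_le\<close>)
        have iD\<phi>: "integrable lebesgue (\<lambda>x. \<phi> x * D x)"
          by (rule Bochner_Integration.integrable_bound[OF iD])
            (use \<phi>ml iD b in \<open>auto intro!: AE_I2 borel_measurable_times simp: abs_mult mult_left_le_one_le\<close>)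
        have e1: "\<phi> x * G x = indicator W x * (\<phi> x * (grad u x \<bullet> i))" for x
          using \<phi>0[of x] ab bc cd(2) by (cases "x \<in> box a b") (auto simp: G_def indicator_def)
        have "(LBINT x. \<phi> x * G x + r x) = 0"
          using C1c_integral_parts(2)[OF t(2) W(1) Ck_on_1_GDERIV[OF u] cu(2), of i]
          unfolding e1 r_def by (simp add: distrib_left)
        then have s1: "(LBINT x. \<phi> x * G x) = - (LBINT x. r x)"
          using iG\<phi> ir by simp
        have "(LINT x:\<Omega>|lebesgue. u x * (grad \<phi> x \<bullet> i)) = - (LINT x:\<Omega>|lebesgue. (Du x \<bullet> i) * \<phi> x)"
          using Du t(1) i unfolding weak_gradient_def by blast
        moreover have e2: "indicator \<Omega> x *\<^sub>R (u x * (grad \<phi> x \<bullet> i)) = r x" for x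
          using C(2) C(4)[of x] W(2) by (cases "x \<in> C") (auto simp: r_def indicator_def)
        moreover have e3: "indicator \<Omega> x *\<^sub>R ((Du x \<bullet> i) * \<phi> x) = \<phi> x * D x" for x
          using \<phi>0[of x] ab bc cd(2) W(2) by (cases "x \<in> box a b") (auto simp: D_def indicator_def)
        ultimately have s2: "(\<integral>x. r x \<partial>lebesgue) = - (\<integral>x. \<phi> x * D x \<partial>lebesgue)"
          unfolding set_lebesgue_integral_def e2 e3 by blast
        have "(LBINT x. \<phi> x * f2 x) = (\<integral>x. \<phi> x * f2 x \<partial>lebesgue)"
          using \<phi>m f2m by (subst integral_completion) auto
        also have "\<dots> = (\<integral>x. \<phi> x * D x - \<phi> x * G x \<partial>lebesgue)"
        proof (rule integral_cong_AE)
          show "(\<lambda>x. \<phi> x * f2 x) \<in> borel_measurable lebesgue" using \<phi>ml f2ml by simp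
          show "(\<lambda>x. \<phi> x * D x - \<phi> x * G x) \<in> borel_measurable lebesgue"
            using iD\<phi> integral_lebesgue_lborel(1)[OF iG\<phi>] by (intro borel_measurable_diff) auto
          show "AE x in lebesgue. \<phi> x * f2 x = \<phi> x * D x - \<phi> x * G x"
            using eq2
          proof eventually_elim
            case (elim x)
            show ?case
            proof (cases "x \<in> box a b")
              case True
              then have "f2 x = D x - G x" using elim ab by (auto simp: f_def)
              then show ?thesis by (simp add: right_diff_distrib)
            qed (simp add: \<phi>0)
          qed
        qed
        also have "\<dots> = (\<integral>x. \<phi> x * D x \<partial>lebesgue) - (\<integral>x. \<phi> x * G x \<partial>lebesgue)"
          using iD\<phi> integral_lebesgue_lborel(1)[OF iG\<phi>] by simp
        also have "\<dots> = 0"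
          using s1 s2 integral_lebesgue_lborel(2)[OF iG\<phi>] integral_lebesgue_lborel(2)[OF ir] by simp
        finally show ?thesis by (simp add: \<phi>_def)
      qed
      have "(\<lambda>n. LBINT x. box_fun n a b x * f2 x) \<longlonglongrightarrow> (LBINT x. indicator (box a b) x * f2 x)"
      proof (rule integral_dominated_convergence[where w = "\<lambda>x. norm (f2 x)"])
        have "box_fun n a b \<in> borel_measurable borel" for n
          using box_fun_test(2)[of a b UNIV n] by (intro borel_measurable_continuous_onI[OF C1c_continuous]) auto
        then show "(\<lambda>x. box_fun n a b x * f2 x) \<in> borel_measurable lborel" for n
          using f2m by simp
        show "AE x in lborel. (\<lambda>n. box_fun n a b x * f2 x) \<longlonglongrightarrow> indicator (box a b) x * f2 x"
          by (intro AE_I2 tendsto_mult tendsto_const box_fun_tendsto)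
        show "AE x in lborel. norm (box_fun n a b x * f2 x) \<le> norm (f2 x)" for n
          using box_fun_bounds[of n a b] by (intro AE_I2) (simp add: abs_mult mult_left_le_one_le)
      qed (use if2 f2m in auto)
      then show "(LBINT x. indicator (box a b) x * f2 x) = 0"
        unfolding z using LIMSEQ_unique tendsto_const by blast
    qed
    then have "AE x in lebesgue. f2 x = 0" by (rule AE_completion)
    with eq2 show ?thesis
    proof eventually_elim
      case (elim x)
      then show ?case using bc by (auto simp: f_def D_def G_def)
    qed
  qed
  then have "AE x in lebesgue. \<forall>i\<in>Basis. x \<in> box c d \<longrightarrow> Du x \<bullet> i = grad u x \<bullet> i"
    by (intro AE_finite_allI) auto
  then have "AE x in lebesgue. x \<in> box c d \<longrightarrow> Du x = grad u x"
    by eventually_elim (auto intro: euclidean_eqI)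
  then have "AE x in lebesgue. x \<notin> {x \<in> box c d. Du x \<noteq> grad u x}"
    by eventually_elim auto
  then obtain N where N: "N \<in> null_sets lebesgue" "{x \<in> box c d. Du x \<noteq> grad u x} \<subseteq> N"
    unfolding eventually_ae_filter by auto
  then have "negligible {x \<in> box c d. Du x \<noteq> grad u x}"
    using negligible_iff_null_sets negligible_subset by blast
  then have "negligible ({x \<in> W. Du x \<noteq> grad u x} \<inter> box c d)"
    by (rule negligible_subset) auto
  moreover have "openin (top_of_set {x \<in> W. Du x \<noteq> grad u x}) ({x \<in> W. Du x \<noteq> grad u x} \<inter> box c d)"
    by (intro openin_open_Int open_box)
  moreover have "p \<in> {x \<in> W. Du x \<noteq> grad u x} \<inter> box c d" using p cd(1) by blast
  ultimately show "\<exists>U. openin (top_of_set {x \<in> W. Du x \<noteq> grad u x}) U \<and> p \<in> U \<and> negligible U" by blast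
qed

subsection \<open>The jump condition\<close>

lemma Ck_on_cong:
  assumes "open S"
  shows "(\<And>x. x \<in> S \<Longrightarrow> f x = g x) \<Longrightarrow> Ck_on k S f \<Longrightarrow> Ck_on k S g"
proof (induction k arbitrary: f g)
  case 0
  then show ?case using continuous_on_eq by (metis Ck_on.simps(1))
next
  case (Suc k)
  have D: "(g has_derivative frechet_derivative f (at x)) (at x)" if x: "x \<in> S" for x
  proof -
    have "(f has_derivative frechet_derivative f (at x)) (at x)"
      using Suc.prems(2) x frechet_derivative_works by auto
    then show ?thesis
      by (rule has_derivative_transform_within_open[OF _ assms x]) (use Suc.prems(1) in auto)
  qed
  have e: "frechet_derivative f (at x) b = frechet_derivative g (at x) b" if "x \<in> S" for x b
    using frechet_derivative_at[OF D[OF that]] by simp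
  show ?case
    unfolding Ck_on.simps
  proof (intro conjI ballI)
    show "g differentiable (at x)" if "x \<in> S" for x using D[OF that] differentiableI by blast
    show "Ck_on k S (\<lambda>x. frechet_derivative g (at x) b)" if "b \<in> Basis" for b
      by (rule Suc.IH[OF e]) (use Suc.prems(2) that in auto)
  qed
qed

lemma Ck_on_uminus: "open S \<Longrightarrow> Ck_on k S f \<Longrightarrow> Ck_on k S (\<lambda>x. - f x)"
proof (induction k arbitrary: f)
  case 0
  then show ?case by (simp add: continuous_on_minus)
next
  case (Suc k)
  have D: "((\<lambda>x. - f x) has_derivative (\<lambda>v. - frechet_derivative f (at x) v)) (at x)" if x: "x \<in> S" for x
    using Suc.prems(2) x by (intro has_derivative_minus) (simp add: frechet_derivative_works)
  have e: "- frechet_derivative f (at x) b = frechet_derivative (\<lambda>x. - f x) (at x) b" if "x \<in> S" for x b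
    using frechet_derivative_at[OF D[OF that]] by metis
  show ?case
    unfolding Ck_on.simps
  proof (intro conjI ballI)
    show "(\<lambda>x. - f x) differentiable (at x)" if "x \<in> S" for x using D[OF that] differentiableI by blast
    show "Ck_on k S (\<lambda>x. frechet_derivative (\<lambda>x. - f x) (at x) b)" if "b \<in> Basis" for b
      using that Suc.prems by (intro Ck_on_cong[OF Suc.prems(1) e Suc.IH]) auto
  qed
qed

lemma local_equation_uminus:
  assumes "local_equation M U g"
  shows "local_equation M U (\<lambda>x. - g x)"
    and "x \<in> U \<Longrightarrow> unit_normal (\<lambda>x. - g x) x = - unit_normal g x"
proof -
  interpret C1_on U g "grad g" by (rule local_equation_C1_on[OF assms])
  have e: "grad (\<lambda>x. - g x) x = - grad g x" if "x \<in> U" for x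
    by (rule grad_eqI[OF GDERIV_minus[OF G[OF that]]])
  then show "x \<in> U \<Longrightarrow> unit_normal (\<lambda>x. - g x) x = - unit_normal g x"
    by (simp add: unit_normal_def)
  have "Ck_on 1 U (\<lambda>x. - g x)"
    using assms unfolding local_equation_def by (intro Ck_on_uminus) auto
  then show "local_equation M U (\<lambda>x. - g x)"
    using assms e unfolding local_equation_def by auto
qed

lemma local_equation_subset:
  assumes "local_equation M U g" "open U'" "U' \<subseteq> U"
  shows "local_equation M U' g"
proof -
  have "Ck_on 1 U g" using assms(1) unfolding local_equation_def by blast
  then have "Ck_on 1 U' g" using assms(3) by (auto intro: continuous_on_subset)
  then show ?thesis using assms unfolding local_equation_def by blast
qed

lemma unit_neq_uminus: "norm (n::'a::real_normed_vector) = 1 \<Longrightarrow> n \<noteq> - n"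
proof
  assume n: "norm n = 1" "n = - n"
  have "2 *\<^sub>R n = n + n" by (rule scaleR_2)
  also have "\<dots> = 0" using n(2) by (metis add.right_inverse)
  finally show False using n(1) by simp
qed

text \<open>At \<open>p\<close> the gradient is parallel to \<open>n\<close>, so nearby
  \<open>a \<bullet> dg x\<close> is almost \<open>(a \<bullet> n) * (dg x \<bullet> n)\<close>.
  Near \<open>p\<close> one also has \<open>norm (dg x) < 2 * G'\<close> and
  \<open>G' / 2 < dg x \<bullet> n\<close>. The two errors \<open>(\<delta> / 8) * (2 * G')\<close>
  and \<open>\<delta> * G' / 4\<close> add up to \<open>\<delta> * (G' / 2)\<close>, which the
  right-hand side exceeds.\<close>

lemma (in C1_on) normal_approx:
  assumes p: "p \<in> U" and n: "norm n = 1" "dg p = G' *\<^sub>R n" "0 < G'" and \<delta>: "0 < \<delta>"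
  shows "\<forall>\<^sub>F x in nhds p. \<forall>v. norm (v - a) < \<delta> / 8 \<longrightarrow>
    \<bar>v \<bullet> dg x - (a \<bullet> n) * (dg x \<bullet> n)\<bar> \<le> \<delta> * (dg x \<bullet> n)"
proof -
  have nn: "n \<bullet> n = 1" using n(1) by (simp add: dot_square_norm)
  have "isCont dg p" using cont_dg open_U p by (simp add: continuous_on_eq_continuous_at)
  then have t: "(dg \<longlongrightarrow> dg p) (nhds p)" unfolding isCont_def by (simp only: tendsto_at_iff_tendsto_nhds)
  have "((\<lambda>x. norm (dg x)) \<longlongrightarrow> norm (dg p)) (nhds p)" by (intro tendsto_intros t)
  then have "\<forall>\<^sub>F x in nhds p. norm (dg x) < 2 * G'" using n by (intro order_tendstoD(2)) auto
  moreover have "((\<lambda>x. dg x \<bullet> n) \<longlongrightarrow> dg p \<bullet> n) (nhds p)" by (intro tendsto_intros t)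
  then have "\<forall>\<^sub>F x in nhds p. G' / 2 < dg x \<bullet> n" using n nn by (intro order_tendstoD(1)) auto
  moreover have "((\<lambda>x. norm a * norm (dg x - (dg x \<bullet> n) *\<^sub>R n)) \<longlongrightarrow> norm a * norm (dg p - (dg p \<bullet> n) *\<^sub>R n)) (nhds p)"
    by (intro tendsto_intros t)
  then have "\<forall>\<^sub>F x in nhds p. norm a * norm (dg x - (dg x \<bullet> n) *\<^sub>R n) < \<delta> * G' / 4"
    using n nn \<delta> by (intro order_tendstoD(2)) auto
  ultimately show ?thesis
  proof eventually_elim
    case (elim x)
    show ?case
    proof (intro allI impI)
      fix v assume v: "norm (v - a) < \<delta> / 8"
      have "v \<bullet> dg x - (a \<bullet> n) * (dg x \<bullet> n) = (v - a) \<bullet> dg x + a \<bullet> (dg x - (dg x \<bullet> n) *\<^sub>R n)"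
        by (simp add: inner_diff_left inner_diff_right)
      also have "\<bar>\<dots>\<bar> \<le> norm (v - a) * norm (dg x) + norm a * norm (dg x - (dg x \<bullet> n) *\<^sub>R n)"
        by (rule order_trans[OF abs_triangle_ineq add_mono[OF Cauchy_Schwarz_ineq2 Cauchy_Schwarz_ineq2]])
      also have "norm (v - a) * norm (dg x) \<le> (\<delta> / 8) * (2 * G')"
        using v elim(1) \<delta> by (intro mult_mono) auto
      also have "(\<delta> / 8) * (2 * G') + norm a * norm (dg x - (dg x \<bullet> n) *\<^sub>R n) \<le> \<delta> * (G' / 2)"
        using elim(3) by (simp add: algebra_simps)
      also have "\<dots> \<le> \<delta> * (dg x \<bullet> n)" using elim(2) \<delta> by (intro mult_left_mono) auto
      finally show "\<bar>v \<bullet> dg x - (a \<bullet> n) * (dg x \<bullet> n)\<bar> \<le> \<delta> * (dg x \<bullet> n)" by simp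
    qed
  qed
qed

text \<open>What matters about \<open>u\<close> and \<open>F\<close> for the jump is recorded in the
  field \<open>V\<close>, its bound by 1 and its one-sided boundary values
  \<open>bv\<close>.\<close>

locale cut_flux = cut_domain \<Omega> \<Gamma> A I \<Omega>s
  for \<Omega> \<Gamma> A :: "'a::euclidean_space set" and I :: "nat set" and \<Omega>s :: "nat \<Rightarrow> 'a set" +
  fixes V :: "'a \<Rightarrow> 'a" and H :: "'a \<Rightarrow> real" and bv :: "nat \<Rightarrow> 'a \<Rightarrow> 'a \<Rightarrow> 'a"
  assumes V_C1': "\<And>j. j \<in> I \<Longrightarrow> Ck_on 1 (\<Omega>s j) V"
    and V_le': "\<And>x. x \<in> \<Omega> - \<Gamma> \<Longrightarrow> norm (V x) \<le> 1"
    and V_div': "\<And>j x. j \<in> I \<Longrightarrow> x \<in> \<Omega>s j \<Longrightarrow> divergence V x = H x"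
    and H_cont': "continuous_on (\<Omega> - \<Gamma>) H" and H_L1': "locally_L1 \<Omega> H"
    and cut: "\<And>j. j \<in> I \<Longrightarrow> continuous_on_cut \<Gamma> A (\<Omega>s j) V (bv j)"

sublocale cut_flux \<subseteq> flux \<Omega> "\<Omega> - \<Gamma>" "closure A" "\<Gamma> - A" V H
proof
  show "open (\<Omega> - \<Gamma>)" by (rule open_W)
  have "\<Omega> - (\<Omega> - \<Gamma>) \<in> sets lborel" using open_\<Omega> open_W by auto
  moreover have "negligible (\<Omega> - (\<Omega> - \<Gamma>))" by (rule negligible_subset[OF negligible_\<Gamma>]) auto
  ultimately show "\<Omega> - (\<Omega> - \<Gamma>) \<in> null_sets lborel"
    by (simp add: negligible_iff_null_sets null_sets_completion_iff)
  show "compact (closure A)" by (rule compact_A)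
  show "\<Omega> - (\<Omega> - \<Gamma>) \<subseteq> \<Gamma> - A \<union> closure A" using closure_subset by blast
  have op: "open (\<Omega>s j)" if "j \<in> I" for j using dom[OF that] by (simp add: domain_def)
  have V: "V differentiable (at x)" if "x \<in> \<Omega>s j" "j \<in> I" for x j using V_C1'[OF that(2)] that(1) by simp
  have "continuous_on (\<Union>j\<in>I. \<Omega>s j) (\<lambda>x. frechet_derivative V (at x) b)" if "b \<in> Basis" for b
    by (rule continuous_on_open_UN) (use op V_C1' that in auto)
  then show "Ck_on 1 (\<Omega> - \<Gamma>) V" unfolding un using V by auto
  show "divergence V x = H x" if "x \<in> \<Omega> - \<Gamma>" for x using that V_div' unfolding un by blast
qed (use A_null V_le' H_cont' H_L1' in auto)

context cut_flux
begin

text \<open>The normal of the second side is eliminated; orthogonality to \<open>- \<nu>\<close> and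
  to \<open>\<nu>\<close> are equivalent.\<close>

definition matched :: "'a \<Rightarrow> bool" where
  "matched p \<longleftrightarrow> (\<exists>j\<in>I. \<exists>l\<in>I. \<exists>\<nu>. outward_normal \<Gamma> A (\<Omega>s j) p \<nu> \<and> outward_normal \<Gamma> A (\<Omega>s l) p (- \<nu>) \<and>
     (bv j p \<nu> - bv l p (- \<nu>)) \<bullet> \<nu> = 0)"

text \<open>The local equation \<open>g\<close> varies with \<open>e\<close>; where several such
  equations meet, their sides are identified by \<open>local_equation_signs\<close>.\<close>

lemma boundary_value:
  assumes "j \<in> I" "outward_normal \<Gamma> A (\<Omega>s j) p \<nu>" "0 < e"
  obtains U g where "p \<in> U" "local_equation (\<Gamma> - A) U g" "unit_normal g p = \<nu>"
    "\<And>x. x \<in> U \<Longrightarrow> g x < 0 \<Longrightarrow> x \<notin> \<Gamma> \<Longrightarrow> norm (V x - bv j p \<nu>) < e"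
proof -
  obtain U g where "side_nhd \<Gamma> A (\<Omega>s j) p \<nu> U g"
      "\<forall>x\<in>{x\<in>U. g x < 0} - \<Gamma>. dist (V x) (bv j p \<nu>) < e"
    using cut[OF assms(1)] assms(2,3) unfolding continuous_on_cut_def by blast
  then show ?thesis unfolding side_nhd_def by (intro that[of U g]) (auto simp: dist_norm)
qed

lemma M_in_\<Omega>: "\<Gamma> - A \<subseteq> \<Omega>"
  using \<Gamma>\<Omega> by blast

text \<open>Near \<open>p\<close> the field is almost constant on each side, with values
  \<open>a\<close> and \<open>a'\<close>. The jump estimate, divided by the positive trace of a test
  bump at \<open>p\<close>, bounds the normal jump by \<open>2 * \<delta>\<close> for every
  \<open>\<delta>\<close>. The point \<open>p\<close> may belong to \<open>closure A\<close>,
  because the layer limit behind the estimate rests on \<open>J_off_M\<close>.\<close>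

lemma matched_if_J_zero:
  assumes zero: "\<And>\<phi>. \<phi> \<in> test_functions \<Omega> \<Longrightarrow> J \<phi> (grad \<phi>) = 0" and p: "p \<in> \<Gamma> - A"
  shows "matched p"
proof -
  obtain U g where U: "p \<in> U" and g: "local_equation (\<Gamma> - A) U g"
    using hyp p unfolding C1_hypersurface_def by blast
  define n where "n = unit_normal g p"
  note mg = local_equation_uminus[OF g]
  interpret C1_on U g "grad g" by (rule local_equation_C1_on[OF g])
  \<comment> \<open>Applied to \<open>g\<close> and to \<open>- g\<close>, this produces a piece on
    either side of the hypersurface at \<open>p\<close>.\<close>
  have side: "\<exists>j\<in>I. outward_normal \<Gamma> A (\<Omega>s j) p (unit_normal h p)" if h: "local_equation (\<Gamma> - A) U h" for h
  proof -
    have pU: "p \<in> (\<Gamma> - A) \<inter> U" using p U by blast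
    obtain \<rho> j where r: "0 < \<rho>" "j \<in> I" "{x \<in> ball p \<rho>. h x < 0} - \<Gamma> \<subseteq> \<Omega>s j"
      using side_piece[OF h pU] by blast
    have "local_equation (\<Gamma> - A) (U \<inter> ball p \<rho>) h"
      by (rule local_equation_subset[OF h]) (auto simp: open_U)
    then have "side_nhd \<Gamma> A (\<Omega>s j) p (unit_normal h p) (U \<inter> ball p \<rho>) h"
      unfolding side_nhd_def using pU r by auto
    then show ?thesis using r(2) unfolding outward_normal_def by blast
  qed
  obtain j where j: "j \<in> I" "outward_normal \<Gamma> A (\<Omega>s j) p n" using side[OF g] unfolding n_def by blast
  obtain l where l: "l \<in> I" "outward_normal \<Gamma> A (\<Omega>s l) p (- n)"
    using side[OF mg(1)] unfolding mg(2)[OF U] n_def by blast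
  define a where "a = bv j p n"
  define a' where "a' = bv l p (- n)"
  have n1: "norm n = 1" unfolding n_def by (rule norm_unit_normal[OF g U])
  have gp: "grad g p = norm (grad g p) *\<^sub>R n" unfolding n_def by (rule grad_unit_normal)
  have G0: "0 < norm (grad g p)" using local_equation_grad_nonzero[OF g U] by simp
  have gp0: "g p = 0" using local_equation_eq[OF g] p U by blast
  have "\<bar>a' \<bullet> n - a \<bullet> n\<bar> \<le> 2 * \<delta>" if \<delta>: "0 < \<delta>" for \<delta>
  proof -
    have d8: "0 < \<delta> / 8" using \<delta> by simp
    obtain U1 g1 where 1: "p \<in> U1" "local_equation (\<Gamma> - A) U1 g1" "unit_normal g1 p = n"
      "\<And>x. x \<in> U1 \<Longrightarrow> g1 x < 0 \<Longrightarrow> x \<notin> \<Gamma> \<Longrightarrow> norm (V x - a) < \<delta> / 8"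
      using boundary_value[OF j d8] unfolding a_def by blast
    obtain U2 g2 where 2: "p \<in> U2" "local_equation (\<Gamma> - A) U2 g2" "unit_normal g2 p = - n"
      "\<And>x. x \<in> U2 \<Longrightarrow> g2 x < 0 \<Longrightarrow> x \<notin> \<Gamma> \<Longrightarrow> norm (V x - a') < \<delta> / 8"
      using boundary_value[OF l d8] unfolding a'_def by blast
    have nn: "n \<noteq> - n" by (rule unit_neq_uminus[OF n1])
    \<comment> \<open>The boundary values come with their own local equations \<open>g1\<close> and
      \<open>g2\<close>; comparing unit normals at \<open>p\<close> shows that these have the signs
      of \<open>g\<close> and \<open>- g\<close> nearby.\<close>
    have s1: "\<forall>\<^sub>F x in nhds p. g x < 0 \<longleftrightarrow> g1 x < 0"
      using local_equation_signs[OF g U 1(2,1) p] 1(3) nn by (simp add: n_def)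
    have s2: "\<forall>\<^sub>F x in nhds p. - g x < 0 \<longleftrightarrow> g2 x < 0"
      using local_equation_signs[OF mg(1) U 2(2,1) p] 2(3) nn mg(2)[OF U] by (simp add: n_def)
    have e1: "\<forall>\<^sub>F x in nhds p. x \<in> U1" and e2: "\<forall>\<^sub>F x in nhds p. x \<in> U2"
      using eventually_nhds_in_open local_equation_open 1(1,2) 2(1,2) by blast+
    have ev: "\<forall>\<^sub>F x in nhds p. (x \<notin> \<Gamma> \<longrightarrow> g x < 0 \<longrightarrow> \<bar>V x \<bullet> grad g x - (a \<bullet> n) * (grad g x \<bullet> n)\<bar> \<le> \<delta> * (grad g x \<bullet> n))
      \<and> (x \<notin> \<Gamma> \<longrightarrow> 0 < g x \<longrightarrow> \<bar>V x \<bullet> grad g x - (a' \<bullet> n) * (grad g x \<bullet> n)\<bar> \<le> \<delta> * (grad g x \<bullet> n))"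
      using normal_approx[OF U n1 gp G0 \<delta>, of a] normal_approx[OF U n1 gp G0 \<delta>, of a'] s1 s2 e1 e2
    proof eventually_elim
      case (elim x)
      then show ?case using 1(4)[of x] 2(4)[of x] by auto
    qed
    then obtain O' where O': "open O'" "p \<in> O'"
      "\<And>x. x \<in> O' \<Longrightarrow> x \<notin> \<Gamma> \<Longrightarrow> g x < 0 \<Longrightarrow> \<bar>V x \<bullet> grad g x - (a \<bullet> n) * (grad g x \<bullet> n)\<bar> \<le> \<delta> * (grad g x \<bullet> n)"
      "\<And>x. x \<in> O' \<Longrightarrow> x \<notin> \<Gamma> \<Longrightarrow> 0 < g x \<Longrightarrow> \<bar>V x \<bullet> grad g x - (a' \<bullet> n) * (grad g x \<bullet> n)\<bar> \<le> \<delta> * (grad g x \<bullet> n)"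
      unfolding eventually_nhds by blast
    have "0 < grad g p \<bullet> n" using G0 n1 by (subst gp) (simp add: dot_square_norm)
    then obtain R c where R: "0 < R" "0 < c" "ball p R \<subseteq> U \<inter> (O' \<inter> \<Omega>)" "\<And>x. x \<in> ball p R \<Longrightarrow> c \<le> grad g x \<bullet> n"
      using ball_dir_lower_bound[OF U, of n "O' \<inter> \<Omega>"] O'(1,2) open_\<Omega> M_in_\<Omega> p by blast
    interpret L: flux_layer \<Omega> "\<Omega> - \<Gamma>" "closure A" "\<Gamma> - A" V H "ball p R" g "grad g"
    proof
      show "(\<Gamma> - A) \<inter> ball p R = {x \<in> ball p R. g x = 0}"
        using local_equation_eq[OF g] R(3) by blast
    qed (use R(3) G continuous_on_subset[OF cont_dg] in auto)
    have "open (ball p R)" "p \<in> ball p R" using R(1) by auto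
    then obtain \<phi> where \<phi>: "\<phi> \<in> test_functions (ball p R)" "C1c (ball p R) \<phi> (grad \<phi>)" "\<And>x. 0 \<le> \<phi> x" "0 < \<phi> p"
      using exists_test_bump by blast
    have "ball p R \<subseteq> \<Omega>" using R(3) by blast
    then have z: "J \<phi> (grad \<phi>) = 0" using zero \<phi>(1) test_functions_mono by blast
    have "\<bar>a' \<bullet> n - a \<bullet> n\<bar> * L.trace n (grad \<phi>) \<le> 2 * \<delta> * L.trace n (grad \<phi>)"
    proof (rule L.jump_estimate[OF \<phi>(2,3) z])
      show "0 \<le> grad g x \<bullet> n" if "x \<in> ball p R" for x using R(4)[OF that] R(2) by linarith
    qed (use O'(3,4) R(3) in auto)
    moreover have "0 < L.trace n (grad \<phi>)"
      by (rule L.trace_pos[OF refl R(1) gp0 n1 R(2,4) \<phi>(2,3,4)])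
    ultimately show ?thesis by simp
  qed
  then have "\<bar>a' \<bullet> n - a \<bullet> n\<bar> \<le> e" if "0 < e" for e
    using that by (metis field_sum_of_halves half_gt_zero mult_2)
  then have "\<bar>a' \<bullet> n - a \<bullet> n\<bar> \<le> 0" by (rule field_le_epsilon[of _ 0, simplified])
  then have "(a - a') \<bullet> n = 0" by (simp add: inner_diff_left)
  then show ?thesis unfolding matched_def using j l unfolding a_def a'_def by blast
qed

text \<open>The gradient of \<open>g\<close> at \<open>q\<close> is parallel to
  \<open>\<nu>\<close>, so the jump condition makes the one-sided limits
  \<open>a \<bullet> b\<close> and \<open>a' \<bullet> b\<close> equal. This concerns the normal
  component only; the tangential part of \<open>V\<close> may still jump.\<close>

lemma normal_component_limit:
  assumes q: "q \<in> \<Gamma> - A" "q \<in> U" and g: "local_equation (\<Gamma> - A) U g" and m: "matched q"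
  shows "\<exists>L. ((\<lambda>x. V x \<bullet> grad g x) \<longlongrightarrow> L) (at q within - \<Gamma>)"
proof -
  interpret C1_on U g "grad g" by (rule local_equation_C1_on[OF g])
  obtain j l \<nu> where jl: "j \<in> I" "outward_normal \<Gamma> A (\<Omega>s j) q \<nu>" "l \<in> I" "outward_normal \<Gamma> A (\<Omega>s l) q (- \<nu>)"
      and jump: "(bv j q \<nu> - bv l q (- \<nu>)) \<bullet> \<nu> = 0"
    using m unfolding matched_def by blast
  define a where "a = bv j q \<nu>"
  define a' where "a' = bv l q (- \<nu>)"
  define b where "b = grad g q"
  have aa: "a \<bullet> b = a' \<bullet> b"
  proof -
    obtain U1 g1 where 1: "q \<in> U1" "local_equation (\<Gamma> - A) U1 g1" "unit_normal g1 q = \<nu>"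
      by (rule boundary_value[OF jl(1,2) zero_less_one]) (rule that)
    have "unit_normal g q = \<nu> \<or> unit_normal g q = - \<nu>"
      using unit_normal_unique[OF 1(2,1) g q(2,1)] 1(3) by simp
    then obtain t where "b = t *\<^sub>R \<nu>" unfolding b_def
      by (metis grad_unit_normal scaleR_minus_left scaleR_minus_right)
    then show ?thesis using jump by (simp add: a_def a'_def inner_diff_left)
  qed
  have "isCont (grad g) q" using cont_dg open_U q(2) by (simp add: continuous_on_eq_continuous_at)
  then have t: "(grad g \<longlongrightarrow> b) (nhds q)"
    unfolding isCont_def b_def by (simp only: tendsto_at_iff_tendsto_nhds)
  have "\<forall>\<^sub>F x in at q within - \<Gamma>. dist (V x \<bullet> grad g x) (a \<bullet> b) < e" if e: "0 < e" for e
  proof -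
    define d where "d = e / (2 * (norm b + 1))"
    have b1: "0 < norm b + 1" by (simp add: add_nonneg_pos)
    have d: "0 < d" "d * (norm b + 1) = e / 2" using e b1 by (auto simp: d_def field_simps)
    obtain U1 g1 where 1: "q \<in> U1" "local_equation (\<Gamma> - A) U1 g1" "unit_normal g1 q = \<nu>"
      "\<And>x. x \<in> U1 \<Longrightarrow> g1 x < 0 \<Longrightarrow> x \<notin> \<Gamma> \<Longrightarrow> norm (V x - a) < d"
      using boundary_value[OF jl(1,2) d(1)] unfolding a_def by blast
    obtain U2 g2 where 2: "q \<in> U2" "local_equation (\<Gamma> - A) U2 g2" "unit_normal g2 q = - \<nu>"
      "\<And>x. x \<in> U2 \<Longrightarrow> g2 x < 0 \<Longrightarrow> x \<notin> \<Gamma> \<Longrightarrow> norm (V x - a') < d"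
      using boundary_value[OF jl(3,4) d(1)] unfolding a'_def by blast
    note m2 = local_equation_uminus[OF 2(2)]
    have "norm \<nu> = 1" using norm_unit_normal[OF 1(2,1)] 1(3) by simp
    then have nn: "\<nu> \<noteq> - \<nu>" by (rule unit_neq_uminus)
    have s: "\<forall>\<^sub>F x in nhds q. g1 x < 0 \<longleftrightarrow> - g2 x < 0"
      using local_equation_signs[OF 1(2,1) m2(1) 2(1) q(1)] 1(3) 2(3) m2(2)[OF 2(1)] nn by simp
    have e1: "\<forall>\<^sub>F x in nhds q. x \<in> U1" and e2: "\<forall>\<^sub>F x in nhds q. x \<in> U2"
      using eventually_nhds_in_open local_equation_open 1(1,2) 2(1,2) by blast+
    have "((\<lambda>x. norm (grad g x)) \<longlongrightarrow> norm b) (nhds q)" by (intro tendsto_intros t)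
    then have f1: "\<forall>\<^sub>F x in nhds q. norm (grad g x) < norm b + 1" by (intro order_tendstoD(2)) auto
    have "((\<lambda>x. (norm a + norm a') * norm (grad g x - b)) \<longlongrightarrow> (norm a + norm a') * norm (b - b)) (nhds q)"
      by (intro tendsto_intros t)
    then have f2: "\<forall>\<^sub>F x in nhds q. (norm a + norm a') * norm (grad g x - b) < e / 2"
      using e by (intro order_tendstoD(2)) auto
    have "\<forall>\<^sub>F x in nhds q. x \<notin> \<Gamma> \<longrightarrow> \<bar>V x \<bullet> grad g x - a \<bullet> b\<bar> < e"
      using s e1 e2 f1 f2
    proof eventually_elim
      case (elim x)
      show ?case
      proof
        assume x: "x \<notin> \<Gamma>"
        \<comment> \<open>Off \<open>\<Gamma>\<close> a point near \<open>q\<close> lies on one of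
          the two sides, so \<open>V x\<close> is close to \<open>a\<close> or to \<open>a'\<close>;
          the choice is immaterial, as both have the same inner product with
          \<open>b\<close>.\<close>
        have "g1 x \<noteq> 0" "g2 x \<noteq> 0"
          using local_equation_eq[OF 1(2)] local_equation_eq[OF 2(2)] elim(2,3) x by auto
        then have "norm (V x - a) < d \<or> norm (V x - a') < d"
          using 1(4)[OF elim(2) _ x] 2(4)[OF elim(3) _ x] elim(1) by force
        then obtain c where c: "c = a \<or> c = a'" "norm (V x - c) < d" by blast
        have cb: "c \<bullet> b = a \<bullet> b" using c(1) aa by auto
        have "V x \<bullet> grad g x - a \<bullet> b = (V x - c) \<bullet> grad g x + c \<bullet> (grad g x - b)"
          unfolding cb[symmetric] by (simp add: inner_diff_left inner_diff_right)
        also have "\<bar>\<dots>\<bar> \<le> norm (V x - c) * norm (grad g x) + norm c * norm (grad g x - b)"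
          by (rule order_trans[OF abs_triangle_ineq add_mono[OF Cauchy_Schwarz_ineq2 Cauchy_Schwarz_ineq2]])
        also have "norm (V x - c) * norm (grad g x) \<le> d * (norm b + 1)"
          using c(2) elim(4) d(1) by (intro mult_mono) auto
        also have "norm c * norm (grad g x - b) \<le> (norm a + norm a') * norm (grad g x - b)"
          using c(1) by (intro mult_right_mono) auto
        finally show "\<bar>V x \<bullet> grad g x - a \<bullet> b\<bar> < e" using elim(5) d(2) by linarith
      qed
    qed
    then show ?thesis unfolding eventually_at_filter
      by eventually_elim (simp add: dist_real_def)
  qed
  then have "((\<lambda>x. V x \<bullet> grad g x) \<longlongrightarrow> a \<bullet> b) (at q within - \<Gamma>)" by (rule tendstoI)
  then show ?thesis by blast
qed

text \<open>A point outside \<open>closure A\<close> has a ball free of \<open>A\<close>, in which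
  \<open>\<Gamma>\<close> consists of the hypersurface alone. All its points there are matched, so
  the normal component has a limit at each of them and extends continuously across
  \<open>\<Gamma>\<close>.\<close>

lemma J_zero_near:
  assumes m: "\<And>p. p \<in> \<Gamma> - A \<Longrightarrow> matched p" and p: "p \<in> \<Omega> - closure A"
  shows "\<exists>r>0. \<forall>f Df. C1c (ball p r) f Df \<longrightarrow> J f Df = 0"
proof (cases "p \<in> \<Gamma>")
  case False
  then obtain r where r: "0 < r" "ball p r \<subseteq> \<Omega> - \<Gamma>"
    using p open_W open_contains_ball by blast
  have "J f Df = 0" if "C1c (ball p r) f Df" for f Df
    by (rule J_W[OF C1c_mono[OF that r(2)]])
  then show ?thesis using r(1) by blast
next
  case True
  then have pM: "p \<in> \<Gamma> - A" using p closure_subset by blast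
  then obtain U g where U: "p \<in> U" and g: "local_equation (\<Gamma> - A) U g"
    using hyp unfolding C1_hypersurface_def by blast
  interpret C1_on U g "grad g" by (rule local_equation_C1_on[OF g])
  define b where "b = grad g p"
  have "0 < grad g p \<bullet> b" using local_equation_grad_nonzero[OF g U] by (simp add: b_def)
  moreover have "open (\<Omega> - closure A)" using open_\<Omega> by auto
  ultimately obtain R c where R: "0 < R" "0 < c" "ball p R \<subseteq> U \<inter> (\<Omega> - closure A)" "\<And>x. x \<in> ball p R \<Longrightarrow> c \<le> grad g x \<bullet> b"
    using ball_dir_lower_bound[OF U] p by blast
  define B where "B = ball p R"
  have B: "B \<subseteq> U" "B \<subseteq> \<Omega>" "B \<inter> A = {}" using R(3) closure_subset by (auto simp: B_def)
  interpret L: flux_layer \<Omega> "\<Omega> - \<Gamma>" "closure A" "\<Gamma> - A" V H B g "grad g"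
  proof
    show "(\<Gamma> - A) \<inter> B = {x \<in> B. g x = 0}" using local_equation_eq[OF g] B(1) by blast
  qed (use B G continuous_on_subset[OF cont_dg] in \<open>auto simp: B_def\<close>)
  define S where "S = B - \<Gamma>"
  have Sc: "B \<subseteq> closure S"
  proof
    fix x assume x: "x \<in> B"
    show "x \<in> closure S"
      unfolding closure_iff_nhds_not_empty
    proof (intro allI impI)
      fix N O' assume "O' \<subseteq> N" "open O'" "x \<in> O'"
      moreover from this obtain y where "y \<in> O' \<inter> B" "y \<notin> \<Gamma>"
        using exists_off_\<Gamma>[of "O' \<inter> B" x] x L.open_U by blast
      ultimately show "S \<inter> N \<noteq> {}" unfolding S_def by blast
    qed
  qed
  have cf: "continuous_on S (\<lambda>x. V x \<bullet> grad g x)"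
    using B by (intro continuous_intros continuous_on_subset[OF V_cont] continuous_on_subset[OF cont_dg])
      (auto simp: S_def)
  have lim: "\<exists>L. ((\<lambda>x. V x \<bullet> grad g x) \<longlongrightarrow> L) (at q within S)" if q: "q \<in> B - S" for q
  proof -
    have "q \<in> \<Gamma> - A" "q \<in> U" using q B by (auto simp: S_def)
    then obtain L where "((\<lambda>x. V x \<bullet> grad g x) \<longlongrightarrow> L) (at q within - \<Gamma>)"
      using normal_component_limit[OF _ _ g m] by blast
    then have "((\<lambda>x. V x \<bullet> grad g x) \<longlongrightarrow> L) (at q within S)"
      by (rule tendsto_within_subset) (auto simp: S_def)
    then show ?thesis by blast
  qed
  obtain w where w: "continuous_on B w" "\<And>x. x \<in> S \<Longrightarrow> w x = V x \<bullet> grad g x"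
    using continuous_extension_to_closure[OF L.open_U _ Sc cf lim] unfolding S_def by blast
  \<comment> \<open>Half the radius leaves room for the auxiliary bump that is 1 on the smaller
    ball.\<close>
  have "J f Df = 0" if f: "C1c (ball p (R / 2)) f Df" for f Df
  proof (rule L.J_zero_if_continuous[OF _ f _ R(2) _ w(1)])
    show "B = ball p (2 * (R / 2))" by (simp add: B_def)
    show "c \<le> grad g x \<bullet> b" if "x \<in> B" for x using R(4) that by (simp add: B_def)
    show "w x = V x \<bullet> grad g x" if "x \<in> B - (\<Gamma> - A)" for x
      using w(2)[of x] that B(3) by (auto simp: S_def)
  qed (use R(1) in auto)
  then show ?thesis using R(1) by (intro exI[of _ "R / 2"]) auto
qed

text \<open>Away from \<open>closure A\<close> the functional vanishes locally, and additivity
  together with cut-offs extends this to every compact support. The set \<open>closure A\<close> is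
  then removed.\<close>

lemma J_zero_if_matched:
  assumes m: "\<And>p. p \<in> \<Gamma> - A \<Longrightarrow> matched p" and f: "C1c \<Omega> f Df"
  shows "J f Df = 0"
proof (rule J_remove_E[OF _ order_refl f])
  fix f Df assume f: "C1c (\<Omega> - closure A) f Df"
  have "\<exists>s. p \<in> \<Omega> - closure A \<longrightarrow> 0 < s \<and> (\<forall>f Df. C1c (ball p (2 * s)) f Df \<longrightarrow> J f Df = 0)" for p
  proof (cases "p \<in> \<Omega> - closure A")
    case True
    obtain r where "0 < r" "\<forall>f Df. C1c (ball p r) f Df \<longrightarrow> J f Df = 0" using J_zero_near[OF m True] by blast
    then show ?thesis by (intro exI[of _ "r / 2"]) simp
  qed blast
  then obtain s where s: "\<And>p. p \<in> \<Omega> - closure A \<Longrightarrow> 0 < s p"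
    "\<And>p f Df. p \<in> \<Omega> - closure A \<Longrightarrow> C1c (ball p (2 * s p)) f Df \<Longrightarrow> J f Df = 0" by metis
  obtain K where K: "compact K" "K \<subseteq> \<Omega> - closure A" "\<And>x. x \<notin> K \<Longrightarrow> f x = 0" "\<And>x. x \<notin> K \<Longrightarrow> Df x = 0"
    using C1c_support[OF f] by blast
  have "K \<subseteq> (\<Union>p\<in>K. ball p (s p))" using s(1) K(2) by force
  then obtain T where T: "T \<subseteq> K" "finite T" "K \<subseteq> (\<Union>p\<in>T. ball p (s p))"
    using compactE_image[OF K(1), of K "\<lambda>p. ball p (s p)"] by auto
  \<comment> \<open>A partition of unity by induction on the cover: \<open>f\<close> times
    \<open>1 - cut p (s p) x\<close> lives in the ball of radius \<open>2 * s p\<close>, and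
    \<open>f\<close> times \<open>cut p (s p) x\<close> vanishes on the ball of radius
    \<open>s p\<close>, which may thus be dropped from the cover.\<close>
  have fin: "C1c (\<Omega> \<inter> (\<Union>p\<in>T. ball p (s p))) f Df \<Longrightarrow> J f Df = 0" if "finite T" "T \<subseteq> \<Omega> - closure A" for T f Df
    using that
  proof (induction T arbitrary: f Df rule: finite_induct)
    case empty
    have "C1c (\<Omega> - \<Gamma>) f Df" using C1c_mono[OF empty.prems(1)] by simp
    then show ?case by (rule J_W)
  next
    case (insert p T)
    have s0: "0 < s p" using insert.prems(2) by (intro s(1)) blast
    have GD: "GDERIV (\<lambda>x. 1 - cut p (s p) x) x :> - dcut p (s p) x" for x
      using C1c_GDERIV[OF C1c_bump[OF s0]] .
    have fO: "C1c \<Omega> f Df" using C1c_mono[OF insert.prems(1)] by blast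
    have 1: "C1c (ball p (2 * s p)) (\<lambda>x. (1 - cut p (s p) x) * f x) (\<lambda>x. (1 - cut p (s p) x) *\<^sub>R Df x + f x *\<^sub>R (- dcut p (s p) x))"
      using C1c_mult_UNIV[OF C1c_bump[OF s0] C1c_GDERIV[OF fO] C1c_continuous_D[OF fO]] .
    have fb: "C1c \<Omega> (\<lambda>x. f x * (1 - cut p (s p) x)) (\<lambda>x. f x *\<^sub>R (- dcut p (s p) x) + (1 - cut p (s p) x) *\<^sub>R Df x)"
      by (rule C1c_mult_UNIV[OF fO GD]) (intro continuous_intros continuous_on_dcut)
    have 2: "C1c \<Omega> (\<lambda>x. f x * cut p (s p) x) (\<lambda>x. f x *\<^sub>R dcut p (s p) x + cut p (s p) x *\<^sub>R Df x)"
      by (rule C1c_mult_UNIV[OF fO GDERIV_cut continuous_on_dcut])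
    obtain C where C: "compact C" "C \<subseteq> \<Omega> \<inter> (\<Union>p\<in>insert p T. ball p (s p))" "\<And>x. x \<notin> C \<Longrightarrow> f x = 0"
      by (rule C1c_support[OF insert.prems(1)]) (rule that)
    have "C1c (\<Omega> \<inter> (\<Union>p\<in>T. ball p (s p))) (\<lambda>x. f x * cut p (s p) x) (\<lambda>x. f x *\<^sub>R dcut p (s p) x + cut p (s p) x *\<^sub>R Df x)"
      unfolding C1c_def
    proof (intro conjI exI)
      show "\<forall>x. GDERIV (\<lambda>x. f x * cut p (s p) x) x :> f x *\<^sub>R dcut p (s p) x + cut p (s p) x *\<^sub>R Df x"
        using C1c_GDERIV[OF 2] by blast
      show "continuous_on UNIV (\<lambda>x. f x *\<^sub>R dcut p (s p) x + cut p (s p) x *\<^sub>R Df x)"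
        by (rule C1c_continuous_D[OF 2])
      show "compact (C - ball p (s p))" by (rule compact_diff[OF C(1) open_ball])
      show "C - ball p (s p) \<subseteq> \<Omega> \<inter> (\<Union>p\<in>T. ball p (s p))" using C(2) by blast
      show "\<forall>x. x \<notin> C - ball p (s p) \<longrightarrow> f x * cut p (s p) x = 0"
        using C(3) cut_eq_0[OF s0, of p] by auto
    qed
    then have z2: "J (\<lambda>x. f x * cut p (s p) x) (\<lambda>x. f x *\<^sub>R dcut p (s p) x + cut p (s p) x *\<^sub>R Df x) = 0"
      using insert.IH insert.prems(2) by blast
    have "J (\<lambda>x. (1 - cut p (s p) x) * f x) (\<lambda>x. (1 - cut p (s p) x) *\<^sub>R Df x + f x *\<^sub>R (- dcut p (s p) x)) = 0"
      by (rule s(2)[OF _ 1]) (use insert.prems(2) in blast)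
    then have z1: "J (\<lambda>x. f x * (1 - cut p (s p) x)) (\<lambda>x. f x *\<^sub>R (- dcut p (s p) x) + (1 - cut p (s p) x) *\<^sub>R Df x) = 0"
      by (simp add: mult.commute add.commute)
    have e: "(\<lambda>x. f x * (1 - cut p (s p) x) + f x * cut p (s p) x) = f"
      "(\<lambda>x. (f x *\<^sub>R (- dcut p (s p) x) + (1 - cut p (s p) x) *\<^sub>R Df x) + (f x *\<^sub>R dcut p (s p) x + cut p (s p) x *\<^sub>R Df x)) = Df"
      by (auto simp: fun_eq_iff algebra_simps)
    show ?case using J_add[OF fb 2] z1 z2 unfolding e by simp
  qed
  have "C1c (\<Omega> \<inter> (\<Union>p\<in>T. ball p (s p))) f Df"
    unfolding C1c_def
    by (intro conjI exI[of _ K]) (use C1c_GDERIV[OF f] C1c_continuous_D[OF f] K T(3) in auto)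
  then show "J f Df = 0" using fin[OF T(2)] T(1) K(2) by blast
qed

end

section \<open>Reduction of the weak formulation to the functional \<open>J\<close>\<close>

text \<open>Completeness of Lebesgue measure supplies the measurability of \<open>g\<close>. In the
  application \<open>g\<close> involves an arbitrary representative of the weak gradient, which is
  known only up to a null set.\<close>

lemma lebesgue_integral_spike:
  fixes f g :: "'a::euclidean_space \<Rightarrow> real"
  assumes f: "integrable lebesgue f" and Z: "negligible Z" and eq: "\<And>x. x \<notin> Z \<Longrightarrow> g x = f x"
  shows "(\<integral>x. g x \<partial>lebesgue) = (\<integral>x. f x \<partial>lebesgue)"
proof (rule integral_cong_AE)
  have "f absolutely_integrable_on UNIV" using f by (simp add: set_integrable_def)
  then have "g absolutely_integrable_on UNIV"
    by (rule absolutely_integrable_spike[OF _ Z]) (use eq in auto)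
  then show "g \<in> borel_measurable lebesgue" by (simp add: set_integrable_def)
  show "f \<in> borel_measurable lebesgue" using f by simp
  have "Z \<in> null_sets lebesgue" using Z by (simp add: negligible_iff_null_sets)
  then show "AE x in lebesgue. g x = f x" by (rule AE_I') (use eq in auto)
qed

lemma test_functions_uminus:
  assumes "\<phi> \<in> test_functions \<Omega>"
  shows "(\<lambda>x. - \<phi> x) \<in> test_functions \<Omega>" and "grad (\<lambda>x. - \<phi> x) = (\<lambda>x. - grad \<phi> x)"
proof -
  have "\<forall>k. Ck_on k UNIV (\<lambda>x. - \<phi> x)"
    using assms Ck_on_uminus[OF open_UNIV] unfolding test_functions_def by blast
  then show "(\<lambda>x. - \<phi> x) \<in> test_functions \<Omega>"
    using assms unfolding test_functions_def by simp
  show "grad (\<lambda>x. - \<phi> x) = (\<lambda>x. - grad \<phi> x)"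
    using grad_eqI[OF GDERIV_minus[OF C1c_GDERIV[OF test_functions_C1c[OF assms]]]] by (rule ext)
qed

text \<open>Off the null set \<open>Z\<close>, the points of \<open>\<Omega>\<close> lie in
  \<open>W\<close>, satisfy \<open>Du x = D x\<close> and are not singular. The right-hand side does
  not mention \<open>Du\<close>, so every representative of the weak gradient leads to the same
  functional.\<close>

lemma (in flux) weak_form_eq_J:
  assumes V: "\<And>x. V x = N_field D F x" and Du: "negligible {x \<in> W. Du x \<noteq> D x}"
    and nz: "singular_set W D F = {}" and \<phi>: "\<phi> \<in> test_functions \<Omega>"
  shows "(LINT x:singular_set \<Omega> Du F|lebesgue. norm (grad \<phi> x))
        + (LINT x:\<Omega> - singular_set \<Omega> Du F|lebesgue. N_field Du F x \<bullet> grad \<phi> x)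
        + (LINT x:\<Omega>|lebesgue. H x * \<phi> x) = J \<phi> (grad \<phi>)"
proof -
  define Z where "Z = (\<Omega> - W) \<union> {x \<in> W. Du x \<noteq> D x}"
  have "negligible (\<Omega> - W)" using null by (simp add: negligible_iff_null_sets null_sets_completionI)
  then have Z: "negligible Z" unfolding Z_def using Du by (rule negligible_Un)
  have S: "x \<notin> singular_set \<Omega> Du F" if "x \<notin> Z" for x
  proof
    assume "x \<in> singular_set \<Omega> Du F"
    then have s: "x \<in> \<Omega>" "Du x + F x = 0" by (auto simp: singular_set_def)
    then have "x \<in> W" "Du x = D x" using that by (auto simp: Z_def)
    then have "x \<in> singular_set W D F" using s(2) by (simp add: singular_set_def)
    then show False using nz by blast
  qed
  note C = test_functions_C1c[OF \<phi>]
  obtain K where K: "compact K" "K \<subseteq> \<Omega>" "\<And>x. x \<notin> K \<Longrightarrow> \<phi> x = 0"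
    by (rule C1c_support[OF C]) (rule that)
  have iV: "integrable lborel (\<lambda>x. indicator W x * (V x \<bullet> grad \<phi> x))" by (rule integrable_V[OF C1c_integrable_D[OF C]])
  have iH: "integrable lborel (\<lambda>x. indicator W x * (H x * \<phi> x))" by (rule integrable_H[OF C1c_continuous[OF C] K])
  have "(LINT x:singular_set \<Omega> Du F|lebesgue. norm (grad \<phi> x)) = (\<integral>x. (0::real) \<partial>(lebesgue :: 'a measure))"
    unfolding set_lebesgue_integral_def by (rule lebesgue_integral_spike[OF _ Z]) (use S in auto)
  moreover have "(LINT x:\<Omega> - singular_set \<Omega> Du F|lebesgue. N_field Du F x \<bullet> grad \<phi> x)
     = (\<integral>x. indicator W x * (V x \<bullet> grad \<phi> x) \<partial>lebesgue)"
    unfolding set_lebesgue_integral_def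
  proof (rule lebesgue_integral_spike[OF integral_lebesgue_lborel(1)[OF iV] Z])
    fix x assume x: "x \<notin> Z"
    show "indicator (\<Omega> - singular_set \<Omega> Du F) x *\<^sub>R (N_field Du F x \<bullet> grad \<phi> x) = indicator W x * (V x \<bullet> grad \<phi> x)"
      using S[OF x] x WO by (cases "x \<in> W") (auto simp: V Z_def N_field_def indicator_def)
  qed
  moreover have "(LINT x:\<Omega>|lebesgue. H x * \<phi> x) = (\<integral>x. indicator W x * (H x * \<phi> x) \<partial>lebesgue)"
    unfolding set_lebesgue_integral_def
  proof (rule lebesgue_integral_spike[OF integral_lebesgue_lborel(1)[OF iH] Z])
    fix x assume x: "x \<notin> Z"
    show "indicator \<Omega> x *\<^sub>R (H x * \<phi> x) = indicator W x * (H x * \<phi> x)"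
      using x WO by (auto simp: Z_def indicator_def)
  qed
  moreover have "J \<phi> (grad \<phi>) = (LBINT x. indicator W x * (V x \<bullet> grad \<phi> x)) + (LBINT x. indicator W x * (H x * \<phi> x))"
    unfolding J_def Bochner_Integration.integral_add[OF iV iH, symmetric] by (simp add: distrib_left)
  ultimately show ?thesis
    using integral_lebesgue_lborel(2)[OF iV] integral_lebesgue_lborel(2)[OF iH] by simp
qed

theorem theorem6p3:
  fixes \<Omega> \<Gamma> A :: "(real ^ 'm) set"
    and J :: "nat set" and \<Omega>s :: "nat \<Rightarrow> (real ^ 'm) set"
    and F :: "real ^ 'm \<Rightarrow> real ^ 'm" and H u :: "real ^ 'm \<Rightarrow> real"
    and N_bdry :: "nat \<Rightarrow> real ^ 'm \<Rightarrow> real ^ 'm \<Rightarrow> real ^ 'm"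
  assumes "domain \<Omega>" and "bounded \<Omega>"
    and "A \<subseteq> \<Gamma>" and "\<Gamma> \<subseteq> \<Omega>"
    and "closedin (top_of_set \<Omega>) \<Gamma>"
    and "hausdorff_measure (CARD('m) - 1) (closure A) = 0"
    and "C1_hypersurface (\<Gamma> - A)"
    and "\<And>j. j \<in> J \<Longrightarrow> domain (\<Omega>s j)"
    and "disjoint_family_on \<Omega>s J"
    and "\<Omega> - \<Gamma> = (\<Union>j\<in>J. \<Omega>s j)"
    and "\<And>j. j \<in> J \<Longrightarrow> frontier (\<Omega>s j) \<subseteq> frontier \<Omega> \<union> \<Gamma>"
    and "Ck_on 1 (\<Omega> - \<Gamma>) F" and "locally_L1 \<Omega> F"
    and "continuous_on (\<Omega> - \<Gamma>) H" and "locally_L1 \<Omega> H"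
    and "Ck_on 1 (\<Omega> - \<Gamma>) u" and "weakly_differentiable \<Omega> u"
    and "singular_set (\<Omega> - \<Gamma>) (grad u) F = {}"
    and "\<And>j. j \<in> J \<Longrightarrow> continuous_on_cut \<Gamma> A (\<Omega>s j) (N_field (grad u) F) (N_bdry j)"
    and "\<And>j. j \<in> J \<Longrightarrow> Ck_on 1 (\<Omega>s j) (N_field (grad u) F)"
    and "\<And>j x. j \<in> J \<Longrightarrow> x \<in> \<Omega>s j \<Longrightarrow> divergence (N_field (grad u) F) x = H x"
  shows "weak_solution \<Omega> F H u \<longleftrightarrow>
    (\<forall>p\<in>\<Gamma> - A. \<exists>j\<in>J. \<exists>l\<in>J. \<exists>\<nu>\<^sub>j \<nu>\<^sub>l.
       outward_normal \<Gamma> A (\<Omega>s j) p \<nu>\<^sub>j \<and> outward_normal \<Gamma> A (\<Omega>s l) p \<nu>\<^sub>l \<and> \<nu>\<^sub>l = - \<nu>\<^sub>j \<and>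
       (N_bdry j p \<nu>\<^sub>j - N_bdry l p \<nu>\<^sub>l) \<bullet> \<nu>\<^sub>j = 0 \<and>
       (N_bdry j p \<nu>\<^sub>j - N_bdry l p \<nu>\<^sub>l) \<bullet> \<nu>\<^sub>l = 0)"
proof -
  interpret C: cut_flux \<Omega> \<Gamma> A J \<Omega>s "N_field (grad u) F" H N_bdry
  proof
    show "open \<Omega>" using assms(1) by (simp add: domain_def)
    show "hausdorff_measure (DIM(real ^ 'm) - 1) (closure A) = 0" using assms(6) by simp
    \<comment> \<open>Where \<open>grad u x + F x\<close> is zero, \<open>inverse 0 = 0\<close>
      makes \<open>N_field\<close> zero, so the bound holds at every point.\<close>
    show "norm (N_field (grad u) F x) \<le> 1" for x
      by (cases "grad u x + F x = 0") (auto simp: N_field_def)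
  qed (rule assms; assumption)+
  have W: "open (\<Omega> - \<Gamma>)" "\<Omega> - \<Gamma> \<subseteq> \<Omega>" using C.open_W by auto
  have m: "(\<forall>p\<in>\<Gamma> - A. \<exists>j\<in>J. \<exists>l\<in>J. \<exists>\<nu>\<^sub>j \<nu>\<^sub>l.
       outward_normal \<Gamma> A (\<Omega>s j) p \<nu>\<^sub>j \<and> outward_normal \<Gamma> A (\<Omega>s l) p \<nu>\<^sub>l \<and> \<nu>\<^sub>l = - \<nu>\<^sub>j \<and>
       (N_bdry j p \<nu>\<^sub>j - N_bdry l p \<nu>\<^sub>l) \<bullet> \<nu>\<^sub>j = 0 \<and>
       (N_bdry j p \<nu>\<^sub>j - N_bdry l p \<nu>\<^sub>l) \<bullet> \<nu>\<^sub>l = 0) \<longleftrightarrow> (\<forall>p\<in>\<Gamma> - A. C.matched p)"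
    unfolding C.matched_def by (intro ball_cong bex_cong refl) auto
  have form: "(LINT x:singular_set \<Omega> Du F|lebesgue. norm (grad \<phi> x))
        + (LINT x:\<Omega> - singular_set \<Omega> Du F|lebesgue. N_field Du F x \<bullet> grad \<phi> x)
        + (LINT x:\<Omega>|lebesgue. H x * \<phi> x) = C.J \<phi> (grad \<phi>)"
    if "weak_gradient \<Omega> u Du" "\<phi> \<in> test_functions \<Omega>" for Du \<phi>
    by (rule C.weak_form_eq_J[OF refl weak_gradient_eq_grad[OF W assms(16) that(1)] assms(18) that(2)])
  \<comment> \<open>The existential quantifier over weak gradients disappears: one exists by
    assumption, and all of them yield the same functional.\<close>
  have ws: "weak_solution \<Omega> F H u \<longleftrightarrow> (\<forall>\<phi>\<in>test_functions \<Omega>. 0 \<le> C.J \<phi> (grad \<phi>))"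
    using assms(17) unfolding weak_solution_def weakly_differentiable_def by (auto simp: form)
  have "weak_solution \<Omega> F H u \<longleftrightarrow> (\<forall>\<phi>\<in>test_functions \<Omega>. C.J \<phi> (grad \<phi>) = 0)"
    unfolding ws
  proof (intro iffI ballI)
    fix \<phi> assume pos: "\<forall>\<phi>\<in>test_functions \<Omega>. 0 \<le> C.J \<phi> (grad \<phi>)" and \<phi>: "\<phi> \<in> test_functions \<Omega>"
    have "C.J (\<lambda>x. - \<phi> x) (grad (\<lambda>x. - \<phi> x)) = - C.J \<phi> (grad \<phi>)"
      unfolding test_functions_uminus(2)[OF \<phi>] C.J_def Bochner_Integration.integral_minus[symmetric]
      by (simp add: algebra_simps)
    then show "C.J \<phi> (grad \<phi>) = 0"
      using pos \<phi> test_functions_uminus(1)[OF \<phi>] by (smt (verit) )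
  qed auto
  also have "\<dots> \<longleftrightarrow> (\<forall>p\<in>\<Gamma> - A. C.matched p)"
    using C.matched_if_J_zero C.J_zero_if_matched test_functions_C1c by blast
  finally show ?thesis unfolding m .
qed

end
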